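(* Let $w,\varphi\colon\Gamma\to[0,+\infty]$ be lower semi-continuous, and let $A_j$, $\mathrm F_j$, $\mathrm F$, $\mathrm W$, $D$ and $\mathrm E=\mathrm F+\mathrm W$ be as in the context (in particular $\mathrm F\ge 0$ is bounded below). Then $\mathrm F$ and $\mathrm E$ are lower semi-continuous for the narrow topology. Furthermore, if $w$ or $\varphi$ has compact sub-level sets and $\inf_{\gamma\in\Gamma}\varphi(\gamma)>0$, then $\mathrm E|_D$ has compact sub-level sets for the narrow topology, and there exists a minimiser $\sigma^*\in\operatorname{argmin}_{\sigma\in D}\mathrm E(\sigma)$ such that, for some $a_i\ge 0$ and $\gamma^i\in\Gamma$, $$\sigma^*=\sum_{i=1}^{s}a_i\,\delta_{\gamma^i}\qquad\text{with } s\le m(T+1)+1 .$$ If in addition $\int_\Gamma\varphi\,d\sigma^*<1$, then $s\le m(T+1)$.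
   Context: $\Omega\subset\mathbb R^d$ ($d\ge1$) is open, bounded and convex. Let $\Gamma_\infty$ be the set of pairs $\gamma=(h,\xi)$ with $h\in C([0,1];[-1,1])$ and $\xi\colon[0,1]\to\bar\Omega$ such that $\xi|_{\{h\ne0\}}$ is continuous, where two pairs $(h_1,\xi_1),(h_2,\xi_2)$ are identified if $h_1=h_2$ and $\xi_1(t)=\xi_2(t)$ for all $t$ with $h_1(t)\neq0$. It is a complete separable metric space for $$d_\Gamma((h_1,\xi_1),(h_2,\xi_2))=\sup_{t\in[0,1]}d_F\big((h_1(t),\xi_1(t)),(h_2(t),\xi_2(t))\big),$$ where $d_F((r_1,x_1),(r_2,x_2))=|r_1|+|r_2|$ if $r_1r_2\le0$ or $|x_1-x_2|\ge2$, and $d_F((r_1,x_1),(r_2,x_2))=|r_1-r_2|+\min(|r_1|,|r_2|)|x_1-x_2|$ otherwise. $\Gamma$ is a closed subset of $\Gamma_\infty$. $\mathcal M(\Gamma)$ is the space of finite signed Borel measures on $\Gamma$, $\mathcal M^+(\Gamma)$ the non-negative ones. The narrow topology is the weakest topology making $\sigma\mapsto\int\phi\,d\sigma$ continuous for each bounded continuous $\phi$. For $\sigma\in\mathcal M(\Gamma)$ and $t\in[0,1]$, the measure $\sigma_t\in\mathcal M(\bar\Omega)$ is defined by $\int_{\bar\Omega}\psi\,d\sigma_t=\int_\Gamma h(t)\psi(\xi(t))\,d\sigma(h,\xi)$ for all $\psi\in C(\bar\Omega)$. Let $t_0,\dots,t_T\in[0,1]$ and $a_i^j\in C(\bar\Omega)$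 for $i=1,\dots,m$, $j=0,\dots,T$. Define $A_j\colon\mathcal M(\bar\Omega)\to\mathbb R^m$ by $(A_j\rho)_i=\int_{\bar\Omega}a_i^j\,d\rho$. Let $\mathrm F_j\in C^2(\mathbb R^m;[0,+\infty))$ be convex, and put $$\mathrm F(\sigma)=\sum_{j=0}^T\mathrm F_j(A_j\sigma_{t_j}),\quad \mathrm W(\sigma)=\int_\Gamma w\,d\sigma,\quad D=\Big\{\sigma\in\mathcal M(\Gamma):\sigma\ge0,\ \int_\Gamma\varphi\,d\sigma\le1\Big\},\quad \mathrm E=\mathrm F+\mathrm W\colon D\to(-\infty,+\infty].$$ *)

theory Defs
  imports "HOL-Analysis.Analysis"
begin

section \<open>The path space\<close>

text \<open>
  Paths are functions on the whole real line of which only the values on \<open>{0..1}\<close> matter;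
  \<open>path_rel\<close> forgets the other values together with those of \<open>\<xi>\<close> where \<open>h\<close> vanishes.
\<close>

definition paths :: "'a::euclidean_space set \<Rightarrow> ((real \<Rightarrow> real) \<times> (real \<Rightarrow> 'a)) set" where
  "paths \<Omega> = {(h, \<xi>).
     continuous_on {0..1} h \<and> h ` {0..1} \<subseteq> {-1..1} \<and>
     \<xi> ` {0..1} \<subseteq> closure \<Omega> \<and> continuous_on {t \<in> {0..1}. h t \<noteq> 0} \<xi>}"

definition path_rel ::
  "'a::euclidean_space set \<Rightarrow> (((real \<Rightarrow> real) \<times> (real \<Rightarrow> 'a)) \<times> ((real \<Rightarrow> real) \<times> (real \<Rightarrow> 'a))) set" where
  "path_rel \<Omega> = {((h1, \<xi>1), (h2, \<xi>2)).
     (h1, \<xi>1) \<in> paths \<Omega> \<and> (h2, \<xi>2) \<in> paths \<Omega> \<and>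
     (\<forall>t\<in>{0..1}. h1 t = h2 t) \<and> (\<forall>t\<in>{0..1}. h1 t \<noteq> 0 \<longrightarrow> \<xi>1 t = \<xi>2 t)}"

type_synonym 'a curve = "((real \<Rightarrow> real) \<times> (real \<Rightarrow> 'a)) set"

definition Gamma_inf :: "'a::euclidean_space set \<Rightarrow> 'a curve set" where
  "Gamma_inf \<Omega> = paths \<Omega> // path_rel \<Omega>"

text \<open>
  The two components of an arbitrary representative. On \<open>{0..1}\<close> the first does not depend on the
  choice, and neither does the second where the first is nonzero.
\<close>

definition curve_h :: "'a curve \<Rightarrow> real \<Rightarrow> real" where
  "curve_h \<gamma> = fst (SOME p. p \<in> \<gamma>)"

definition curve_xi :: "'a curve \<Rightarrow> real \<Rightarrow> 'a" where
  "curve_xi \<gamma> = snd (SOME p. p \<in> \<gamma>)"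

definition d_F :: "real \<times> 'a::euclidean_space \<Rightarrow> real \<times> 'a \<Rightarrow> real" where
  "d_F = (\<lambda>(r1, x1) (r2, x2).
     if r1 * r2 \<le> 0 \<or> norm (x1 - x2) \<ge> 2 then \<bar>r1\<bar> + \<bar>r2\<bar>
     else \<bar>r1 - r2\<bar> + min \<bar>r1\<bar> \<bar>r2\<bar> * norm (x1 - x2))"

text \<open>The locale \<open>Metric_space\<close> wants a distance that is nonnegative off its carrier too.\<close>

definition d_Gamma :: "'a::euclidean_space set \<Rightarrow> 'a curve \<Rightarrow> 'a curve \<Rightarrow> real" where
  "d_Gamma \<Omega> \<gamma>1 \<gamma>2 = (if \<gamma>1 \<in> Gamma_inf \<Omega> \<and> \<gamma>2 \<in> Gamma_inf \<Omega>
     then SUP t\<in>{0..1}. d_F (curve_h \<gamma>1 t, curve_xi \<gamma>1 t) (curve_h \<gamma>2 t, curve_xi \<gamma>2 t)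
     else 0)"

definition Gamma_inf_top :: "'a::euclidean_space set \<Rightarrow> 'a curve topology" where
  "Gamma_inf_top \<Omega> = Metric_space.mtopology (Gamma_inf \<Omega>) (d_Gamma \<Omega>)"


section \<open>Semicontinuity and compact sub-level sets\<close>

definition lower_semicontinuous_map :: "'a topology \<Rightarrow> ('a \<Rightarrow> 'b::linorder) \<Rightarrow> bool" where
  "lower_semicontinuous_map X f \<longleftrightarrow> (\<forall>c. openin X {x \<in> topspace X. c < f x})"

text \<open>Only finite levels count: the sub-level set of level \<open>top\<close> is the whole space.\<close>

definition compact_sublevel_sets :: "'a topology \<Rightarrow> ('a \<Rightarrow> 'b::{linorder, order_top}) \<Rightarrow> bool" where
  "compact_sublevel_sets X f \<longleftrightarrow> (\<forall>c<top. compactin X {x \<in> topspace X. f x \<le> c})"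


section \<open>Finite signed Borel measures\<close>

definition borel_sets :: "'a topology \<Rightarrow> 'a set set" where
  "borel_sets X = sigma_sets (topspace X) {U. openin X U}"

text \<open>
  A signed measure is a set function, made unique by the value \<open>0\<close> outside the Borel sets.
\<close>

definition signed_measures :: "'a topology \<Rightarrow> ('a set \<Rightarrow> real) set" where
  "signed_measures X = {\<mu>.
     (\<forall>B. B \<notin> borel_sets X \<longrightarrow> \<mu> B = 0) \<and> \<mu> {} = 0 \<and>
     (\<forall>B :: nat \<Rightarrow> 'a set. range B \<subseteq> borel_sets X \<longrightarrow> disjoint_family B \<longrightarrow>
        (\<lambda>i. \<mu> (B i)) sums \<mu> (\<Union>i. B i))}"

definition nonneg_measures :: "'a topology \<Rightarrow> ('a set \<Rightarrow> real) set" where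
  "nonneg_measures X = {\<mu> \<in> signed_measures X. \<forall>B. 0 \<le> \<mu> B}"

definition to_measure :: "'a topology \<Rightarrow> ('a set \<Rightarrow> real) \<Rightarrow> 'a measure" where
  "to_measure X \<mu> = measure_of (topspace X) (borel_sets X) (\<lambda>B. ennreal (\<mu> B))"

text \<open>Integration against a signed measure goes through its Jordan decomposition.\<close>

definition jordan_pos :: "'a topology \<Rightarrow> ('a set \<Rightarrow> real) \<Rightarrow> 'a set \<Rightarrow> real" where
  "jordan_pos X \<mu> B = (SUP C\<in>{C \<in> borel_sets X. C \<subseteq> B}. \<mu> C)"

definition jordan_neg :: "'a topology \<Rightarrow> ('a set \<Rightarrow> real) \<Rightarrow> 'a set \<Rightarrow> real" where
  "jordan_neg X \<mu> = jordan_pos X (\<lambda>B. - \<mu> B)"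

definition signed_integral :: "'a topology \<Rightarrow> ('a set \<Rightarrow> real) \<Rightarrow> ('a \<Rightarrow> real) \<Rightarrow> real" where
  "signed_integral X \<mu> f =
     (\<integral>x. f x \<partial>to_measure X (jordan_pos X \<mu>)) - (\<integral>x. f x \<partial>to_measure X (jordan_neg X \<mu>))"

definition dirac :: "'a topology \<Rightarrow> 'a \<Rightarrow> 'a set \<Rightarrow> real" where
  "dirac X x B = (if B \<in> borel_sets X then indicator B x else 0)"

definition narrow_topology :: "'a topology \<Rightarrow> ('a set \<Rightarrow> real) topology" where
  "narrow_topology X = topology_generated_by
     {{\<mu> \<in> signed_measures X. signed_integral X \<mu> f \<in> U} | f U.
        continuous_map X euclideanreal f \<and> bounded (f ` topspace X) \<and> open U}"


section \<open>The energy\<close>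

text \<open>In this section \<open>X\<close> is the topological space \<open>\<Gamma>\<close>.\<close>

definition time_slice ::
  "'a::euclidean_space set \<Rightarrow> 'a curve topology \<Rightarrow> ('a curve set \<Rightarrow> real) \<Rightarrow> real \<Rightarrow> 'a set \<Rightarrow> real" where
  "time_slice \<Omega> X \<sigma> t = (THE \<rho>. \<rho> \<in> signed_measures (top_of_set (closure \<Omega>)) \<and>
     (\<forall>\<psi>. continuous_on (closure \<Omega>) \<psi> \<longrightarrow>
        signed_integral (top_of_set (closure \<Omega>)) \<rho> \<psi> =
        signed_integral X \<sigma> (\<lambda>\<gamma>. curve_h \<gamma> t * \<psi> (curve_xi \<gamma> t))))"

definition forward_op ::
  "'a::euclidean_space set \<Rightarrow> ('m::finite \<Rightarrow> 'a \<Rightarrow> real) \<Rightarrow> ('a set \<Rightarrow> real) \<Rightarrow> real ^ 'm" where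
  "forward_op \<Omega> a \<rho> = (\<chi> i. signed_integral (top_of_set (closure \<Omega>)) \<rho> (a i))"

definition fidelity ::
  "'a::euclidean_space set \<Rightarrow> 'a curve topology \<Rightarrow> nat \<Rightarrow> (nat \<Rightarrow> real) \<Rightarrow>
   (nat \<Rightarrow> 'm::finite \<Rightarrow> 'a \<Rightarrow> real) \<Rightarrow> (nat \<Rightarrow> real ^ 'm \<Rightarrow> real) \<Rightarrow> ('a curve set \<Rightarrow> real) \<Rightarrow> real" where
  "fidelity \<Omega> X T t a F \<sigma> = (\<Sum>j=0..T. F j (forward_op \<Omega> (a j) (time_slice \<Omega> X \<sigma> (t j))))"

definition regulariser :: "'g topology \<Rightarrow> ('g \<Rightarrow> ennreal) \<Rightarrow> ('g set \<Rightarrow> real) \<Rightarrow> ennreal" where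
  "regulariser X w \<sigma> = (\<integral>\<^sup>+\<gamma>. w \<gamma> \<partial>to_measure X \<sigma>)"

definition admissible :: "'g topology \<Rightarrow> ('g \<Rightarrow> ennreal) \<Rightarrow> ('g set \<Rightarrow> real) set" where
  "admissible X \<phi> = {\<sigma> \<in> nonneg_measures X. (\<integral>\<^sup>+\<gamma>. \<phi> \<gamma> \<partial>to_measure X \<sigma>) \<le> 1}"

definition energy ::
  "'a::euclidean_space set \<Rightarrow> 'a curve topology \<Rightarrow> nat \<Rightarrow> (nat \<Rightarrow> real) \<Rightarrow>
   (nat \<Rightarrow> 'm::finite \<Rightarrow> 'a \<Rightarrow> real) \<Rightarrow> (nat \<Rightarrow> real ^ 'm \<Rightarrow> real) \<Rightarrow> ('a curve \<Rightarrow> ennreal) \<Rightarrow>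
   ('a curve set \<Rightarrow> real) \<Rightarrow> ereal" where
  "energy \<Omega> X T t a F w \<sigma> = ereal (fidelity \<Omega> X T t a F \<sigma>) + enn2ereal (regulariser X w \<sigma>)"

definition C2_function :: "('a::real_normed_vector \<Rightarrow> real) \<Rightarrow> bool" where
  "C2_function f \<longleftrightarrow> (\<exists>(f' :: 'a \<Rightarrow> 'a \<Rightarrow>\<^sub>L real) (f'' :: 'a \<Rightarrow> 'a \<Rightarrow>\<^sub>L 'a \<Rightarrow>\<^sub>L real).
     (\<forall>x. (f has_derivative blinfun_apply (f' x)) (at x)) \<and>
     (\<forall>x. (f' has_derivative blinfun_apply (f'' x)) (at x)) \<and>
     continuous_on UNIV f'')"


section \<open>The distance on the path space is a metric\<close>

lemma equiv_path_rel: "equiv (paths \<Omega>) (path_rel \<Omega>)"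
  unfolding equiv_def refl_on_def sym_def trans_def path_rel_def by auto

lemma curve_representative:
  assumes "\<gamma> \<in> Gamma_inf \<Omega>"
  shows "(curve_h \<gamma>, curve_xi \<gamma>) \<in> \<gamma>" "(curve_h \<gamma>, curve_xi \<gamma>) \<in> paths \<Omega>"
proof -
  have "\<gamma> \<noteq> {}"
    using assms equiv_path_rel in_quotient_imp_non_empty unfolding Gamma_inf_def by blast
  then show *: "(curve_h \<gamma>, curve_xi \<gamma>) \<in> \<gamma>"
    by (simp add: curve_h_def curve_xi_def some_in_eq)
  show "(curve_h \<gamma>, curve_xi \<gamma>) \<in> paths \<Omega>"
    using * assms equiv_path_rel in_quotient_imp_subset unfolding Gamma_inf_def by blast
qed

lemma curve_h_bound: "\<gamma> \<in> Gamma_inf \<Omega> \<Longrightarrow> t \<in> {0..1} \<Longrightarrow> \<bar>curve_h \<gamma> t\<bar> \<le> 1"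
  using curve_representative(2)[of \<gamma> \<Omega>] by (force simp: paths_def image_subset_iff abs_le_iff)

lemma curve_eq_iff:
  assumes "\<gamma>1 \<in> Gamma_inf \<Omega>" "\<gamma>2 \<in> Gamma_inf \<Omega>"
  shows "\<gamma>1 = \<gamma>2 \<longleftrightarrow> (\<forall>t\<in>{0..1}. curve_h \<gamma>1 t = curve_h \<gamma>2 t) \<and>
           (\<forall>t\<in>{0..1}. curve_h \<gamma>1 t \<noteq> 0 \<longrightarrow> curve_xi \<gamma>1 t = curve_xi \<gamma>2 t)"
  using quotient_eq_iff[OF equiv_path_rel, of \<gamma>1 \<Omega> \<gamma>2] assms curve_representative[OF assms(1)]
    curve_representative[OF assms(2)]
  by (auto simp: Gamma_inf_def path_rel_def)

lemma d_F_alt: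
  "d_F (r1, x1) (r2, x2) =
     \<bar>r1 - r2\<bar> + (if r1 * r2 \<le> 0 then 0 else min \<bar>r1\<bar> \<bar>r2\<bar> * min 2 (norm (x1 - x2)))"
  by (auto simp: d_F_def min_def abs_if mult_le_0_iff algebra_simps)

lemma d_F_nonneg: "0 \<le> d_F p q"
  by (cases p; cases q) (auto simp: d_F_def)

lemma d_F_commute: "d_F p q = d_F q p"
  by (cases p; cases q) (auto simp: d_F_def norm_minus_commute mult.commute min.commute)

lemma d_F_bound: "\<bar>r1\<bar> \<le> 1 \<Longrightarrow> \<bar>r2\<bar> \<le> 1 \<Longrightarrow> d_F (r1, x1) (r2, x2) \<le> 4"
proof -
  assume r: "\<bar>r1\<bar> \<le> 1" "\<bar>r2\<bar> \<le> 1"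
  have "min \<bar>r1\<bar> \<bar>r2\<bar> * min 2 (norm (x1 - x2)) \<le> 1 * 2"
    using r by (intro mult_mono) auto
  moreover have "\<bar>r1 - r2\<bar> \<le> 2"
    using r by linarith
  ultimately show ?thesis
    unfolding d_F_alt by auto
qed

lemma d_F_eq_0_iff: "d_F (r1, x1) (r2, x2) = 0 \<longleftrightarrow> r1 = r2 \<and> (r1 \<noteq> 0 \<longrightarrow> x1 = x2)"
proof -
  have "0 \<le> (if r1 * r2 \<le> 0 then 0 else min \<bar>r1\<bar> \<bar>r2\<bar> * min 2 (norm (x1 - x2)))"
    by auto
  then have "d_F (r1, x1) (r2, x2) = 0 \<longleftrightarrow> r1 = r2 \<and>
      (if r1 * r2 \<le> 0 then 0 else min \<bar>r1\<bar> \<bar>r2\<bar> * min 2 (norm (x1 - x2))) = 0"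
    unfolding d_F_alt by linarith
  also have "\<dots> \<longleftrightarrow> r1 = r2 \<and> (r1 \<noteq> 0 \<longrightarrow> x1 = x2)"
    by (auto simp: mult_le_0_iff min_def)
  finally show ?thesis .
qed

lemma d_F_triangle: "d_F p1 p3 \<le> d_F p1 p2 + d_F p2 p3"
proof -
  define m :: "real \<Rightarrow> real \<Rightarrow> real"
    where "m = (\<lambda>r s. if r * s \<le> 0 then 0 else min \<bar>r\<bar> \<bar>s\<bar>)"
  obtain r1 x1 r2 x2 r3 x3 where p: "p1 = (r1, x1)" "p2 = (r2, x2)" "p3 = (r3, x3)"
    by (cases p1, cases p2, cases p3) auto
  define n12 n23 n13 where n: "n12 = min 2 (norm (x1 - x2))" "n23 = min 2 (norm (x2 - x3))"
    "n13 = min 2 (norm (x1 - x3))"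
  have d: "d_F (r, x) (s, y) = \<bar>r - s\<bar> + m r s * min 2 (norm (x - y))" for r s and x y :: 'a
    by (simp add: d_F_alt m_def)
  have tri: "n13 \<le> n12 + n23" "0 \<le> n12" "0 \<le> n23" "0 \<le> n13" "n13 \<le> 2"
    using norm_diff_triangle_le[of x1 x2 _ x3, OF order_refl order_refl] norm_ge_zero[of "x1 - x2"]
      norm_ge_zero[of "x2 - x3"] norm_ge_zero[of "x1 - x3"] unfolding n by (smt (verit))+
  define k where "k = min (m r1 r2) (m r2 r3)"
  have m0: "0 \<le> m r s" for r s
    by (auto simp: m_def)
  have k: "0 \<le> k" "k \<le> m r1 r2" "k \<le> m r2 r3"
    using m0 by (auto simp: k_def)
  have *: "\<bar>r1 - r3\<bar> + 2 * max 0 (m r1 r3 - k) \<le> \<bar>r1 - r2\<bar> + \<bar>r2 - r3\<bar>"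
  proof -
    have "m r s = (if 0 < r \<and> 0 < s then min r s else if r < 0 \<and> s < 0 then min (-r) (-s) else 0)"
      for r s
      by (auto simp: m_def mult_le_0_iff)
    then show ?thesis
      unfolding k_def min_def by (smt (verit))
  qed
  have "m r1 r3 * n13 \<le> (k + max 0 (m r1 r3 - k)) * n13"
    using tri by (intro mult_right_mono) auto
  also have "\<dots> \<le> k * (n12 + n23) + max 0 (m r1 r3 - k) * 2"
    unfolding distrib_right using tri k by (intro add_mono mult_left_mono) auto
  also have "k * (n12 + n23) \<le> m r1 r2 * n12 + m r2 r3 * n23"
    unfolding distrib_left using tri k by (intro add_mono mult_right_mono) auto
  finally show ?thesis
    using * unfolding p d by (simp add: n)
qed

lemma Metric_space_Gamma_inf: "Metric_space (Gamma_inf \<Omega>) (d_Gamma \<Omega>)"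
proof -
  let ?d = "\<lambda>\<gamma>1 \<gamma>2 t. d_F (curve_h \<gamma>1 t, curve_xi \<gamma>1 t) (curve_h \<gamma>2 t, curve_xi \<gamma>2 t)"
  have bdd: "bdd_above (?d \<gamma>1 \<gamma>2 ` {0..1})" if "\<gamma>1 \<in> Gamma_inf \<Omega>" "\<gamma>2 \<in> Gamma_inf \<Omega>" for \<gamma>1 \<gamma>2
    using d_F_bound curve_h_bound[OF that(1)] curve_h_bound[OF that(2)]
    by (intro bdd_aboveI2[where M = 4]) blast
  have upper: "?d \<gamma>1 \<gamma>2 t \<le> d_Gamma \<Omega> \<gamma>1 \<gamma>2"
    if "\<gamma>1 \<in> Gamma_inf \<Omega>" "\<gamma>2 \<in> Gamma_inf \<Omega>" "t \<in> {0..1}" for \<gamma>1 \<gamma>2 t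
    using that cSUP_upper[OF that(3) bdd[OF that(1,2)]] by (simp add: d_Gamma_def)
  have least: "d_Gamma \<Omega> \<gamma>1 \<gamma>2 \<le> c" 
    if "\<gamma>1 \<in> Gamma_inf \<Omega>" "\<gamma>2 \<in> Gamma_inf \<Omega>" "\<And>t. t \<in> {0..1} \<Longrightarrow> ?d \<gamma>1 \<gamma>2 t \<le> c" for \<gamma>1 \<gamma>2 c
    unfolding d_Gamma_def using that by (auto intro!: cSUP_least)
  show ?thesis
  proof
    show "0 \<le> d_Gamma \<Omega> \<gamma>1 \<gamma>2" for \<gamma>1 \<gamma>2
    proof (cases "\<gamma>1 \<in> Gamma_inf \<Omega> \<and> \<gamma>2 \<in> Gamma_inf \<Omega>")
      case True
      then show ?thesis
        using order_trans[OF d_F_nonneg upper[of \<gamma>1 \<gamma>2 0]] by simp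
    qed (auto simp: d_Gamma_def)
    show "d_Gamma \<Omega> \<gamma>1 \<gamma>2 = d_Gamma \<Omega> \<gamma>2 \<gamma>1" for \<gamma>1 \<gamma>2
    proof -
      have "?d \<gamma>1 \<gamma>2 = ?d \<gamma>2 \<gamma>1"
        by (rule ext) (rule d_F_commute)
      then show ?thesis
        unfolding d_Gamma_def by presburger
    qed
    show "d_Gamma \<Omega> \<gamma>1 \<gamma>2 = 0 \<longleftrightarrow> \<gamma>1 = \<gamma>2" if "\<gamma>1 \<in> Gamma_inf \<Omega>" "\<gamma>2 \<in> Gamma_inf \<Omega>" for \<gamma>1 \<gamma>2
    proof -
      have "d_Gamma \<Omega> \<gamma>1 \<gamma>2 = 0 \<longleftrightarrow> (\<forall>t\<in>{0..1}. ?d \<gamma>1 \<gamma>2 t = 0)"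
      proof
        assume "d_Gamma \<Omega> \<gamma>1 \<gamma>2 = 0"
        then show "\<forall>t\<in>{0..1}. ?d \<gamma>1 \<gamma>2 t = 0"
          using upper[OF that] d_F_nonneg by (metis order_antisym)
      next
        assume "\<forall>t\<in>{0..1}. ?d \<gamma>1 \<gamma>2 t = 0"
        then show "d_Gamma \<Omega> \<gamma>1 \<gamma>2 = 0"
          by (simp add: d_Gamma_def cong: SUP_cong_simp)
      qed
      then show ?thesis
        unfolding curve_eq_iff[OF that] d_F_eq_0_iff by auto
    qed
    show "d_Gamma \<Omega> \<gamma>1 \<gamma>3 \<le> d_Gamma \<Omega> \<gamma>1 \<gamma>2 + d_Gamma \<Omega> \<gamma>2 \<gamma>3"
      if "\<gamma>1 \<in> Gamma_inf \<Omega>" "\<gamma>2 \<in> Gamma_inf \<Omega>" "\<gamma>3 \<in> Gamma_inf \<Omega>" for \<gamma>1 \<gamma>2 \<gamma>3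
    proof (rule least[OF that(1,3)])
      fix t :: real
      assume "t \<in> {0..1}"
      then show "?d \<gamma>1 \<gamma>3 t \<le> d_Gamma \<Omega> \<gamma>1 \<gamma>2 + d_Gamma \<Omega> \<gamma>2 \<gamma>3"
        using order_trans[OF d_F_triangle add_mono[OF upper[OF that(1,2)] upper[OF that(2,3)]]] by blast
    qed
  qed
qed

end

(*
  The energy sees a measure only through the m(T+1) integrals of the functions
  h(t_j) a_i^j(xi(t_j)), which are bounded and continuous on Gamma, and through the integrals of w and
  phi. A lower semicontinuous integrand is an increasing limit of bounded continuous ones, which gives
  lower semicontinuity. The sub-level sets have bounded mass and are tight. To see that a set of such
  measures is compact, embed it into a product of intervals by evaluation on all bounded continuous
  functions: a limit point is a positive linear functional that, by tightness and Dini's theorem,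
  satisfies Daniell's condition and hence is a measure.

  By Richter's theorem (Caratheodory's theorem for cones, applied to the moments of a measure) some
  finitely supported measure has the same integrals as a given minimiser. Among the finitely supported
  minimisers take one with as few atoms as possible. With more than m(T+1)+1 atoms, its weights could
  be moved along a line that fixes all observables and the integral of phi; the energy is affine on
  this line and minimal at an interior point, hence constant, and one can move until an atom
  disappears. If the constraint is inactive, the integral of phi need not be fixed.
*)
theory Submission
  imports Defs
begin

section \<open>Finite Borel measures and signed measures\<close>

text \<open>The narrow topology on signed measures is in general not metrizable, hence compactness
  is treated with covers and a product topology instead of subsequences. Two objects are given only
  implicitly: \<open>signed_integral\<close> is tied to the Jordan parts, so its linearity has to be
  recovered from additivity of set functions, and \<open>time_slice\<close> is a definite
  description, so existence and uniqueness of the slice come before its integral formula. The lower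
  bound on \<open>\<phi>\<close> enters twice: it bounds the masses of admissible measures, and it
  forces a direction along which the integral of \<open>\<phi>\<close> does not increase to decrease
  some weight, without which no atom could be removed. Richter's theorem has to reproduce the
  integrals of both \<open>w\<close> and \<open>\<phi>\<close>, two moments beyond the observables;
  the count improves because minimality already fixes the integral of \<open>w\<close>, so that only
  \<open>\<phi>\<close> costs a further atom, and only while its constraint is active.\<close>

definition borel_of :: "'a topology \<Rightarrow> 'a measure" where
  "borel_of X = sigma (topspace X) {U. openin X U}"

definition finite_borel_measure :: "'a topology \<Rightarrow> 'a measure \<Rightarrow> bool" where
  "finite_borel_measure X M \<longleftrightarrow> finite_measure M \<and> sets M = borel_sets X"

lemma openin_subset_Pow: "{U. openin X U} \<subseteq> Pow (topspace X)"
  using openin_subset by auto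

lemma space_borel_of [simp]: "space (borel_of X) = topspace X"
  by (simp add: borel_of_def space_measure_of[OF openin_subset_Pow])

lemma sets_borel_of [simp]: "sets (borel_of X) = borel_sets X"
  by (simp add: borel_of_def borel_sets_def sets_measure_of[OF openin_subset_Pow])

lemma sigma_algebra_borel_sets: "sigma_algebra (topspace X) (borel_sets X)"
  using sets.sigma_algebra_axioms[of "borel_of X"] by simp

lemma borel_sets_subset: "B \<in> borel_sets X \<Longrightarrow> B \<subseteq> topspace X"
  using sets.sets_into_space[of B "borel_of X"] by simp

lemma borel_sets_open: "openin X U \<Longrightarrow> U \<in> borel_sets X"
  unfolding borel_sets_def by auto

lemma borel_sets_ops:
  "{} \<in> borel_sets X" "topspace X \<in> borel_sets X"
  "A \<in> borel_sets X \<Longrightarrow> B \<in> borel_sets X \<Longrightarrow> A \<union> B \<in> borel_sets X"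
  "A \<in> borel_sets X \<Longrightarrow> B \<in> borel_sets X \<Longrightarrow> A \<inter> B \<in> borel_sets X"
  "A \<in> borel_sets X \<Longrightarrow> B \<in> borel_sets X \<Longrightarrow> A - B \<in> borel_sets X"
  "(\<And>i::nat. C i \<in> borel_sets X) \<Longrightarrow> (\<Union>i. C i) \<in> borel_sets X"
  using sets.empty_sets[of "borel_of X"] sets.top[of "borel_of X"] sets.Un[of A "borel_of X" B]
    sets.Int[of A "borel_of X" B] sets.Diff[of A "borel_of X" B]
    sets.countable_UN[of C UNIV "borel_of X"] by auto

lemma finite_borel_measureD:
  assumes "finite_borel_measure X M"
  shows "finite_measure M" "sets M = borel_sets X" "space M = topspace X"
  using assms sets_eq_imp_space_eq[of M "borel_of X"] by (auto simp: finite_borel_measure_def)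

text \<open>The hypotheses concern Borel sets only, so that the lemma also covers
  \<open>jordan_pos X \<mu>\<close>, which need not vanish on other sets and hence need not belong
  to \<open>signed_measures X\<close>.\<close>

lemma to_measure_of_additive:
  assumes nonneg: "\<And>B. B \<in> borel_sets X \<Longrightarrow> 0 \<le> \<mu> B" and empty: "\<mu> {} = 0"
    and sums: "\<And>B :: nat \<Rightarrow> 'a set. range B \<subseteq> borel_sets X \<Longrightarrow> disjoint_family B \<Longrightarrow>
      (\<lambda>i. \<mu> (B i)) sums \<mu> (\<Union>i. B i)"
  shows "finite_borel_measure X (to_measure X \<mu>)"
    and "\<And>B. B \<in> borel_sets X \<Longrightarrow> measure (to_measure X \<mu>) B = \<mu> B"
proof -
  interpret sigma_algebra "topspace X" "borel_sets X"
    by (rule sigma_algebra_borel_sets)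
  have sets: "sets (to_measure X \<mu>) = borel_sets X"
    by (simp add: to_measure_def)
  have e: "emeasure (to_measure X \<mu>) B = ennreal (\<mu> B)" if "B \<in> borel_sets X" for B
    unfolding to_measure_def
  proof (rule emeasure_measure_of_sigma[OF sigma_algebra_borel_sets _ _ that])
    show "positive (borel_sets X) (\<lambda>B. ennreal (\<mu> B))"
      by (simp add: positive_def empty)
    show "countably_additive (borel_sets X) (\<lambda>B. ennreal (\<mu> B))"
      unfolding countably_additive_def
    proof (intro allI impI)
      fix A :: "nat \<Rightarrow> 'a set"
      assume A: "range A \<subseteq> borel_sets X" "disjoint_family A"
      have "(\<Sum>i. ennreal (\<mu> (A i))) = ennreal (\<Sum>i. \<mu> (A i))"
        using A nonneg sums[OF A] by (intro suminf_ennreal2) (auto simp: sums_iff)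
      then show "(\<Sum>i. ennreal (\<mu> (A i))) = ennreal (\<mu> (\<Union> (range A)))"
        using sums[OF A] by (simp add: sums_iff)
    qed
  qed
  have space: "space (to_measure X \<mu>) = topspace X"
    by (simp add: to_measure_def space_measure_of_conv)
  show "finite_borel_measure X (to_measure X \<mu>)"
    unfolding finite_borel_measure_def using sets e[OF borel_sets_ops(2)]
    by (auto intro!: finite_measureI simp: space)
  show "measure (to_measure X \<mu>) B = \<mu> B" if "B \<in> borel_sets X" for B
    using e[OF that] nonneg[OF that] by (simp add: measure_def)
qed

lemma signed_measuresD:
  assumes "\<mu> \<in> signed_measures X"
  shows "B \<notin> borel_sets X \<Longrightarrow> \<mu> B = 0" "\<mu> {} = 0"
    "range C \<subseteq> borel_sets X \<Longrightarrow> disjoint_family C \<Longrightarrow> (\<lambda>i::nat. \<mu> (C i)) sums \<mu> (\<Union>i. C i)"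
  using assms unfolding signed_measures_def by auto

lemma nonneg_measuresD:
  assumes "\<mu> \<in> nonneg_measures X"
  shows "\<mu> \<in> signed_measures X" "0 \<le> \<mu> B"
  using assms unfolding nonneg_measures_def by auto

lemma finite_borel_measure_to_measure:
  assumes "\<mu> \<in> nonneg_measures X"
  shows "finite_borel_measure X (to_measure X \<mu>)" "measure (to_measure X \<mu>) = \<mu>"
proof -
  note m = nonneg_measuresD[OF assms] signed_measuresD[OF nonneg_measuresD(1)[OF assms]]
  show f: "finite_borel_measure X (to_measure X \<mu>)"
    using m by (intro to_measure_of_additive) auto
  show "measure (to_measure X \<mu>) = \<mu>"
  proof
    fix B
    show "measure (to_measure X \<mu>) B = \<mu> B"
    proof (cases "B \<in> borel_sets X")
      case True
      then show ?thesis
        using m by (intro to_measure_of_additive) auto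
    next
      case False
      then show ?thesis
        using finite_borel_measureD(2)[OF f] m by (simp add: measure_notin_sets)
    qed
  qed
qed

lemma measure_nonneg_measures:
  assumes "finite_borel_measure X M"
  shows "measure M \<in> nonneg_measures X"
  using finite_borel_measureD[OF assms] finite_measure.finite_measure_UNION[of M]
  by (auto simp: nonneg_measures_def signed_measures_def measure_notin_sets)

lemma finite_borel_measure_eqI:
  assumes "finite_borel_measure X M" "finite_borel_measure X N"
    and "\<And>B. B \<in> borel_sets X \<Longrightarrow> measure M B = measure N B"
  shows "M = N"
  using finite_borel_measureD[OF assms(1)] finite_borel_measureD[OF assms(2)] assms(3)
  by (intro measure_eqI) (auto simp: finite_measure.emeasure_eq_measure)

lemma to_measure_measure:
  assumes "finite_borel_measure X M"
  shows "to_measure X (measure M) = M"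
  using finite_borel_measure_to_measure[OF measure_nonneg_measures[OF assms]] assms
  by (intro finite_borel_measure_eqI[of X]) auto

lemma signed_measure_additive:
  assumes "\<mu> \<in> signed_measures X" "A \<in> borel_sets X" "B \<in> borel_sets X" "A \<inter> B = {}"
  shows "\<mu> (A \<union> B) = \<mu> A + \<mu> B"
proof -
  define C where "C i = (if i = 0 then A else if i = (1::nat) then B else {})" for i
  have "range C \<subseteq> borel_sets X" "disjoint_family C"
    using assms borel_sets_ops(1) by (auto simp: C_def disjoint_family_on_def)
  from signed_measuresD(3)[OF assms(1) this] have "(\<lambda>i. \<mu> (C i)) sums \<mu> (\<Union>i. C i)" .
  moreover have "(\<lambda>i. \<mu> (C i)) sums (\<Sum>i\<in>{0,1}. \<mu> (C i))"
    by (rule sums_finite) (auto simp: C_def signed_measuresD(2)[OF assms(1)])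
  ultimately have "\<mu> (\<Union>i. C i) = (\<Sum>i\<in>{0,1}. \<mu> (C i))"
    using sums_unique2 by blast
  moreover have "(\<Union>i. C i) = A \<union> B"
    by (auto simp: C_def split: if_splits)
  ultimately show ?thesis
    by (simp add: C_def)
qed

lemma signed_measure_diff:
  assumes "\<mu> \<in> signed_measures X" "A \<in> borel_sets X" "B \<in> borel_sets X" "B \<subseteq> A"
  shows "\<mu> (A - B) = \<mu> A - \<mu> B"
  using signed_measure_additive[OF assms(1) borel_sets_ops(5)[OF assms(2,3)] assms(3)] assms(4)
  by (simp add: Int_Diff sup.absorb1 Diff_Int_distrib2 inf.commute)

text \<open>If some set had subsets of arbitrarily large measure, one could peel off infinitely many
  disjoint sets of measure at least one in absolute value.\<close>

lemma signed_measure_bounded: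
  assumes "\<mu> \<in> signed_measures X"
  shows "\<exists>K. \<forall>B\<in>borel_sets X. \<bar>\<mu> B\<bar> \<le> K"
proof (rule ccontr)
  assume contra: "\<not> ?thesis"
  define unb where "unb A \<longleftrightarrow> A \<in> borel_sets X \<and> (\<forall>K. \<exists>C\<in>borel_sets X. C \<subseteq> A \<and> \<bar>\<mu> C\<bar> > K)" for A
  have top: "unb (topspace X)"
    using contra borel_sets_subset borel_sets_ops(2) unfolding unb_def by (meson not_le)
  have split: "unb C \<or> unb (A - C)" if A: "unb A" and C: "C \<in> borel_sets X" "C \<subseteq> A" for A C
  proof (rule ccontr)
    assume "\<not> ?thesis"
    moreover have AC: "A - C \<in> borel_sets X"
      using A C borel_sets_ops(5) by (auto simp: unb_def)
    ultimately obtain K1 K2 where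
      K: "\<And>B. B \<in> borel_sets X \<Longrightarrow> B \<subseteq> C \<Longrightarrow> \<bar>\<mu> B\<bar> \<le> K1"
         "\<And>B. B \<in> borel_sets X \<Longrightarrow> B \<subseteq> A - C \<Longrightarrow> \<bar>\<mu> B\<bar> \<le> K2"
      using C unfolding unb_def by (meson not_less)
    obtain B where B: "B \<in> borel_sets X" "B \<subseteq> A" "\<bar>\<mu> B\<bar> > K1 + K2"
      using A unfolding unb_def by blast
    have "\<mu> ((B \<inter> C) \<union> (B - C)) = \<mu> (B \<inter> C) + \<mu> (B - C)"
      using B C by (intro signed_measure_additive[OF assms] borel_sets_ops) auto
    then have "\<mu> B = \<mu> (B \<inter> C) + \<mu> (B - C)"
      by (simp add: Int_Diff_Un)
    moreover have "\<bar>\<mu> (B \<inter> C)\<bar> \<le> K1" "\<bar>\<mu> (B - C)\<bar> \<le> K2"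
      using B C by (auto intro!: K borel_sets_ops)
    ultimately show False
      using B(3) by linarith
  qed
  have step: "\<exists>A'. A' \<subseteq> A \<and> unb A' \<and> 1 \<le> \<bar>\<mu> (A - A')\<bar>" if A: "unb A" for A
  proof -
    \<comment> \<open>With this excess over \<open>\<bar>\<mu> A\<bar>\<close> both \<open>C\<close>
      and \<open>A - C\<close> have measure at least one in absolute value, so whichever of them is
      kept, the discarded part counts.\<close>
    obtain C where C: "C \<in> borel_sets X" "C \<subseteq> A" "\<bar>\<mu> C\<bar> > \<bar>\<mu> A\<bar> + 1"
      using A unfolding unb_def by blast
    have AB: "A \<in> borel_sets X"
      using A by (simp add: unb_def)
    have d: "\<mu> (A - C) = \<mu> A - \<mu> C"
      using signed_measure_diff[OF assms AB C(1,2)] .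
    show ?thesis
    proof (cases "unb C")
      case True
      then show ?thesis
        using C d by (intro exI[of _ C]) auto
    next
      case False
      then have "unb (A - C)"
        using split[OF A C(1,2)] by blast
      moreover have "A - (A - C) = C"
        using C(2) by blast
      ultimately show ?thesis
        using C by (intro exI[of _ "A - C"]) auto
    qed
  qed
  have "\<exists>A. \<forall>n::nat. unb (A n) \<and> (A (Suc n) \<subseteq> A n \<and> 1 \<le> \<bar>\<mu> (A n - A (Suc n))\<bar>)"
  proof (rule dependent_nat_choice)
    show "\<exists>A. unb A"
      using top by blast
  next
    fix A and n :: nat
    assume "unb A"
    from step[OF this] show "\<exists>A'. unb A' \<and> A' \<subseteq> A \<and> 1 \<le> \<bar>\<mu> (A - A')\<bar>"
      by blast
  qed
  then obtain A where A: "\<And>n. unb (A n)" "\<And>n. A (Suc n) \<subseteq> A n" "\<And>n. 1 \<le> \<bar>\<mu> (A n - A (Suc n))\<bar>"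
    by blast
  have mono: "A m \<subseteq> A n" if "n \<le> m" for m n
    using lift_Suc_antimono_le[of A, OF A(2) that] .
  have disj: "disjoint_family (\<lambda>n. A n - A (Suc n))"
    unfolding disjoint_family_on_def
  proof (intro ballI impI)
    fix m n :: nat
    assume "m \<noteq> n"
    then have "Suc m \<le> n \<or> Suc n \<le> m"
      by linarith
    then show "(A m - A (Suc m)) \<inter> (A n - A (Suc n)) = {}"
      using mono by blast
  qed
  have "range (\<lambda>n. A n - A (Suc n)) \<subseteq> borel_sets X"
    using A(1) borel_sets_ops(5) unfolding unb_def by blast
  from signed_measuresD(3)[OF assms this disj]
  have "(\<lambda>n. \<mu> (A n - A (Suc n))) \<longlonglongrightarrow> 0"
    using sums_summable summable_LIMSEQ_zero by blast
  then obtain n where "\<bar>\<mu> (A n - A (Suc n))\<bar> < 1"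
    using LIMSEQ_D[of "\<lambda>n. \<mu> (A n - A (Suc n))" 0 1] by auto
  then show False
    using A(3)[of n] by linarith
qed

section \<open>Jordan decomposition\<close>

lemma uminus_signed_measures: "\<mu> \<in> signed_measures X \<Longrightarrow> (\<lambda>B. - \<mu> B) \<in> signed_measures X"
  unfolding signed_measures_def by (auto intro: sums_minus)

lemma jordan_pos_upper:
  assumes "\<mu> \<in> signed_measures X" "C \<in> borel_sets X" "C \<subseteq> B"
  shows "\<mu> C \<le> jordan_pos X \<mu> B"
proof -
  obtain K where K: "\<And>B. B \<in> borel_sets X \<Longrightarrow> \<bar>\<mu> B\<bar> \<le> K"
    using signed_measure_bounded[OF assms(1)] by blast
  show ?thesis
    unfolding jordan_pos_def
    using assms K by (intro cSUP_upper bdd_aboveI2[where M = K]) (auto simp: abs_le_iff)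
qed

lemma jordan_pos_least:
  assumes "\<And>C. C \<in> borel_sets X \<Longrightarrow> C \<subseteq> B \<Longrightarrow> \<mu> C \<le> c"
  shows "jordan_pos X \<mu> B \<le> c"
  unfolding jordan_pos_def
  using assms borel_sets_ops(1)[of X] by (intro cSUP_least) auto

lemma jordan_pos_nonneg:
  assumes "\<mu> \<in> signed_measures X"
  shows "0 \<le> jordan_pos X \<mu> B"
  using jordan_pos_upper[OF assms borel_sets_ops(1), of B] signed_measuresD(2)[OF assms] by simp

text \<open>Superadditivity: competitors for the union of the first n pieces and for the next piece
  are disjoint, so their union competes for the larger set. Using \<open>jordan_pos_least\<close>
  twice takes the two suprema one after the other.\<close>

lemma jordan_pos_finite_sum:
  assumes \<mu>: "\<mu> \<in> signed_measures X" and A: "\<And>i::nat. A i \<in> borel_sets X" "disjoint_family A"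
  shows "(\<Sum>i<n. jordan_pos X \<mu> (A i)) \<le> jordan_pos X \<mu> (\<Union>i<n. A i)"
proof (induction n)
  case 0
  then show ?case
    using jordan_pos_nonneg[OF \<mu>] by simp
next
  case (Suc n)
  have "jordan_pos X \<mu> (\<Union>i<n. A i) + jordan_pos X \<mu> (A n) \<le> jordan_pos X \<mu> (\<Union>i<Suc n. A i)"
  proof -
    have "jordan_pos X \<mu> (\<Union>i<n. A i) \<le> jordan_pos X \<mu> (\<Union>i<Suc n. A i) - jordan_pos X \<mu> (A n)"
    proof (rule jordan_pos_least)
      fix C assume C: "C \<in> borel_sets X" "C \<subseteq> (\<Union>i<n. A i)"
      have "jordan_pos X \<mu> (A n) \<le> jordan_pos X \<mu> (\<Union>i<Suc n. A i) - \<mu> C"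
      proof (rule jordan_pos_least)
        fix C' assume C': "C' \<in> borel_sets X" "C' \<subseteq> A n"
        have "A i \<inter> A n = {}" if "i < n" for i
          using A(2) that by (simp add: disjoint_family_on_def)
        then have "C \<inter> C' = {}"
          using C(2) C'(2) by blast
        from signed_measure_additive[OF \<mu> C(1) C'(1) this]
        have "\<mu> C + \<mu> C' \<le> jordan_pos X \<mu> (\<Union>i<Suc n. A i)"
          using jordan_pos_upper[OF \<mu> borel_sets_ops(3)[OF C(1) C'(1)], of "\<Union>i<Suc n. A i"] C C'
          by (auto simp: lessThan_Suc)
        then show "\<mu> C' \<le> jordan_pos X \<mu> (\<Union>i<Suc n. A i) - \<mu> C"
          by linarith
      qed
      then show "\<mu> C \<le> jordan_pos X \<mu> (\<Union>i<Suc n. A i) - jordan_pos X \<mu> (A n)"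
        by linarith
    qed
    then show ?thesis
      by linarith
  qed
  then show ?case
    using Suc by simp
qed

lemma jordan_pos_mono:
  assumes "\<mu> \<in> signed_measures X" "A \<subseteq> B"
  shows "jordan_pos X \<mu> A \<le> jordan_pos X \<mu> B"
  using assms by (intro jordan_pos_least jordan_pos_upper) auto

text \<open>The partial sums are bounded by superadditivity. Conversely, a competitor for the union
  is cut along the pieces, and each part competes for its own piece.\<close>

lemma jordan_pos_sums:
  assumes \<mu>: "\<mu> \<in> signed_measures X" and A: "range A \<subseteq> borel_sets X" "disjoint_family A"
  shows "(\<lambda>i::nat. jordan_pos X \<mu> (A i)) sums jordan_pos X \<mu> (\<Union>i. A i)"
proof -
  have A1: "A i \<in> borel_sets X" for i
    using A(1) by auto
  have le: "(\<Sum>i<n. jordan_pos X \<mu> (A i)) \<le> jordan_pos X \<mu> (\<Union>i. A i)" for n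
    using jordan_pos_finite_sum[OF \<mu> A1 A(2), of n] jordan_pos_mono[OF \<mu>, of "\<Union>i<n. A i" "\<Union>i. A i"]
    by force
  have s: "summable (\<lambda>i. jordan_pos X \<mu> (A i))"
    using jordan_pos_nonneg[OF \<mu>] le by (intro summableI_nonneg_bounded)
  have "(\<Sum>i. jordan_pos X \<mu> (A i)) \<le> jordan_pos X \<mu> (\<Union>i. A i)"
    using s le by (intro suminf_le_const)
  moreover have "jordan_pos X \<mu> (\<Union>i. A i) \<le> (\<Sum>i. jordan_pos X \<mu> (A i))"
  proof (rule jordan_pos_least)
    fix C assume C: "C \<in> borel_sets X" "C \<subseteq> (\<Union>i. A i)"
    have "disjoint_family (\<lambda>i. C \<inter> A i)"
      using A(2) by (fastforce simp: disjoint_family_on_def)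
    then have *: "(\<lambda>i. \<mu> (C \<inter> A i)) sums \<mu> (\<Union>i. C \<inter> A i)"
      using A1 C(1) by (intro signed_measuresD(3)[OF \<mu>]) (auto intro: borel_sets_ops)
    have "(\<Union>i. C \<inter> A i) = C"
      using C(2) by auto
    then have "\<mu> C = (\<Sum>i. \<mu> (C \<inter> A i))"
      using * by (simp add: sums_iff)
    also have "\<dots> \<le> (\<Sum>i. jordan_pos X \<mu> (A i))"
      using * s A1 C(1)
      by (intro suminf_le jordan_pos_upper[OF \<mu>] borel_sets_ops) (auto simp: sums_iff)
    finally show "\<mu> C \<le> (\<Sum>i. jordan_pos X \<mu> (A i))" .
  qed
  ultimately show ?thesis
    using s by (simp add: sums_iff)
qed

text \<open>Passing from \<open>C\<close> to \<open>B - C\<close> turns a competitor for one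
  supremum into one for the other, because
  \<open>\<mu> C = \<mu> B + (- \<mu> (B - C))\<close>.\<close>

lemma jordan_decomposition:
  assumes \<mu>: "\<mu> \<in> signed_measures X" and B: "B \<in> borel_sets X"
  shows "\<mu> B = jordan_pos X \<mu> B - jordan_neg X \<mu> B"
proof -
  note \<mu>' = uminus_signed_measures[OF \<mu>]
  have "jordan_pos X \<mu> B \<le> \<mu> B + jordan_neg X \<mu> B"
  proof (rule jordan_pos_least)
    fix C assume C: "C \<in> borel_sets X" "C \<subseteq> B"
    show "\<mu> C \<le> \<mu> B + jordan_neg X \<mu> B"
      using jordan_pos_upper[OF \<mu>' borel_sets_ops(5)[OF B C(1)], of B] signed_measure_diff[OF \<mu> B C]
      by (auto simp: jordan_neg_def)
  qed
  moreover have "jordan_neg X \<mu> B \<le> jordan_pos X \<mu> B - \<mu> B"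
    unfolding jordan_neg_def
  proof (rule jordan_pos_least)
    fix C assume C: "C \<in> borel_sets X" "C \<subseteq> B"
    show "- \<mu> C \<le> jordan_pos X \<mu> B - \<mu> B"
      using jordan_pos_upper[OF \<mu> borel_sets_ops(5)[OF B C(1)], of B] signed_measure_diff[OF \<mu> B C]
      by auto
  qed
  ultimately show ?thesis
    by linarith
qed

lemma jordan_pos_empty: "\<mu> \<in> signed_measures X \<Longrightarrow> jordan_pos X \<mu> {} = 0"
  using jordan_pos_nonneg[of \<mu> X "{}"] jordan_pos_least[of X "{}" \<mu> 0] signed_measuresD(2)[of \<mu> X]
  by auto

lemma finite_borel_measure_jordan:
  assumes "\<mu> \<in> signed_measures X"
  shows "finite_borel_measure X (to_measure X (jordan_pos X \<mu>))"
    "B \<in> borel_sets X \<Longrightarrow> measure (to_measure X (jordan_pos X \<mu>)) B = jordan_pos X \<mu> B"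
    "finite_borel_measure X (to_measure X (jordan_neg X \<mu>))"
    "B \<in> borel_sets X \<Longrightarrow> measure (to_measure X (jordan_neg X \<mu>)) B = jordan_neg X \<mu> B"
proof -
  note n = uminus_signed_measures[OF assms]
  show "finite_borel_measure X (to_measure X (jordan_pos X \<mu>))"
    "B \<in> borel_sets X \<Longrightarrow> measure (to_measure X (jordan_pos X \<mu>)) B = jordan_pos X \<mu> B"
    by (rule to_measure_of_additive[OF jordan_pos_nonneg[OF assms] jordan_pos_empty[OF assms]
        jordan_pos_sums[OF assms]]; assumption)+
  show "finite_borel_measure X (to_measure X (jordan_neg X \<mu>))"
    "B \<in> borel_sets X \<Longrightarrow> measure (to_measure X (jordan_neg X \<mu>)) B = jordan_neg X \<mu> B"
    unfolding jordan_neg_def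
    by (rule to_measure_of_additive[OF jordan_pos_nonneg[OF n] jordan_pos_empty[OF n]
        jordan_pos_sums[OF n]]; assumption)+
qed

section \<open>Integration against signed measures\<close>

lemma measurable_finite_borel_measure:
  assumes "finite_borel_measure X M"
  shows "measurable M N = measurable (borel_of X) N"
  using finite_borel_measureD[OF assms] by (intro measurable_cong_sets) auto

lemma integrable_finite_borel_measure:
  fixes f :: "'a \<Rightarrow> real"
  assumes "finite_borel_measure X M" "f \<in> borel_measurable (borel_of X)" "\<And>x. x \<in> topspace X \<Longrightarrow> \<bar>f x\<bar> \<le> K"
  shows "integrable M f"
  using assms(2,3) finite_borel_measureD[OF assms(1)]
  unfolding measurable_finite_borel_measure[OF assms(1), symmetric]
  by (intro finite_measure.integrable_const_bound[where B = K]) auto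

text \<open>A linear relation between measures is inherited by their integrals. As the coefficients
  have arbitrary signs, the limit is taken in each integral separately, by dominated convergence
  with a constant bound.\<close>

lemma sum_integral_eq_0_nonneg:
  fixes f :: "'a \<Rightarrow> real" and M :: "'k \<Rightarrow> 'a measure"
  assumes I: "finite I" and M: "\<And>k. k \<in> I \<Longrightarrow> finite_borel_measure X (M k)"
    and 0: "\<And>B. B \<in> borel_sets X \<Longrightarrow> (\<Sum>k\<in>I. s k * measure (M k) B) = 0"
    and f: "f \<in> borel_measurable (borel_of X)" "\<And>x. 0 \<le> f x" "\<And>x. x \<in> topspace X \<Longrightarrow> f x \<le> K"
  shows "(\<Sum>k\<in>I. s k * integral\<^sup>L (M k) f) = 0"
proof -
  note int = integrable_finite_borel_measure[OF M]
  \<comment> \<open>Boundedness is a premise inside the induction statement: it has to be derived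
    anew for each approximating function, from the bound on the function it approximates.\<close>
  have "(\<exists>K. \<forall>x\<in>topspace X. f x \<le> K) \<longrightarrow> (\<Sum>k\<in>I. s k * integral\<^sup>L (M k) f) = 0"
    using f(1,2)
  proof (induction rule: borel_measurable_induct_real)
    case (set A)
    then show ?case
      using 0[of A] finite_borel_measureD[OF M] borel_sets_subset[of A X]
      by (simp add: Int_absorb2)
  next
    case (mult u c)
    show ?case
    \<comment> \<open>For \<open>c = 0\<close> a bound on \<open>c * u\<close> says nothing about
      \<open>u\<close>, but then the integrand is zero.\<close>
    proof (cases "c = 0")
      case False
      show ?thesis
      proof
        assume "\<exists>K. \<forall>x\<in>topspace X. c * u x \<le> K"
        then obtain K where "\<forall>x\<in>topspace X. c * u x \<le> K" by blast
        then have "\<forall>x\<in>topspace X. u x \<le> K / c"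
          using False mult(1) by (auto simp: field_simps)
        then have "(\<Sum>k\<in>I. s k * integral\<^sup>L (M k) u) = 0"
          using mult by blast
        then have "c * (\<Sum>k\<in>I. s k * integral\<^sup>L (M k) u) = 0"
          by simp
        then show "(\<Sum>k\<in>I. s k * integral\<^sup>L (M k) (\<lambda>x. c * u x)) = 0"
          by (simp add: sum_distrib_left algebra_simps)
      qed
    qed simp
  next
    case (add u v)
    show ?case
    proof
      assume "\<exists>K. \<forall>x\<in>topspace X. v x + u x \<le> K"
      then obtain K where K: "\<forall>x\<in>topspace X. v x + u x \<le> K" by blast
      have b: "\<And>x. x \<in> topspace X \<Longrightarrow> \<bar>u x\<bar> \<le> K" "\<And>x. x \<in> topspace X \<Longrightarrow> \<bar>v x\<bar> \<le> K"
        using K add by (auto simp: abs_le_iff) (smt (verit) add.hyps)+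
      have "integral\<^sup>L (M k) (\<lambda>x. v x + u x) = integral\<^sup>L (M k) v + integral\<^sup>L (M k) u" if "k \<in> I" for k
        by (rule Bochner_Integration.integral_add[OF int[OF that add.hyps(3) b(2)] int[OF that add.hyps(1) b(1)]])
      then have "(\<Sum>k\<in>I. s k * integral\<^sup>L (M k) (\<lambda>x. v x + u x)) =
          (\<Sum>k\<in>I. s k * integral\<^sup>L (M k) v) + (\<Sum>k\<in>I. s k * integral\<^sup>L (M k) u)"
        by (simp add: distrib_left sum.distrib)
      moreover have "\<forall>x\<in>topspace X. u x \<le> K" "\<forall>x\<in>topspace X. v x \<le> K"
        using b by (auto simp: abs_le_iff)
      ultimately show "(\<Sum>k\<in>I. s k * integral\<^sup>L (M k) (\<lambda>x. v x + u x)) = 0"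
        using add by auto
    qed
  next
    case (seq U)
    show ?case
    proof
      assume "\<exists>K. \<forall>x\<in>topspace X. f x \<le> K"
      then obtain K where K: "\<And>x. x \<in> topspace X \<Longrightarrow> f x \<le> K" by blast
      have Uf: "U i x \<le> f x" if "x \<in> topspace X" for i x
        using seq.hyps(4)[of x] that seq.hyps(3) by (intro incseq_le) (auto simp: incseq_def le_fun_def)
      have U0: "(\<Sum>k\<in>I. s k * integral\<^sup>L (M k) (U i)) = 0" for i
        using seq.IH[of i] Uf[of _ i] K order_trans by blast
      have "(\<lambda>i. integral\<^sup>L (M k) (U i)) \<longlonglongrightarrow> integral\<^sup>L (M k) f" if k: "k \<in> I" for k
      proof (rule integral_dominated_convergence[where w = "\<lambda>_. K"])
        interpret finite_measure "M k"
          using finite_borel_measureD(1)[OF M[OF k]] .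
        show "integrable (M k) (\<lambda>_. K)" by simp
        show "AE x in M k. (\<lambda>i. U i x) \<longlonglongrightarrow> f x"
          using seq.hyps(4) finite_borel_measureD(3)[OF M[OF k]] by auto
        show "AE x in M k. norm (U i x) \<le> K" for i
          using seq.hyps(2) order_trans[OF Uf K] finite_borel_measureD(3)[OF M[OF k]] by (intro AE_I2) auto
      qed (use seq f in \<open>auto simp: measurable_finite_borel_measure[OF M[OF k]]\<close>)
      then have "(\<lambda>i. \<Sum>k\<in>I. s k * integral\<^sup>L (M k) (U i)) \<longlonglongrightarrow> (\<Sum>k\<in>I. s k * integral\<^sup>L (M k) f)"
        by (intro tendsto_intros)
      then show "(\<Sum>k\<in>I. s k * integral\<^sup>L (M k) f) = 0"
        unfolding U0 using LIMSEQ_unique[OF _ tendsto_const] by blast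
    qed
  qed
  then show ?thesis
    using f(3) by blast
qed

lemma sum_integral_eq_0:
  fixes f :: "'a \<Rightarrow> real" and M :: "'k \<Rightarrow> 'a measure"
  assumes I: "finite I" and M: "\<And>k. k \<in> I \<Longrightarrow> finite_borel_measure X (M k)"
    and 0: "\<And>B. B \<in> borel_sets X \<Longrightarrow> (\<Sum>k\<in>I. s k * measure (M k) B) = 0"
    and f: "f \<in> borel_measurable (borel_of X)" "\<And>x. x \<in> topspace X \<Longrightarrow> \<bar>f x\<bar> \<le> K"
  shows "(\<Sum>k\<in>I. s k * integral\<^sup>L (M k) f) = 0"
proof -
  have b: "max 0 (f x) \<le> \<bar>K\<bar>" "max 0 (- f x) \<le> \<bar>K\<bar>" if "x \<in> topspace X" for x
    using f(2)[OF that] by linarith+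
  have pos: "(\<Sum>k\<in>I. s k * integral\<^sup>L (M k) (\<lambda>x. max 0 (f x))) = 0"
    by (rule sum_integral_eq_0_nonneg[OF I M 0, where K = "\<bar>K\<bar>"]) (use f(1) b in auto)
  have neg: "(\<Sum>k\<in>I. s k * integral\<^sup>L (M k) (\<lambda>x. max 0 (- f x))) = 0"
    by (rule sum_integral_eq_0_nonneg[OF I M 0, where K = "\<bar>K\<bar>"]) (use f(1) b in auto)
  have "integral\<^sup>L (M k) f = integral\<^sup>L (M k) (\<lambda>x. max 0 (f x)) - integral\<^sup>L (M k) (\<lambda>x. max 0 (- f x))"
    if "k \<in> I" for k
  proof -
    have "integrable (M k) (\<lambda>x. max 0 (f x))" "integrable (M k) (\<lambda>x. max 0 (- f x))"
      by (rule integrable_finite_borel_measure[OF M[OF that], where K = "\<bar>K\<bar>"], use f(1) b in auto)+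
    then have "integral\<^sup>L (M k) (\<lambda>x. max 0 (f x) - max 0 (- f x)) =
        integral\<^sup>L (M k) (\<lambda>x. max 0 (f x)) - integral\<^sup>L (M k) (\<lambda>x. max 0 (- f x))"
      by (rule Bochner_Integration.integral_diff)
    moreover have "(\<lambda>x. max 0 (f x) - max 0 (- f x)) = f"
      by auto
    ultimately show ?thesis
      by simp
  qed
  then have "(\<Sum>k\<in>I. s k * integral\<^sup>L (M k) f) =
      (\<Sum>k\<in>I. s k * integral\<^sup>L (M k) (\<lambda>x. max 0 (f x))) -
      (\<Sum>k\<in>I. s k * integral\<^sup>L (M k) (\<lambda>x. max 0 (- f x)))"
    by (simp add: right_diff_distrib sum_subtractf)
  then show ?thesis
    using pos neg by simp
qed

text \<open>\<open>signed_integral\<close> only knows the Jordan parts. Any other combination of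
  finite measures representing \<open>\<mu>\<close>, minus these parts, vanishes on Borel sets, and
  \<open>sum_integral_eq_0\<close> applies to the difference.\<close>

lemma signed_integral_sum:
  fixes f :: "'a \<Rightarrow> real" and M :: "'k \<Rightarrow> 'a measure"
  assumes I: "finite I" and M: "\<And>k. k \<in> I \<Longrightarrow> finite_borel_measure X (M k)"
    and \<mu>: "\<mu> \<in> signed_measures X" "\<And>B. B \<in> borel_sets X \<Longrightarrow> \<mu> B = (\<Sum>k\<in>I. s k * measure (M k) B)"
    and f: "f \<in> borel_measurable (borel_of X)" "\<And>x. x \<in> topspace X \<Longrightarrow> \<bar>f x\<bar> \<le> K"
  shows "signed_integral X \<mu> f = (\<Sum>k\<in>I. s k * integral\<^sup>L (M k) f)"
proof -
  \<comment> \<open>The two Jordan parts join the family, with the signs that move them to the other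
    side of the equation.\<close>
  define J :: "('k + bool) set" where "J = Inl ` I \<union> {Inr True, Inr False}"
  define M' where "M' = case_sum M (\<lambda>b. if b then to_measure X (jordan_pos X \<mu>) else to_measure X (jordan_neg X \<mu>))"
  define s' where "s' = case_sum s (\<lambda>b. if b then -1 else 1 :: real)"
  have sumJ: "(\<Sum>j\<in>J. g j) = (\<Sum>k\<in>I. g (Inl k)) + g (Inr True) + g (Inr False)" for g :: "_ \<Rightarrow> real"
    unfolding J_def using I by (subst sum.union_disjoint) (auto simp: sum.reindex)
  have "(\<Sum>j\<in>J. s' j * integral\<^sup>L (M' j) f) = 0"
  proof (rule sum_integral_eq_0[of J X, OF _ _ _ f])
    show "finite J"
      using I by (simp add: J_def)
    show "finite_borel_measure X (M' j)" if "j \<in> J" for j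
      using that M finite_borel_measure_jordan[OF \<mu>(1)] by (auto simp: J_def M'_def)
    show "(\<Sum>j\<in>J. s' j * measure (M' j) B) = 0" if B: "B \<in> borel_sets X" for B
      unfolding sumJ using finite_borel_measure_jordan[OF \<mu>(1)] B jordan_decomposition[OF \<mu>(1) B] \<mu>(2)[OF B]
      by (simp add: M'_def s'_def)
  qed
  then show ?thesis
    unfolding sumJ by (simp add: M'_def s'_def signed_integral_def)
qed

lemma signed_integral_nonneg_measure:
  assumes \<sigma>: "\<sigma> \<in> nonneg_measures X"
  shows "signed_integral X \<sigma> f = integral\<^sup>L (to_measure X \<sigma>) f"
proof -
  note m = nonneg_measuresD[OF \<sigma>]
  have "jordan_pos X \<sigma> B = \<sigma> B" if B: "B \<in> borel_sets X" for B
  proof (rule antisym)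
    show "jordan_pos X \<sigma> B \<le> \<sigma> B"
    proof (rule jordan_pos_least)
      fix C assume "C \<in> borel_sets X" "C \<subseteq> B"
      then show "\<sigma> C \<le> \<sigma> B"
        using signed_measure_diff[OF m(1) B, of C] m(2)[of "B - C"] by simp
    qed
  qed (use jordan_pos_upper[OF m(1) B] in auto)
  then have p: "to_measure X (jordan_pos X \<sigma>) = to_measure X \<sigma>"
    using finite_borel_measure_jordan[OF m(1)] finite_borel_measure_to_measure[OF \<sigma>]
    by (intro finite_borel_measure_eqI[of X]) auto
  have "jordan_neg X \<sigma> B = 0" for B
    unfolding jordan_neg_def using jordan_pos_nonneg[OF uminus_signed_measures[OF m(1)], of B]
      jordan_pos_least[of X B "\<lambda>B. - \<sigma> B" 0] m(2) by (simp add: order_antisym)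
  then have "to_measure X (jordan_neg X \<sigma>) = null_measure (borel_of X)"
    using finite_borel_measure_jordan(3,4)[OF m(1)]
    by (intro finite_borel_measure_eqI[of X])
      (auto simp: finite_borel_measure_def measure_def intro!: finite_measureI)
  then show ?thesis
    unfolding signed_integral_def p by simp
qed


section \<open>Bounded continuous functions and semicontinuity\<close>

definition bounded_continuous :: "'a topology \<Rightarrow> ('a \<Rightarrow> real) \<Rightarrow> bool" where
  "bounded_continuous X f \<longleftrightarrow> continuous_map X euclideanreal f \<and> bounded (f ` topspace X)"

lemma continuous_map_real_iff:
  "continuous_map X euclideanreal f \<longleftrightarrow>
    (\<forall>x\<in>topspace X. \<forall>e>0. \<exists>U. openin X U \<and> x \<in> U \<and> (\<forall>y\<in>U. \<bar>f y - f x\<bar> < e))"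
  using Met_TC.continuous_map_to_metric[of X f]
  by (simp add: dist_real_def abs_minus_commute)

lemma bounded_continuousI:
  assumes "continuous_map X euclideanreal f" "\<And>x. x \<in> topspace X \<Longrightarrow> \<bar>f x\<bar> \<le> K"
  shows "bounded_continuous X f"
  using assms by (auto simp: bounded_continuous_def bounded_iff)

lemma bounded_continuousD:
  assumes "bounded_continuous X f"
  shows "continuous_map X euclideanreal f"
    and "\<exists>K\<ge>0. \<forall>x\<in>topspace X. \<bar>f x\<bar> \<le> K"
proof -
  show "continuous_map X euclideanreal f"
    using assms by (simp add: bounded_continuous_def)
  from assms obtain K where "\<forall>x\<in>topspace X. \<bar>f x\<bar> \<le> K"
    by (auto simp: bounded_continuous_def bounded_iff)
  then show "\<exists>K\<ge>0. \<forall>x\<in>topspace X. \<bar>f x\<bar> \<le> K"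
    by (intro exI[of _ "max 0 K"]) auto
qed

lemma bounded_continuous_const: "bounded_continuous X (\<lambda>x. c)"
  by (rule bounded_continuousI[where K = "\<bar>c\<bar>"]) auto

lemma bounded_continuous_add:
  assumes "bounded_continuous X f" "bounded_continuous X g"
  shows "bounded_continuous X (\<lambda>x. f x + g x)"
proof -
  obtain K L where K: "\<forall>x\<in>topspace X. \<bar>f x\<bar> \<le> K" "\<forall>x\<in>topspace X. \<bar>g x\<bar> \<le> L"
    using assms[THEN bounded_continuousD(2)] by blast
  have "\<bar>f x + g x\<bar> \<le> K + L" if "x \<in> topspace X" for x
    using K that by (smt (verit))
  then show ?thesis
    by (rule bounded_continuousI[OF continuous_map_add[OF assms[THEN bounded_continuousD(1)]]])
qed

lemma bounded_continuous_mult_left: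
  assumes "bounded_continuous X f"
  shows "bounded_continuous X (\<lambda>x. c * f x)"
proof -
  obtain K where "\<forall>x\<in>topspace X. \<bar>f x\<bar> \<le> K"
    using assms[THEN bounded_continuousD(2)] by blast
  then have "\<bar>c * f x\<bar> \<le> \<bar>c\<bar> * K" if "x \<in> topspace X" for x
    using that by (auto simp: abs_mult intro: mult_left_mono)
  then show ?thesis
    by (rule bounded_continuousI[OF continuous_map_real_mult_left[OF bounded_continuousD(1)[OF assms]]])
qed

lemma bounded_continuous_diff:
  assumes "bounded_continuous X f" "bounded_continuous X g"
  shows "bounded_continuous X (\<lambda>x. f x - g x)"
  using bounded_continuous_add[OF assms(1) bounded_continuous_mult_left[OF assms(2), of "-1"]] by simp

lemma bounded_continuous_min_max:
  assumes "bounded_continuous X f" "bounded_continuous X g"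
  shows "bounded_continuous X (\<lambda>x. min (f x) (g x))" "bounded_continuous X (\<lambda>x. max (f x) (g x))"
proof -
  obtain K L where K: "\<forall>x\<in>topspace X. \<bar>f x\<bar> \<le> K" "\<forall>x\<in>topspace X. \<bar>g x\<bar> \<le> L"
    using assms[THEN bounded_continuousD(2)] by blast
  have "\<bar>min (f x) (g x)\<bar> \<le> max K L" "\<bar>max (f x) (g x)\<bar> \<le> max K L" if "x \<in> topspace X" for x
    using K that by (smt (verit))+
  then show "bounded_continuous X (\<lambda>x. min (f x) (g x))" "bounded_continuous X (\<lambda>x. max (f x) (g x))"
    using bounded_continuousI[OF continuous_map_real_min[OF assms[THEN bounded_continuousD(1)]]]
      bounded_continuousI[OF continuous_map_real_max[OF assms[THEN bounded_continuousD(1)]]] by metis+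
qed

lemma bounded_continuous_sum:
  assumes "\<And>i. i \<in> I \<Longrightarrow> bounded_continuous X (f i)"
  shows "bounded_continuous X (\<lambda>x. \<Sum>i\<in>I. f i x)"
  using assms by (induction I rule: infinite_finite_induct)
    (auto intro: bounded_continuous_add bounded_continuous_const)

lemma borel_measurable_openI:
  fixes f :: "'a \<Rightarrow> 'b::{second_countable_topology, linorder_topology}"
  assumes "\<And>c. openin X {x \<in> topspace X. c < f x}"
  shows "f \<in> borel_measurable (borel_of X)"
proof (rule borel_measurableI_greater)
  fix c
  show "{w \<in> space (borel_of X). c < f w} \<in> sets (borel_of X)"
    using borel_sets_open[OF assms[of c]] by simp
qed

lemma borel_measurable_lower_semicontinuous:
  fixes f :: "'a \<Rightarrow> ennreal"
  assumes "lower_semicontinuous_map X f"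
  shows "f \<in> borel_measurable (borel_of X)"
  using assms unfolding lower_semicontinuous_map_def by (intro borel_measurable_openI) auto

lemma borel_measurable_continuous_map:
  assumes "continuous_map X euclideanreal f"
  shows "f \<in> borel_measurable (borel_of X)"
proof (rule borel_measurable_openI)
  fix c
  show "openin X {x \<in> topspace X. c < f x}"
    using openin_continuous_map_preimage[OF assms, of "{c<..}"] by simp
qed

lemma integrable_bounded_continuous:
  assumes "bounded_continuous X f" "finite_borel_measure X M"
  shows "integrable M f"
proof -
  obtain K where K: "\<And>x. x \<in> topspace X \<Longrightarrow> \<bar>f x\<bar> \<le> K"
    using bounded_continuousD(2)[OF assms(1)] by blast
  show ?thesis
    by (rule integrable_finite_borel_measure[OF assms(2) borel_measurable_continuous_map[OF bounded_continuousD(1)[OF assms(1)]] K])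
qed

text \<open>The infimal convolutions of \<open>f\<close> with the multiples of the distance increase to \<open>f\<close>.\<close>

lemma lower_semicontinuous_approx:
  fixes f :: "'a \<Rightarrow> ennreal"
  assumes "metrizable_space X" and lsc: "lower_semicontinuous_map X f"
  obtains g :: "nat \<Rightarrow> 'a \<Rightarrow> real" where
    "\<And>n. bounded_continuous X (g n)" "\<And>n x. 0 \<le> g n x" "\<And>m n x. m \<le> n \<Longrightarrow> g m x \<le> g n x"
    "\<And>x. x \<in> topspace X \<Longrightarrow> (SUP n. ennreal (g n x)) = f x"
proof -
  obtain M d where Md: "Metric_space M d" and X: "X = Metric_space.mtopology M d"
    using assms(1) unfolding metrizable_space_def by blast
  interpret Metric_space M d by fact
  have top: "topspace X = M"
    by (simp add: X)
  \<comment> \<open>The truncation at n makes the function bounded even where the infimal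
    convolution is infinite. The value 0 of \<open>g\<close> off the carrier keeps sign and
    monotonicity valid for all x.\<close>
  define G where "G n x = min (ennreal (real n)) (INF y\<in>M. f y + ennreal (real n * d x y))" for n x
  define g where "g n x = (if x \<in> M then enn2real (G n x) else 0)" for n x
  have Gfin: "G n x < top" for n x
    unfolding G_def by (auto simp: min_less_iff_disj)
  have gG: "ennreal (g n x) = G n x" if "x \<in> M" for n x
    using that Gfin by (simp add: g_def)
  have Gmono: "G m x \<le> G n x" if "m \<le> n" for m n x
    unfolding G_def using that
    by (intro min.mono INF_mono') (auto intro!: add_left_mono ennreal_leI mult_right_mono)
  have Glip: "G n x \<le> G n y + ennreal (real n * d x y)" if xy: "x \<in> M" "y \<in> M" for n x y
  proof -
    have "(INF z\<in>M. f z + ennreal (real n * d x z)) \<le>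
        (INF z\<in>M. (f z + ennreal (real n * d y z))) + ennreal (real n * d x y)"
    proof -
      have "(INF z\<in>M. f z + ennreal (real n * d x z)) \<le> (f z + ennreal (real n * d y z)) + ennreal (real n * d x y)"
        if z: "z \<in> M" for z
      proof -
        have "real n * d x z \<le> real n * d y z + real n * d x y"
          using triangle[OF xy z] mult_left_mono[of "d x z" "d x y + d y z" "real n"]
          by (simp add: distrib_left)
        then have "ennreal (real n * d x z) \<le> ennreal (real n * d y z) + ennreal (real n * d x y)"
          by (simp add: ennreal_plus[symmetric] ennreal_leI del: ennreal_plus)
        then have "f z + ennreal (real n * d x z) \<le> (f z + ennreal (real n * d y z)) + ennreal (real n * d x y)"
          by (simp add: add_left_mono add.assoc)
        then show ?thesis
          by (rule INF_lower2[OF z])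
      qed
      then have "(INF z\<in>M. f z + ennreal (real n * d x z)) - ennreal (real n * d x y) \<le>
          (INF z\<in>M. f z + ennreal (real n * d y z))"
        by (intro INF_greatest) (auto simp: ennreal_minus_le_iff add.commute)
      then show ?thesis
        by (auto simp: ennreal_minus_le_iff add.commute)
    qed
    moreover have "min p q \<le> min p r + c" if "q \<le> r + c" for p q r c :: ennreal
      using that by (cases "p \<le> r") (auto simp: min.absorb1 min.absorb2 min.coboundedI1 min.coboundedI2 add_increasing2)
    ultimately show ?thesis
      unfolding G_def by blast
  qed
  have glip: "g n x \<le> g n y + real n * d x y" if "x \<in> M" "y \<in> M" for n x y
  proof -
    have "ennreal (g n x) \<le> ennreal (g n y + real n * d x y)"
      using Glip[OF that, of n] gG[OF that(1)] gG[OF that(2)] by (simp add: g_def)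
    then show ?thesis
      by (subst (asm) ennreal_le_iff) (auto simp: g_def)
  qed
  have cont: "continuous_map X euclideanreal (g n)" for n
    unfolding continuous_map_real_iff
  proof (intro ballI allI impI)
    fix x and e :: real
    assume x: "x \<in> topspace X" and e: "0 < e"
    have "\<bar>g n y - g n x\<bar> < e" if y: "y \<in> mball x (e / (real n + 1))" for y
    proof -
      have yM: "y \<in> M" "d x y < e / (real n + 1)"
        using y by auto
      have "real n * d x y \<le> (real n + 1) * d x y"
        by (simp add: mult_right_mono)
      also have "\<dots> < e"
        using yM(2) by (simp add: field_simps)
      finally have "real n * d x y < e" .
      then show ?thesis
        using glip[of x y n] glip[of y x n] x top yM(1) commute[of x y] by auto
    qed
    then show "\<exists>U. openin X U \<and> x \<in> U \<and> (\<forall>y\<in>U. \<bar>g n y - g n x\<bar> < e)"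
      using x e top unfolding X by (intro exI[of _ "mball x (e / (real n + 1))"]) (auto simp: add_pos_nonneg)
  qed
  show ?thesis
  proof
    show "bounded_continuous X (g n)" for n
    proof (rule bounded_continuousI[OF cont, where K = "real n"])
      fix x
      assume "x \<in> topspace X"
      then have "ennreal (g n x) \<le> ennreal (real n)"
        using gG[of x n] by (simp add: top G_def)
      then show "\<bar>g n x\<bar> \<le> real n"
        by (simp add: g_def)
    qed
    show "0 \<le> g n x" for n x
      by (simp add: g_def)
    show "g m x \<le> g n x" if "m \<le> n" for m n x
      using Gmono[OF that, of x] Gfin by (auto simp: g_def intro: enn2real_mono)
    show "(SUP n. ennreal (g n x)) = f x" if "x \<in> topspace X" for x
    proof -
      have x: "x \<in> M"
        using that top by simp
      have "(SUP n. G n x) = f x"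
      proof (rule antisym)
        have "G n x \<le> f x" for n
          unfolding G_def using x mdist_zero[OF x] by (intro min.coboundedI2 INF_lower2[OF x]) simp
        then show "(SUP n. G n x) \<le> f x"
          by (rule SUP_least)
        show "f x \<le> (SUP n. G n x)"
        proof (rule dense_le)
          fix c
          assume c: "c < f x"
          then have cfin: "c < top"
            using order_less_le_trans[OF c] by simp
          have "openin mtopology {x \<in> M. c < f x}"
            using lsc unfolding lower_semicontinuous_map_def top unfolding X by blast
          then obtain r where r: "r > 0" "mball x r \<subseteq> {x \<in> M. c < f x}"
            using x c unfolding openin_mtopology by blast
          \<comment> \<open>The first bound takes care of the truncation at n, the second of points
            at distance at least r, where the penalty alone reaches c; inside the ball
            \<open>f\<close> itself exceeds c.\<close>
          obtain n :: nat where n: "real n \<ge> enn2real c" "real n \<ge> enn2real c / r"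
            using real_arch_simple[of "max (enn2real c) (enn2real c / r)"] by auto
          have cn: "c \<le> ennreal (real n)" "c \<le> ennreal (real n * r)"
            using n r(1) cfin by (auto simp: enn2real_le field_simps top.not_eq_extremum)
          have "c \<le> f y + ennreal (real n * d x y)" if y: "y \<in> M" for y
          proof (cases "d x y < r")
            case True
            then have "c < f y"
              using r(2) x y by auto
            then show ?thesis
              by (simp add: add_increasing2 less_imp_le)
          next
            case False
            then have "ennreal (real n * r) \<le> ennreal (real n * d x y)"
              by (intro ennreal_leI mult_left_mono) auto
            then show ?thesis
              using order_trans[OF cn(2)] by (simp add: add_increasing)
          qed
          then have "c \<le> G n x"
            unfolding G_def using cn(1) by (auto intro: INF_greatest)
          then show "c \<le> (SUP n. G n x)"
            by (rule SUP_upper2[OF UNIV_I])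
        qed
      qed
      then show ?thesis
        using gG[OF x] by simp
    qed
  qed
qed

lemma lower_semicontinuous_indicator:
  assumes "openin X U"
  shows "lower_semicontinuous_map X (indicator U :: 'a \<Rightarrow> ennreal)"
  unfolding lower_semicontinuous_map_def
proof
  fix c :: ennreal
  have "{x \<in> topspace X. c < indicator U x} = (if c < 1 then U else {})"
    using openin_subset[OF assms] by (auto simp: indicator_def split: if_splits)
  then show "openin X {x \<in> topspace X. c < indicator U x}"
    using assms by simp
qed

lemma openin_approx:
  assumes "metrizable_space X" and U: "openin X U"
  obtains g :: "nat \<Rightarrow> 'a \<Rightarrow> real" where
    "\<And>n. bounded_continuous X (g n)" "\<And>n x. 0 \<le> g n x" "\<And>m n x. m \<le> n \<Longrightarrow> g m x \<le> g n x"
    "\<And>n x. x \<in> topspace X \<Longrightarrow> g n x \<le> indicator U x"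
    "\<And>x. x \<in> topspace X \<Longrightarrow> (\<lambda>n. g n x) \<longlonglongrightarrow> indicator U x"
proof -
  obtain g :: "nat \<Rightarrow> 'a \<Rightarrow> real" where g: "\<And>n. bounded_continuous X (g n)" "\<And>n x. 0 \<le> g n x"
    "\<And>m n x. m \<le> n \<Longrightarrow> g m x \<le> g n x"
    "\<And>x. x \<in> topspace X \<Longrightarrow> (SUP n. ennreal (g n x)) = indicator U x"
    using lower_semicontinuous_approx[OF assms(1) lower_semicontinuous_indicator[OF U]] by metis
  have ind: "indicator U x = ennreal (indicator U x)" for x
    by (simp add: indicator_def)
  show ?thesis
  proof
    show "g n x \<le> indicator U x" if "x \<in> topspace X" for n x
    proof -
      have "ennreal (g n x) \<le> ennreal (indicator U x)"
        using g(4)[OF that] SUP_upper[of n UNIV "\<lambda>n. ennreal (g n x)"] ind by simp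
      then show ?thesis
        by (subst (asm) ennreal_le_iff) auto
    qed
    show "(\<lambda>n. g n x) \<longlonglongrightarrow> indicator U x" if "x \<in> topspace X" for x
    proof -
      have "incseq (\<lambda>n. ennreal (g n x))"
        using g(3) by (auto simp: incseq_def intro: ennreal_leI)
      from LIMSEQ_SUP[OF this] have "(\<lambda>n. ennreal (g n x)) \<longlonglongrightarrow> ennreal (indicator U x)"
        unfolding g(4)[OF that] ind .
      then show ?thesis
        by (rule tendsto_ennrealD) (auto simp: g)
    qed
  qed (use g in auto)
qed

text \<open>On open sets the relation follows by approximating indicators from below. Open sets are
  an intersection-stable generator, and the relation survives complements and disjoint unions.
  Allowing signed combinations handles the Jordan parts of two measures at once.\<close>

lemma sum_measure_eq_0:
  assumes X: "metrizable_space X" and I: "finite I"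
    and M: "\<And>k. k \<in> I \<Longrightarrow> finite_borel_measure X (M k)"
    and 0: "\<And>f. bounded_continuous X f \<Longrightarrow> (\<Sum>k\<in>I. s k * integral\<^sup>L (M k) f) = 0"
    and B: "B \<in> borel_sets X"
  shows "(\<Sum>k\<in>I. s k * measure (M k) B) = 0"
proof -
  have op: "(\<Sum>k\<in>I. s k * measure (M k) U) = 0" if U: "openin X U" for U
  proof -
    obtain g :: "nat \<Rightarrow> 'a \<Rightarrow> real" where g: "\<And>n. bounded_continuous X (g n)" "\<And>n x. 0 \<le> g n x"
      "\<And>n x. x \<in> topspace X \<Longrightarrow> g n x \<le> indicator U x"
      "\<And>x. x \<in> topspace X \<Longrightarrow> (\<lambda>n. g n x) \<longlonglongrightarrow> indicator U x"
      using openin_approx[OF X U] by metis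
    have "(\<lambda>n. integral\<^sup>L (M k) (g n)) \<longlonglongrightarrow> measure (M k) U" if k: "k \<in> I" for k
    proof -
      interpret finite_measure "M k"
        using finite_borel_measureD(1)[OF M[OF k]] .
      note sp = finite_borel_measureD(3)[OF M[OF k]]
      have "(\<lambda>n. integral\<^sup>L (M k) (g n)) \<longlonglongrightarrow> integral\<^sup>L (M k) (indicator U)"
      proof (rule integral_dominated_convergence[where w = "\<lambda>_. 1"])
        show "indicator U \<in> borel_measurable (M k)"
          using borel_sets_open[OF U] finite_borel_measureD(2)[OF M[OF k]] by (intro borel_measurable_indicator) simp
        show "AE x in M k. norm (g n x) \<le> 1" for n
        proof (rule AE_I2)
          fix x assume "x \<in> space (M k)"
          then have "g n x \<le> indicator U x"
            using g(3) sp by auto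
          also have "\<dots> \<le> (1::real)"
            by (simp add: indicator_def)
          finally show "norm (g n x) \<le> 1"
            using g(2)[of n x] by simp
        qed
        show "AE x in M k. (\<lambda>n. g n x) \<longlonglongrightarrow> indicator U x"
          using g(4) sp by auto
        show "g n \<in> borel_measurable (M k)" for n
          using integrable_bounded_continuous[OF g(1) M[OF k]] by (rule borel_measurable_integrable)
      qed simp
      then show ?thesis
        using openin_subset[OF U] sp by (simp add: Int_absorb2)
    qed
    then have "(\<lambda>n. \<Sum>k\<in>I. s k * integral\<^sup>L (M k) (g n)) \<longlonglongrightarrow> (\<Sum>k\<in>I. s k * measure (M k) U)"
      by (intro tendsto_intros)
    then show ?thesis
      unfolding 0[OF g(1)] using LIMSEQ_unique[OF _ tendsto_const] by blast
  qed
  have stable: "Int_stable {U. openin X U}"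
    by (auto simp: Int_stable_def)
  have B': "B \<in> sigma_sets (topspace X) {U. openin X U}"
    using B by (simp add: borel_sets_def)
  have sets: "A \<in> sets (M k)" if "A \<in> sigma_sets (topspace X) {U. openin X U}" "k \<in> I" for A k
    using that finite_borel_measureD(2)[OF M] by (simp add: borel_sets_def)
  note fin = finite_borel_measureD(1)[OF M]
  show ?thesis
    using stable openin_subset_Pow B'
  proof (induction rule: sigma_sets_induct_disjoint)
    case (basic A)
    then show ?case using op by simp
  next
    case empty
    then show ?case by simp
  next
    case (compl A)
    have "measure (M k) (topspace X - A) = measure (M k) (topspace X) - measure (M k) A" if "k \<in> I" for k
      using finite_measure.finite_measure_compl[OF fin[OF that] sets[OF compl(1) that]]
        finite_borel_measureD(3)[OF M[OF that]] by simp
    then have "(\<Sum>k\<in>I. s k * measure (M k) (topspace X - A)) =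
        (\<Sum>k\<in>I. s k * measure (M k) (topspace X)) - (\<Sum>k\<in>I. s k * measure (M k) A)"
      by (simp add: right_diff_distrib sum_subtractf)
    then show ?case
      using compl op[OF openin_topspace] by simp
  next
    case (union A)
    have "(\<lambda>i. measure (M k) (A i)) sums measure (M k) (\<Union>i. A i)" if "k \<in> I" for k
      using union sets[OF _ that] by (intro finite_measure.finite_measure_UNION[OF fin[OF that]]) auto
    then have "(\<lambda>i. \<Sum>k\<in>I. s k * measure (M k) (A i)) sums (\<Sum>k\<in>I. s k * measure (M k) (\<Union>i. A i))"
      by (intro sums_sum sums_mult)
    then show ?case
      using union by (simp add: sums_iff)
  qed
qed

lemma signed_measure_eqI:
  assumes X: "metrizable_space X" and \<mu>: "\<mu> \<in> signed_measures X" and \<nu>: "\<nu> \<in> signed_measures X"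
    and eq: "\<And>f. bounded_continuous X f \<Longrightarrow> signed_integral X \<mu> f = signed_integral X \<nu> f"
  shows "\<mu> = \<nu>"
proof
  fix B
  show "\<mu> B = \<nu> B"
  proof (cases "B \<in> borel_sets X")
    case B: True
    \<comment> \<open>The four Jordan parts; with the signs in \<open>s\<close> their combination is
      \<mu> - \<nu>.\<close>
    define M :: "nat \<Rightarrow> 'a measure" where
      "M k = ([to_measure X (jordan_pos X \<mu>), to_measure X (jordan_neg X \<mu>),
        to_measure X (jordan_pos X \<nu>), to_measure X (jordan_neg X \<nu>)] ! k)" for k
    define s :: "nat \<Rightarrow> real" where "s k = [1, -1, -1, 1] ! k" for k
    have sum: "(\<Sum>k<4. s k * F (M k)) = F (M 0) - F (M 1) - F (M 2) + F (M 3)" for F :: "'a measure \<Rightarrow> real"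
      by (simp add: s_def eval_nat_numeral)
    have "(\<Sum>k<4. s k * measure (M k) B) = 0"
    proof (rule sum_measure_eq_0[OF X _ _ _ B])
      show "finite_borel_measure X (M k)" if "k \<in> {..<4}" for k
        using that finite_borel_measure_jordan[OF \<mu>] finite_borel_measure_jordan[OF \<nu>]
        by (auto simp: M_def less_Suc_eq eval_nat_numeral)
      show "(\<Sum>k<4. s k * integral\<^sup>L (M k) f) = 0" if "bounded_continuous X f" for f
        using eq[OF that] unfolding sum[of "\<lambda>N. integral\<^sup>L N f"] by (simp add: signed_integral_def M_def eval_nat_numeral)
    qed simp
    then show ?thesis
      unfolding sum[of "\<lambda>N. measure N B"] using B finite_borel_measure_jordan[OF \<mu>] finite_borel_measure_jordan[OF \<nu>]
      by (simp add: M_def eval_nat_numeral jordan_decomposition[OF \<mu>] jordan_decomposition[OF \<nu>])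
  next
    case False
    then show ?thesis
      using signed_measuresD(1) \<mu> \<nu> by metis
  qed
qed

section \<open>The narrow topology\<close>

lemma openin_narrow:
  assumes "bounded_continuous X f" "open U"
  shows "openin (narrow_topology X) {\<mu> \<in> signed_measures X. signed_integral X \<mu> f \<in> U}"
  unfolding narrow_topology_def
  using assms by (intro topology_generated_by_Basis) (auto simp: bounded_continuous_def)

lemma topspace_narrow [simp]: "topspace (narrow_topology X) = signed_measures X"
proof
  show "topspace (narrow_topology X) \<subseteq> signed_measures X"
    unfolding narrow_topology_def topology_generated_by_topspace by auto
  show "signed_measures X \<subseteq> topspace (narrow_topology X)"
    using openin_subset[OF openin_narrow[OF bounded_continuous_const open_UNIV, of X]] by simp
qed

lemma continuous_map_signed_integral:
  assumes "bounded_continuous X f"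
  shows "continuous_map (narrow_topology X) euclideanreal (\<lambda>\<mu>. signed_integral X \<mu> f)"
  unfolding continuous_map_def using openin_narrow[OF assms] by auto

lemma nn_integral_bounded_continuous:
  assumes "bounded_continuous X f" "\<And>x. 0 \<le> f x" "\<sigma> \<in> nonneg_measures X"
  shows "(\<integral>\<^sup>+x. ennreal (f x) \<partial>to_measure X \<sigma>) = ennreal (signed_integral X \<sigma> f)"
  using nn_integral_eq_integral[OF integrable_bounded_continuous[OF assms(1)
        finite_borel_measure_to_measure(1)[OF assms(3)]]] assms(2)
  by (simp add: signed_integral_nonneg_measure[OF assms(3)])

text \<open>A supremum of narrowly continuous functionals: this gives lower semicontinuity, and it
  lets a bound on the integral pass to limit points of measures.\<close>

lemma regulariser_SUP:
  assumes X: "metrizable_space X" and w: "lower_semicontinuous_map X w"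
  obtains g :: "nat \<Rightarrow> 'a \<Rightarrow> real" where
    "\<And>n. bounded_continuous X (g n)" "\<And>n x. 0 \<le> g n x" "\<And>n x. x \<in> topspace X \<Longrightarrow> ennreal (g n x) \<le> w x"
    "\<And>\<sigma>. \<sigma> \<in> nonneg_measures X \<Longrightarrow> regulariser X w \<sigma> = (SUP n. ennreal (signed_integral X \<sigma> (g n)))"
proof -
  obtain g :: "nat \<Rightarrow> 'a \<Rightarrow> real" where g: "\<And>n. bounded_continuous X (g n)" "\<And>n x. 0 \<le> g n x"
    "\<And>m n x. m \<le> n \<Longrightarrow> g m x \<le> g n x"
    "\<And>x. x \<in> topspace X \<Longrightarrow> (SUP n. ennreal (g n x)) = w x"
    using lower_semicontinuous_approx[OF X w] by metis
  show ?thesis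
  proof
    show "ennreal (g n x) \<le> w x" if "x \<in> topspace X" for n x
      using SUP_upper[of n UNIV "\<lambda>n. ennreal (g n x)"] g(4)[OF that] by simp
    fix \<sigma> assume \<sigma>: "\<sigma> \<in> nonneg_measures X"
    note M = finite_borel_measure_to_measure(1)[OF \<sigma>]
    have "regulariser X w \<sigma> = (\<integral>\<^sup>+x. (SUP n. ennreal (g n x)) \<partial>to_measure X \<sigma>)"
      unfolding regulariser_def using g(4) finite_borel_measureD(3)[OF M] by (intro nn_integral_cong) auto
    also have "\<dots> = (SUP n. \<integral>\<^sup>+x. ennreal (g n x) \<partial>to_measure X \<sigma>)"
    proof (rule nn_integral_monotone_convergence_SUP)
      show "incseq (\<lambda>n x. ennreal (g n x))"
        using g(3) by (auto simp: incseq_def le_fun_def intro: ennreal_leI)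
      show "(\<lambda>x. ennreal (g n x)) \<in> borel_measurable (to_measure X \<sigma>)" for n
        using borel_measurable_integrable[OF integrable_bounded_continuous[OF g(1) M]] by measurable
    qed
    finally show "regulariser X w \<sigma> = (SUP n. ennreal (signed_integral X \<sigma> (g n)))"
      using nn_integral_bounded_continuous[OF g(1,2) \<sigma>] by simp
  qed (use g in auto)
qed

text \<open>The statement is relative to sets of non-negative measures, because
  \<open>to_measure\<close> truncates negative values and the supremum formula holds only for
  non-negative ones.\<close>

lemma lower_semicontinuous_regulariser:
  assumes X: "metrizable_space X" and w: "lower_semicontinuous_map X w" and D: "D \<subseteq> nonneg_measures X"
  shows "lower_semicontinuous_map (subtopology (narrow_topology X) D) (regulariser X w)"
  unfolding lower_semicontinuous_map_def
proof
  fix c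
  obtain g :: "nat \<Rightarrow> 'a \<Rightarrow> real" where g: "\<And>n. bounded_continuous X (g n)" "\<And>n x. 0 \<le> g n x"
    "\<And>\<sigma>. \<sigma> \<in> nonneg_measures X \<Longrightarrow> regulariser X w \<sigma> = (SUP n. ennreal (signed_integral X \<sigma> (g n)))"
    using regulariser_SUP[OF X w] by metis
  show "openin (subtopology (narrow_topology X) D)
      {\<sigma> \<in> topspace (subtopology (narrow_topology X) D). c < regulariser X w \<sigma>}" (is "openin _ ?S")
  proof (cases "c = top")
    case False
    then have "c < ennreal r \<longleftrightarrow> enn2real c < r" for r
      by (cases c) (auto simp: ennreal_less_iff)
    then have "c < regulariser X w \<sigma> \<longleftrightarrow> (\<exists>n. enn2real c < signed_integral X \<sigma> (g n))" if "\<sigma> \<in> D" for \<sigma>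
      using that D by (subst g(3)) (auto simp: less_SUP_iff)
    then have "?S = (\<Union>n. {\<mu> \<in> signed_measures X. signed_integral X \<mu> (g n) \<in> {enn2real c<..}}) \<inter> D"
      by auto
    moreover have "openin (narrow_topology X)
        (\<Union>n. {\<mu> \<in> signed_measures X. signed_integral X \<mu> (g n) \<in> {enn2real c<..}})"
      using openin_narrow[OF g(1) open_greaterThan] by (intro openin_Union) auto
    ultimately show ?thesis
      by (auto simp: openin_subtopology)
  qed simp
qed


section \<open>Daniell functionals\<close>

text \<open>\<open>tendsto_0\<close> is Daniell's condition. It supplies the countable additivity
  that positivity and linearity alone do not give on a non-compact space.\<close>

locale daniell_functional =
  fixes X :: "'a topology" and \<Lambda> :: "('a \<Rightarrow> real) \<Rightarrow> real"
  assumes metrizable: "metrizable_space X"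
    and add: "\<And>f g. bounded_continuous X f \<Longrightarrow> bounded_continuous X g \<Longrightarrow> \<Lambda> (\<lambda>x. f x + g x) = \<Lambda> f + \<Lambda> g"
    and scale: "\<And>c f. bounded_continuous X f \<Longrightarrow> \<Lambda> (\<lambda>x. c * f x) = c * \<Lambda> f"
    and nonneg: "\<And>f. bounded_continuous X f \<Longrightarrow> (\<And>x. x \<in> topspace X \<Longrightarrow> 0 \<le> f x) \<Longrightarrow> 0 \<le> \<Lambda> f"
    and tendsto_0: "\<And>f :: nat \<Rightarrow> 'a \<Rightarrow> real. (\<And>n. bounded_continuous X (f n)) \<Longrightarrow>
      (\<And>m n x. m \<le> n \<Longrightarrow> x \<in> topspace X \<Longrightarrow> f n x \<le> f m x) \<Longrightarrow>
      (\<And>x. x \<in> topspace X \<Longrightarrow> (\<lambda>n. f n x) \<longlonglongrightarrow> 0) \<Longrightarrow> (\<lambda>n. \<Lambda> (f n)) \<longlonglongrightarrow> 0"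
begin

lemma diff:
  assumes "bounded_continuous X f" "bounded_continuous X g"
  shows "\<Lambda> (\<lambda>x. f x - g x) = \<Lambda> f - \<Lambda> g"
  using add[OF assms(1) bounded_continuous_mult_left[OF assms(2), of "-1"]] scale[OF assms(2), of "-1"]
  by simp

lemma mono:
  assumes "bounded_continuous X f" "bounded_continuous X g" "\<And>x. x \<in> topspace X \<Longrightarrow> f x \<le> g x"
  shows "\<Lambda> f \<le> \<Lambda> g"
  using nonneg[OF bounded_continuous_diff[OF assms(2,1)]] assms by (simp add: diff)

lemma const: "\<Lambda> (\<lambda>x. c) = c * \<Lambda> (\<lambda>x. 1)"
  using scale[OF bounded_continuous_const, of c 1] by simp

lemma sum:
  assumes "\<And>i. i \<in> I \<Longrightarrow> bounded_continuous X (f i)"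
  shows "\<Lambda> (\<lambda>x. \<Sum>i\<in>I. f i x) = (\<Sum>i\<in>I. \<Lambda> (f i))"
  using assms
proof (induction I rule: infinite_finite_induct)
  case (insert i I)
  then show ?case
    using add[of "f i" "\<lambda>x. \<Sum>i\<in>I. f i x"] bounded_continuous_sum[of I X f] by simp
qed (use const[of 0] in simp_all)

section \<open>The content of open sets\<close>

definition below :: "'a set \<Rightarrow> ('a \<Rightarrow> real) set" where
  "below U = {f. bounded_continuous X f \<and> (\<forall>x\<in>topspace X. 0 \<le> f x \<and> f x \<le> indicator U x)}"

text \<open>The value that monotone convergence forces on a representing measure, since the
  indicator of an open set is an increasing limit of functions in \<open>below U\<close>.\<close>

definition mass :: "'a set \<Rightarrow> real" where
  "mass U = (SUP f\<in>below U. \<Lambda> f)"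

lemma belowD:
  assumes "f \<in> below U"
  shows "bounded_continuous X f" "x \<in> topspace X \<Longrightarrow> 0 \<le> f x" "x \<in> topspace X \<Longrightarrow> f x \<le> indicator U x"
    "x \<in> topspace X \<Longrightarrow> f x \<le> 1"
proof -
  show "bounded_continuous X f" "x \<in> topspace X \<Longrightarrow> 0 \<le> f x" "x \<in> topspace X \<Longrightarrow> f x \<le> indicator U x"
    using assms unfolding below_def by auto
  then show "x \<in> topspace X \<Longrightarrow> f x \<le> 1"
    by (auto simp: indicator_def split: if_splits intro: order_trans)
qed

lemma zero_below: "(\<lambda>x. 0) \<in> below U"
  unfolding below_def using bounded_continuous_const by auto

lemma mass_upper:
  assumes "f \<in> below U"
  shows "\<Lambda> f \<le> mass U"
  unfolding mass_def
proof (rule cSUP_upper[OF assms])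
  show "bdd_above (\<Lambda> ` below U)"
    using belowD by (intro bdd_aboveI2[where M = "\<Lambda> (\<lambda>x. 1)"] mono bounded_continuous_const) auto
qed

lemma mass_least: "(\<And>f. f \<in> below U \<Longrightarrow> \<Lambda> f \<le> c) \<Longrightarrow> mass U \<le> c"
  unfolding mass_def using zero_below by (intro cSUP_least) auto

lemma mass_nonneg: "0 \<le> mass U"
  using mass_upper[OF zero_below] const[of 0] by simp

lemma mass_mono:
  assumes "U \<subseteq> V"
  shows "mass U \<le> mass V"
proof (rule mass_least)
  fix f assume f: "f \<in> below U"
  have "indicator U x \<le> (indicator V x :: real)" for x
    using assms by (auto simp: indicator_def)
  then have "f \<in> below V"
    using f order_trans unfolding below_def by blast
  then show "\<Lambda> f \<le> mass V"
    by (rule mass_upper)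
qed

lemma mass_empty: "mass {} = 0"
proof (rule antisym[OF mass_least mass_nonneg])
  fix f assume f: "f \<in> below {}"
  show "\<Lambda> f \<le> 0"
    using mono[OF belowD(1)[OF f] bounded_continuous_const, of 0] belowD(3)[OF f] const[of 0] by simp
qed

lemma mass_topspace: "mass (topspace X) = \<Lambda> (\<lambda>x. 1)"
proof (rule antisym[OF mass_least mass_upper])
  fix f assume "f \<in> below (topspace X)"
  then show "\<Lambda> f \<le> \<Lambda> (\<lambda>x. 1)"
    using belowD by (intro mono bounded_continuous_const) auto
qed (auto simp: below_def bounded_continuous_const)

text \<open>A function below the union is truncated by finite sums of functions subordinate to the
  single sets. The error decreases to zero pointwise, and Daniell's condition carries this over to
  the functional.\<close>

lemma mass_subadditive:
  assumes U: "\<And>i::nat. openin X (U i)"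
  shows "ennreal (mass (\<Union>i. U i)) \<le> (\<Sum>i. ennreal (mass (U i)))"
proof -
  have "ennreal (\<Lambda> f) \<le> (\<Sum>i. ennreal (mass (U i)))" if f: "f \<in> below (\<Union>i. U i)" for f
  proof -
    have "\<exists>g. (\<forall>n. bounded_continuous X (g n)) \<and> (\<forall>n x. 0 \<le> g n x) \<and> (\<forall>m n x. m \<le> n \<longrightarrow> g m x \<le> g n x) \<and>
      (\<forall>n. \<forall>x\<in>topspace X. g n x \<le> indicator (U i) x) \<and>
      (\<forall>x\<in>topspace X. (\<lambda>n::nat. g n x :: real) \<longlonglongrightarrow> indicator (U i) x)" for i
      by (rule openin_approx[OF metrizable U[of i]]) blast
    then obtain g :: "nat \<Rightarrow> nat \<Rightarrow> 'a \<Rightarrow> real" where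
      g: "\<And>i n. bounded_continuous X (g i n)" "\<And>i n x. 0 \<le> g i n x" "\<And>i m n x. m \<le> n \<Longrightarrow> g i m x \<le> g i n x"
        "\<And>i n x. x \<in> topspace X \<Longrightarrow> g i n x \<le> indicator (U i) x"
        "\<And>i x. x \<in> topspace X \<Longrightarrow> (\<lambda>n. g i n x) \<longlonglongrightarrow> indicator (U i) x"
      by metis
    \<comment> \<open>The index n counts both the sets in use and the accuracy of each
      approximation, so that a single monotone sequence exhausts the union.\<close>
    define s where "s n x = (\<Sum>i<n. g i n x)" for n x
    have s: "bounded_continuous X (s n)" for n
      unfolding s_def using g(1) by (intro bounded_continuous_sum)
    have smono: "s m x \<le> s n x" if "m \<le> n" for m n x
    proof -
      have "s m x \<le> (\<Sum>i<m. g i n x)"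
        unfolding s_def using that g(3) by (intro sum_mono) auto
      also have "\<dots> \<le> s n x"
        unfolding s_def using that g(2) by (intro sum_mono2) auto
      finally show ?thesis .
    qed
    define h where "h n x = min (f x) (s n x)" for n x
    have h: "bounded_continuous X (h n)" for n
      unfolding h_def by (rule bounded_continuous_min_max(1)[OF belowD(1)[OF f] s])
    have "(\<lambda>n. \<Lambda> (\<lambda>x. f x - h n x)) \<longlonglongrightarrow> 0"
    proof (rule tendsto_0)
      show "bounded_continuous X (\<lambda>x. f x - h n x)" for n
        by (rule bounded_continuous_diff[OF belowD(1)[OF f] h])
      show "f x - h n x \<le> f x - h m x" if "m \<le> n" for m n x
        using smono[OF that, of x] by (auto simp: h_def)
      show "(\<lambda>n. f x - h n x) \<longlonglongrightarrow> 0" if x: "x \<in> topspace X" for x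
      proof (cases "x \<in> (\<Union>i. U i)")
        case True
        then obtain i where i: "x \<in> U i" by blast
        have "(\<lambda>n. 1 - g i n x) \<longlonglongrightarrow> 1 - indicator (U i) x"
          by (intro tendsto_intros g(5)[OF x])
        then have lim: "(\<lambda>n. 1 - g i n x) \<longlonglongrightarrow> 0"
          using i by simp
        show ?thesis
        proof (rule tendsto_sandwich[OF _ _ tendsto_const lim])
          show "\<forall>\<^sub>F n in sequentially. 0 \<le> f x - h n x"
            by (simp add: h_def)
          show "\<forall>\<^sub>F n in sequentially. f x - h n x \<le> 1 - g i n x"
            using eventually_gt_at_top[of i]
          proof eventually_elim
            case (elim n)
            then have "g i n x \<le> s n x"
              unfolding s_def using g(2) by (intro member_le_sum) auto
            moreover have "g i n x \<le> 1"
              using g(4)[OF x, of i n] i by simp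
            ultimately show ?case
              using belowD(4)[OF f x] by (auto simp: h_def min_def)
          qed
        qed
      next
        case False
        then have "f x = 0"
          using belowD(2,3)[OF f x] by simp
        moreover have "0 \<le> s n x" for n
          unfolding s_def using g(2) by (intro sum_nonneg) auto
        ultimately show ?thesis
          by (simp add: h_def min_def)
      qed
    qed
    then have "(\<lambda>n. \<Lambda> f - (\<Lambda> f - \<Lambda> (h n))) \<longlonglongrightarrow> \<Lambda> f - 0"
      using diff[OF belowD(1)[OF f] h] by (intro tendsto_intros) simp
    then have lim: "(\<lambda>n. ennreal (\<Lambda> (h n))) \<longlonglongrightarrow> ennreal (\<Lambda> f)"
      by (intro tendsto_ennrealI) simp
    have "ennreal (\<Lambda> (h n)) \<le> (\<Sum>i. ennreal (mass (U i)))" for n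
    proof -
      have "\<Lambda> (h n) \<le> \<Lambda> (s n)"
        using h s by (intro mono) (auto simp: h_def)
      also have "\<dots> = (\<Sum>i<n. \<Lambda> (g i n))"
        unfolding s_def using g(1) by (intro sum)
      also have "\<dots> \<le> (\<Sum>i<n. mass (U i))"
        using g by (intro sum_mono mass_upper) (auto simp: below_def)
      finally have "ennreal (\<Lambda> (h n)) \<le> ennreal (\<Sum>i<n. mass (U i))"
        by (rule ennreal_leI)
      also have "\<dots> = (\<Sum>i<n. ennreal (mass (U i)))"
        by (simp add: mass_nonneg)
      also have "\<dots> \<le> (\<Sum>i. ennreal (mass (U i)))"
        by (rule sum_le_suminf) auto
      finally show ?thesis .
    qed
    then show ?thesis
      using LIMSEQ_le_const2[OF lim] by blast
  qed
  \<comment> \<open>\<open>mass\<close> is a supremum of reals while the series may diverge; the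
    comparison moves to the reals only when the series is finite.\<close>
  then have le: "\<Lambda> f \<le> enn2real (\<Sum>i. ennreal (mass (U i)))"
    if "f \<in> below (\<Union>i. U i)" "(\<Sum>i. ennreal (mass (U i))) \<noteq> top" for f
    using that by (metis ennreal_enn2real_if ennreal_le_iff enn2real_nonneg)
  show ?thesis
  proof (cases "(\<Sum>i. ennreal (mass (U i))) = top")
    case False
    have "mass (\<Union>i. U i) \<le> enn2real (\<Sum>i. ennreal (mass (U i)))"
      using le False by (intro mass_least)
    then show ?thesis
      using False by (metis ennreal_enn2real_if ennreal_le_iff enn2real_nonneg)
  qed simp
qed

section \<open>Outer measure and Caratheodory's construction\<close>

definition outer :: "'a set \<Rightarrow> ennreal" where
  "outer A = (INF U\<in>{U. openin X U \<and> A \<subseteq> U}. ennreal (mass U))"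

lemma outer_open: "openin X U \<Longrightarrow> outer U = ennreal (mass U)"
  unfolding outer_def by (rule antisym) (auto intro!: INF_lower INF_greatest ennreal_leI mass_mono)

lemma outer_le: "openin X U \<Longrightarrow> A \<subseteq> U \<Longrightarrow> outer A \<le> ennreal (mass U)"
  unfolding outer_def by (intro INF_lower) auto

lemma outer_mono: "A \<subseteq> B \<Longrightarrow> outer A \<le> outer B"
  unfolding outer_def by (intro INF_superset_mono) auto

lemma outer_finite: "A \<subseteq> topspace X \<Longrightarrow> outer A < top"
  using outer_le[OF openin_topspace] by (rule order_le_less_trans) auto

lemma outer_measure_space_outer: "outer_measure_space (Pow (topspace X)) outer"
  unfolding outer_measure_space_def
proof (intro conjI)
  show "positive (Pow (topspace X)) outer"
    using outer_open[OF openin_empty] by (simp add: positive_def mass_empty)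
  show "increasing (Pow (topspace X)) outer"
    by (simp add: increasing_def outer_mono)
  show "countably_subadditive (Pow (topspace X)) outer"
    unfolding countably_subadditive_def
  proof (intro allI impI)
    fix A :: "nat \<Rightarrow> 'a set"
    assume A: "range A \<subseteq> Pow (topspace X)"
    show "outer (\<Union>(range A)) \<le> (\<Sum>i. outer (A i))"
    proof (rule ennreal_le_epsilon)
      fix e :: real
      assume e: "0 < e"
      have "\<exists>U. openin X U \<and> A i \<subseteq> U \<and> ennreal (mass U) \<le> outer (A i) + ennreal (e * (1/2) ^ Suc i)" for i
      proof -
        have "outer (A i) < outer (A i) + ennreal (e * (1/2) ^ Suc i)"
          using e outer_finite[of "A i"] A by (auto simp: less_top[symmetric] ennreal_zero_less_mult_iff)
        then show ?thesis
          unfolding outer_def[of "A i"] INF_less_iff by (auto simp: outer_def intro: less_imp_le)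
      qed
      then obtain U where U: "\<And>i. openin X (U i)" "\<And>i. A i \<subseteq> U i"
        "\<And>i. ennreal (mass (U i)) \<le> outer (A i) + ennreal (e * (1/2) ^ Suc i)"
        by metis
      have "outer (\<Union>(range A)) \<le> ennreal (mass (\<Union>i. U i))"
        using U(1,2) by (intro outer_le openin_Union) auto
      also have "\<dots> \<le> (\<Sum>i. ennreal (mass (U i)))"
        by (rule mass_subadditive[OF U(1)])
      also have "\<dots> \<le> (\<Sum>i. outer (A i) + ennreal (e * (1/2) ^ Suc i))"
        using U(3) by (intro suminf_le) auto
      also have "\<dots> = (\<Sum>i. outer (A i)) + (\<Sum>i. ennreal (e * (1/2) ^ Suc i))"
        by (simp add: suminf_add[symmetric])
      also have "(\<Sum>i. ennreal (e * (1/2) ^ Suc i)) = ennreal (e * 1)"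
        using e by (intro suminf_ennreal_eq sums_mult power_half_series) auto
      finally show "outer (\<Union>(range A)) \<le> (\<Sum>i. outer (A i)) + ennreal e"
        by simp
    qed
  qed
qed

text \<open>If \<open>f\<close> lives below \<open>U \<inter> V\<close>, then \<open>{f < \<delta>}\<close> is an open neighbourhood of \<open>V - U\<close> on which one can
  add any \<open>h\<close> to the truncation of \<open>f - \<delta>\<close> and remain below \<open>V\<close>.\<close>

lemma mass_split:
  assumes U: "openin X U" and V: "openin X V"
  shows "ennreal (mass (U \<inter> V)) + outer (V - U) \<le> ennreal (mass V)"
proof -
  have "\<Lambda> f \<le> mass V - enn2real (outer (V - U))" if f: "f \<in> below (U \<inter> V)" for f
  proof (rule field_le_epsilon)
    fix e :: real
    assume e: "0 < e"
    \<comment> \<open>Lowering f by \<delta> costs at most \<delta> times the total mass, which this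
      choice keeps below e; the added 1 excludes division by zero.\<close>
    define \<delta> where "\<delta> = e / (\<Lambda> (\<lambda>x. 1) + 1)"
    have L1: "0 \<le> \<Lambda> (\<lambda>x. 1)"
      by (intro nonneg bounded_continuous_const) auto
    have \<delta>: "0 < \<delta>" "\<delta> * \<Lambda> (\<lambda>x. 1) \<le> e"
      using e L1 by (auto simp: \<delta>_def field_simps)
    define W where "W = {x \<in> topspace X. f x < \<delta>} \<inter> V"
    have W: "openin X W"
      using openin_continuous_map_preimage[OF bounded_continuousD(1)[OF belowD(1)[OF f]], of "{..<\<delta>}"] V
      unfolding W_def by (intro openin_Int) auto
    have "V - U \<subseteq> W"
    proof
      fix x assume x: "x \<in> V - U"
      then have "x \<in> topspace X"
        using openin_subset[OF V] by blast
      moreover from this have "f x \<le> 0"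
        using belowD(3)[OF f, of x] x by simp
      ultimately show "x \<in> W"
        using x \<delta>(1) unfolding W_def by auto
    qed
    then have "outer (V - U) \<le> ennreal (mass W)"
      by (rule outer_le[OF W])
    then have oW: "enn2real (outer (V - U)) \<le> mass W"
      using mass_nonneg by (simp add: enn2real_leI)
    define f' where "f' x = max 0 (f x - \<delta>)" for x
    have f': "bounded_continuous X f'"
      unfolding f'_def
      by (intro bounded_continuous_min_max(2) bounded_continuous_diff bounded_continuous_const belowD(1)[OF f])
    have "\<Lambda> (\<lambda>x. f x - \<delta>) \<le> \<Lambda> f'"
      by (intro mono f' bounded_continuous_diff bounded_continuous_const belowD(1)[OF f]) (simp add: f'_def)
    then have Lf: "\<Lambda> f - \<delta> * \<Lambda> (\<lambda>x. 1) \<le> \<Lambda> f'"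
      using diff[OF belowD(1)[OF f] bounded_continuous_const] const[of \<delta>] by simp
    have "mass W \<le> mass V - \<Lambda> f'"
    proof (rule mass_least)
      fix h assume h: "h \<in> below W"
      have "(\<lambda>x. f' x + h x) \<in> below V"
        unfolding below_def
      proof (intro CollectI conjI ballI)
        show "bounded_continuous X (\<lambda>x. f' x + h x)"
          by (rule bounded_continuous_add[OF f' belowD(1)[OF h]])
        fix x assume x: "x \<in> topspace X"
        show "0 \<le> f' x + h x"
          using belowD(2)[OF h x] by (simp add: f'_def)
        \<comment> \<open>The two summands never overlap: \<open>f'\<close> vanishes on
          \<open>W\<close> and \<open>h\<close> vanishes outside it.\<close>
        show "f' x + h x \<le> indicator V x"
        proof (cases "x \<in> W")
          case True
          then show ?thesis
            using belowD(3)[OF h x] by (simp add: f'_def W_def)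
        next
          case False
          then have "h x = 0"
            using belowD(2,3)[OF h x] by simp
          moreover have "f x \<le> indicator V x"
            using belowD(3,4)[OF f x] by (auto simp: indicator_def split: if_splits)
          ultimately show ?thesis
            using \<delta>(1) by (auto simp: f'_def)
        qed
      qed
      from mass_upper[OF this] show "\<Lambda> h \<le> mass V - \<Lambda> f'"
        using add[OF f' belowD(1)[OF h]] by simp
    qed
    then show "\<Lambda> f \<le> mass V - enn2real (outer (V - U)) + e"
      using oW Lf \<delta>(2) by linarith
  qed
  then have "mass (U \<inter> V) \<le> mass V - enn2real (outer (V - U))"
    by (rule mass_least)
  then have "ennreal (mass (U \<inter> V) + enn2real (outer (V - U))) \<le> ennreal (mass V)"
    by (intro ennreal_leI) simp
  moreover have "outer (V - U) < top"
    using openin_subset[OF V] by (intro outer_finite) auto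
  ultimately show ?thesis
    using mass_nonneg by simp
qed

text \<open>\<open>mass_split\<close> settles the case of an open set; since \<open>outer A\<close>
  is an infimum over open sets containing \<open>A\<close>, monotonicity transfers the inequality to
  \<open>A\<close>.\<close>

lemma outer_split:
  assumes U: "openin X U" and A: "A \<subseteq> topspace X"
  shows "outer (U \<inter> A) + outer (A - U) \<le> outer A"
  unfolding outer_def[of A]
proof (rule INF_greatest)
  fix V assume "V \<in> {V. openin X V \<and> A \<subseteq> V}"
  then have V: "openin X V" "A \<subseteq> V" by auto
  have "outer (U \<inter> A) + outer (A - U) \<le> ennreal (mass (U \<inter> V)) + outer (V - U)"
    using V U by (intro add_mono outer_le outer_mono openin_Int) auto
  also have "\<dots> \<le> ennreal (mass V)"
    by (rule mass_split[OF U V(1)])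
  finally show "outer (U \<inter> A) + outer (A - U) \<le> ennreal (mass V)" .
qed

lemma open_in_lambda_system:
  assumes U: "openin X U"
  shows "U \<in> lambda_system (topspace X) (Pow (topspace X)) outer"
  unfolding lambda_system_def
proof (intro CollectI conjI ballI)
  show "U \<in> Pow (topspace X)"
    using openin_subset[OF U] by auto
  fix A assume A: "A \<in> Pow (topspace X)"
  have eq: "(topspace X - U) \<inter> A = A - U"
    using A by auto
  have "subadditive (Pow (topspace X)) outer"
    using outer_measure_space_outer unfolding outer_measure_space_def
    by (intro ring_of_sets.countably_subadditive_subadditive[OF ring_of_sets_Pow]) auto
  then have "outer ((U \<inter> A) \<union> (A - U)) \<le> outer (U \<inter> A) + outer (A - U)"
    using A by (intro subadditiveD) auto
  moreover have "(U \<inter> A) \<union> (A - U) = A"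
    by auto
  ultimately show "outer (U \<inter> A) + outer ((topspace X - U) \<inter> A) = outer A"
    using outer_split[OF U, of A] A unfolding eq by (auto intro: antisym)
qed

definition representing_measure :: "'a measure" where
  "representing_measure = measure_of (topspace X) (borel_sets X) outer"

lemma sets_representing_measure: "sets representing_measure = borel_sets X"
  unfolding representing_measure_def
  by (simp add: sigma_algebra.sets_measure_of_eq[OF sigma_algebra_borel_sets])

lemma emeasure_representing_measure:
  assumes "B \<in> borel_sets X"
  shows "emeasure representing_measure B = outer B"
  unfolding representing_measure_def
proof (rule emeasure_measure_of_sigma[OF sigma_algebra_borel_sets _ _ assms])
  have ms: "measure_space (topspace X) (lambda_system (topspace X) (Pow (topspace X)) outer) outer"
    by (rule sigma_algebra.caratheodory_lemma[OF sigma_algebra_Pow outer_measure_space_outer])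
  have sub: "borel_sets X \<subseteq> lambda_system (topspace X) (Pow (topspace X)) outer"
    unfolding borel_sets_def
    using ms open_in_lambda_system unfolding measure_space_def
    by (intro sigma_algebra.sigma_sets_subset) auto
  show "positive (borel_sets X) outer"
    using outer_measure_space_outer by (simp add: positive_def outer_measure_space_def)
  show "countably_additive (borel_sets X) outer"
    unfolding countably_additive_def
  proof (intro allI impI)
    fix A :: "nat \<Rightarrow> 'a set"
    assume A: "range A \<subseteq> borel_sets X" "disjoint_family A" "\<Union>(range A) \<in> borel_sets X"
    show "(\<Sum>i. outer (A i)) = outer (\<Union>(range A))"
      using ms A sub unfolding measure_space_def countably_additive_def by blast
  qed
qed

lemma finite_borel_measure_representing: "finite_borel_measure X representing_measure"
proof -
  have "space representing_measure = topspace X"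
    using sets_eq_imp_space_eq[of representing_measure "borel_of X"] sets_representing_measure by simp
  then show ?thesis
    using outer_finite[of "topspace X"]
    by (auto simp: finite_borel_measure_def sets_representing_measure
        emeasure_representing_measure[OF borel_sets_ops(2)] intro!: finite_measureI)
qed

section \<open>Representation of the functional by its measure\<close>

lemma measure_representing_open: "openin X U \<Longrightarrow> measure representing_measure U = mass U"
  using emeasure_representing_measure[OF borel_sets_open] outer_open mass_nonneg by (simp add: measure_def)

text \<open>Cut f at the levels k/n. Each slice, multiplied by n, lies below the open set where f
  exceeds the lower level, which bounds \<open>\<Lambda> f\<close> by masses over n; the indicators
  of the same sets over n, without the lowest one, fit under f. The discrepancy is a single term of
  order 1/n.\<close>

lemma le_integral_representing:
  assumes f: "bounded_continuous X f" "\<And>x. x \<in> topspace X \<Longrightarrow> 0 \<le> f x"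
  shows "\<Lambda> f \<le> integral\<^sup>L representing_measure f"
proof -
  note M = finite_borel_measure_representing
  interpret M: finite_measure representing_measure
    by (rule finite_borel_measureD(1)[OF M])
  have space: "space representing_measure = topspace X"
    by (rule finite_borel_measureD(3)[OF M])
  obtain K where K: "\<And>x. x \<in> topspace X \<Longrightarrow> \<bar>f x\<bar> \<le> K"
    using bounded_continuousD(2)[OF f(1)] by blast
  have main: "\<Lambda> f \<le> integral\<^sup>L representing_measure f + \<Lambda> (\<lambda>x. 1) / real n" if n: "n > 0" for n :: nat
  proof -
    \<comment> \<open>N slices of height 1/n reach the bound of f, so that they add up to f.\<close>
    obtain N :: nat where N: "K * real n \<le> real N"
      using real_arch_simple by blast
    define \<tau> where "\<tau> k = real k / real n" for k
    define U where "U k = {x \<in> topspace X. \<tau> k < f x}" for k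
    define \<phi> where "\<phi> k x = min (f x) (\<tau> (Suc k)) - min (f x) (\<tau> k)" for k x
    have \<tau>: "\<tau> (Suc k) = \<tau> k + 1 / real n" for k
      by (simp add: \<tau>_def add_divide_distrib)
    have \<tau>_mono: "\<tau> k \<le> \<tau> (Suc k)" for k
      unfolding \<tau> by simp
    have U: "openin X (U k)" for k
      unfolding U_def using openin_continuous_map_preimage[OF bounded_continuousD(1)[OF f(1)], of "{\<tau> k<..}"]
      by simp
    have bc: "bounded_continuous X (\<phi> k)" for k
      unfolding \<phi>_def by (intro bounded_continuous_diff bounded_continuous_min_max bounded_continuous_const f)
    have fN: "f x = (\<Sum>k<N. \<phi> k x)" if "x \<in> topspace X" for x
    proof -
      have "f x \<le> \<tau> N"
        using order_trans[OF mult_right_mono[of "f x" K "real n"] N] K[OF that] n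
        by (simp add: \<tau>_def pos_le_divide_eq)
      moreover have "(\<Sum>k<N. \<phi> k x) = min (f x) (\<tau> N) - min (f x) (\<tau> 0)"
        unfolding \<phi>_def by (rule sum_lessThan_telescope)
      ultimately show ?thesis
        using f(2)[OF that] by (simp add: \<tau>_def)
    qed
    have up: "\<Lambda> (\<phi> k) \<le> mass (U k) / real n" for k
    proof -
      have "(\<lambda>x. real n * \<phi> k x) \<in> below (U k)"
        unfolding below_def
      proof (intro CollectI conjI ballI)
        show "bounded_continuous X (\<lambda>x. real n * \<phi> k x)"
          by (rule bounded_continuous_mult_left[OF bc])
        fix x assume x: "x \<in> topspace X"
        have "0 \<le> \<phi> k x" "\<phi> k x \<le> 1 / real n" "\<tau> k \<ge> f x \<Longrightarrow> \<phi> k x = 0"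
          using \<tau>[of k] divide_pos_pos[of 1 "real n"] n unfolding \<phi>_def min_def by (smt (verit) of_nat_0_less_iff)+
        then show "0 \<le> real n * \<phi> k x" "real n * \<phi> k x \<le> indicator (U k) x"
          using n x by (auto simp: U_def indicator_def field_simps not_less)
      qed
      from mass_upper[OF this] show ?thesis
        using n scale[OF bc, of "real n" k] by (simp add: field_simps)
    qed
    have intU: "integrable representing_measure (\<lambda>x. indicator (U k) x / real n)" for k
      using borel_sets_open[OF U] finite_borel_measureD(2)[OF M]
      by (intro integrable_divide_zero integrable_real_indicator) (auto simp: M.emeasure_eq_measure)
    have low: "(\<Sum>k\<in>{1..<N}. mass (U k) / real n) \<le> integral\<^sup>L representing_measure f"
    proof -
      have "(\<Sum>k\<in>{1..<N}. mass (U k) / real n) =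
          (\<Sum>k\<in>{1..<N}. integral\<^sup>L representing_measure (\<lambda>x. indicator (U k) x / real n))"
        using measure_representing_open[OF U] openin_subset[OF U] space
        by (simp add: Int_absorb2)
      also have "\<dots> = integral\<^sup>L representing_measure (\<lambda>x. \<Sum>k\<in>{1..<N}. indicator (U k) x / real n)"
        by (rule Bochner_Integration.integral_sum[symmetric, OF intU])
      also have "\<dots> \<le> integral\<^sup>L representing_measure f"
      proof (rule integral_mono)
        show "integrable representing_measure (\<lambda>x. \<Sum>k\<in>{1..<N}. indicator (U k) x / real n)"
          by (rule Bochner_Integration.integrable_sum[OF intU])
        show "integrable representing_measure f"
          by (rule integrable_bounded_continuous[OF f(1) M])
        fix x assume x: "x \<in> space representing_measure"
        \<comment> \<open>A point of \<open>U k\<close> has completely filled slice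
          \<open>k - 1\<close>. This shift is the reason for starting at \<open>U 1\<close>.\<close>
        have "(\<Sum>k\<in>{1..<N}. indicator (U k) x / real n) \<le> (\<Sum>k\<in>{1..<N}. \<phi> (k - 1) x)"
        proof (rule sum_mono)
          fix k assume k: "k \<in> {1..<N}"
          have "\<tau> k = \<tau> (k - 1) + 1 / real n"
            using \<tau>[of "k - 1"] k by simp
          moreover have "0 \<le> 1 / real n"
            by simp
          ultimately have "(if \<tau> k < f x then 1 / real n else 0) \<le> min (f x) (\<tau> k) - min (f x) (\<tau> (k - 1))"
            by (smt (verit))
          then show "indicator (U k) x / real n \<le> \<phi> (k - 1) x"
            using k x space by (auto simp: \<phi>_def indicator_def U_def split: if_splits)
        qed
        also have "\<dots> = (\<Sum>k<N - 1. \<phi> k x)"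
          by (rule sum.reindex_bij_witness[of _ Suc "\<lambda>k. k - 1"]) auto
        also have "\<dots> \<le> (\<Sum>k<N. \<phi> k x)"
          using \<tau>_mono by (intro sum_mono2) (auto simp: \<phi>_def intro: min.coboundedI2)
        also have "\<dots> = f x"
          using fN x space by simp
        finally show "(\<Sum>k\<in>{1..<N}. indicator (U k) x / real n) \<le> f x" .
      qed
      finally show ?thesis .
    qed
    have "\<Lambda> f \<le> \<Lambda> (\<lambda>x. \<Sum>k<N. \<phi> k x)"
      using fN by (intro mono f bounded_continuous_sum bc) auto
    also have "\<dots> = (\<Sum>k<N. \<Lambda> (\<phi> k))"
      by (rule sum[OF bc])
    also have "\<dots> \<le> (\<Sum>k<N. mass (U k) / real n)"
      by (intro sum_mono up)
    \<comment> \<open>For \<open>N = 0\<close> the left sum is empty and inserting 0 is a genuine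
      enlargement; this avoids a case distinction.\<close>
    also have "\<dots> \<le> (\<Sum>k\<in>insert 0 {1..<N}. mass (U k) / real n)"
      using mass_nonneg by (intro sum_mono2) auto
    also have "\<dots> = mass (U 0) / real n + (\<Sum>k\<in>{1..<N}. mass (U k) / real n)"
      by simp
    also have "mass (U 0) / real n \<le> \<Lambda> (\<lambda>x. 1) / real n"
      using mass_mono[of "U 0" "topspace X"] mass_topspace by (intro divide_right_mono) (auto simp: U_def)
    finally show ?thesis
      using low by linarith
  qed
  have "(\<lambda>n. integral\<^sup>L representing_measure f + \<Lambda> (\<lambda>x. 1) / real n) \<longlonglongrightarrow> integral\<^sup>L representing_measure f + 0"
    by (intro tendsto_intros lim_const_over_n)
  then show ?thesis
    using main by (intro LIMSEQ_le_const[where X = "\<lambda>n. integral\<^sup>L representing_measure f + \<Lambda> (\<lambda>x. 1) / real n"])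
      (auto intro: exI[of _ 1])
qed

text \<open>The one-sided estimate, applied to \<open>f + K\<close> and to \<open>K - f\<close>,
  gives both inequalities, because constants are represented exactly.\<close>

lemma integral_representing:
  assumes f: "bounded_continuous X f"
  shows "\<Lambda> f = integral\<^sup>L representing_measure f"
proof -
  note M = finite_borel_measure_representing
  interpret M: finite_measure representing_measure
    by (rule finite_borel_measureD(1)[OF M])
  have one: "measure representing_measure (topspace X) = \<Lambda> (\<lambda>x. 1)"
    using measure_representing_open[OF openin_topspace] mass_topspace by simp
  note int = integrable_bounded_continuous[OF f M]
  obtain K where K: "\<And>x. x \<in> topspace X \<Longrightarrow> \<bar>f x\<bar> \<le> K"
    using bounded_continuousD(2)[OF f] by blast
  have fK: "0 \<le> f x + K" "0 \<le> K - f x" if "x \<in> topspace X" for x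
    using K[OF that] by linarith+
  have "\<Lambda> (\<lambda>x. f x + K) \<le> integral\<^sup>L representing_measure (\<lambda>x. f x + K)"
    using fK by (intro le_integral_representing bounded_continuous_add f bounded_continuous_const)
  moreover have "\<Lambda> (\<lambda>x. K - f x) \<le> integral\<^sup>L representing_measure (\<lambda>x. K - f x)"
    using fK by (intro le_integral_representing bounded_continuous_diff f bounded_continuous_const)
  ultimately show ?thesis
    using int finite_borel_measureD(3)[OF M] const[of K] one
      add[OF f bounded_continuous_const, of K] diff[OF bounded_continuous_const f, of K]
    by simp
qed

end


section \<open>Compactness of tight sets of measures\<close>

text \<open>Dini's theorem: the sets where \<open>f n\<close> is below e are open and increase with
  n, so a finite subcover reduces to its last member.\<close>

lemma decreasing_to_0_uniform_on_compactin:
  fixes f :: "nat \<Rightarrow> 'a \<Rightarrow> real"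
  assumes K: "compactin X K" and cont: "\<And>n. continuous_map X euclideanreal (f n)"
    and dec: "\<And>m n x. m \<le> n \<Longrightarrow> x \<in> topspace X \<Longrightarrow> f n x \<le> f m x"
    and lim: "\<And>x. x \<in> topspace X \<Longrightarrow> (\<lambda>n. f n x) \<longlonglongrightarrow> 0" and e: "0 < e"
  shows "\<exists>N. \<forall>n\<ge>N. \<forall>x\<in>K. f n x < e"
proof -
  define U where "U n = {x \<in> topspace X. f n x < e}" for n
  have KX: "K \<subseteq> topspace X"
    by (rule compactin_subset_topspace[OF K])
  have op: "openin X V" if "V \<in> range U" for V
    using that openin_continuous_map_preimage[OF cont, of "{..<e}"] by (auto simp: U_def)
  have cov: "K \<subseteq> \<Union>(range U)"
  proof
    fix x assume x: "x \<in> K"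
    then have "\<forall>\<^sub>F n in sequentially. f n x < e"
      using order_tendstoD(2)[OF lim[of x] e] KX by auto
    then obtain n where "f n x < e"
      by (auto simp: eventually_sequentially)
    then show "x \<in> \<Union>(range U)"
      using x KX by (auto simp: U_def)
  qed
  obtain \<F> where F: "finite \<F>" "\<F> \<subseteq> range U" "K \<subseteq> \<Union>\<F>"
    using compactinD[OF K op cov] by blast
  then obtain I where I: "finite I" "\<F> = U ` I"
    using finite_subset_image by metis
  have "f n x < e" if n: "n \<ge> Max (insert 0 I)" and x: "x \<in> K" for n x
  proof -
    obtain i where i: "i \<in> I" "x \<in> U i"
      using F(3) x I by auto
    then have "i \<le> n"
      using n I Max_ge[of "insert 0 I" i] by auto
    then show ?thesis
      using dec[of i n x] i by (auto simp: U_def)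
  qed
  then show ?thesis
    by blast
qed

text \<open>\<open>restrict\<close> makes the evaluation extensional, hence a point of the product
  space indexed by the bounded continuous functions.\<close>

definition narrow_eval :: "'a topology \<Rightarrow> ('a set \<Rightarrow> real) \<Rightarrow> ('a \<Rightarrow> real) \<Rightarrow> real" where
  "narrow_eval X \<sigma> = restrict (signed_integral X \<sigma>) {f. bounded_continuous X f}"

text \<open>The narrow topology is the initial topology of the evaluation map: preimages of open
  sets are closed under the finite intersections and unions that generate it, and they contain its
  subbasis.\<close>

lemma openin_narrow_pullback:
  assumes "openin (narrow_topology X) U"
  shows "\<exists>V. openin (product_topology (\<lambda>_. euclideanreal) {f. bounded_continuous X f}) V \<and>
    U = {\<sigma> \<in> signed_measures X. narrow_eval X \<sigma> \<in> V}"
proof -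
  let ?P = "product_topology (\<lambda>_. euclideanreal) {f. bounded_continuous X f}"
  have "generate_topology_on {{\<mu> \<in> signed_measures X. signed_integral X \<mu> f \<in> U} | f U.
        continuous_map X euclideanreal f \<and> bounded (f ` topspace X) \<and> open U} U"
    using assms unfolding narrow_topology_def openin_topology_generated_by_iff .
  then show ?thesis
  proof induction
    case Empty
    then show ?case by (intro exI[of _ "{}"]) auto
  next
    case (Int A B)
    then obtain V W where "openin ?P V" "A = {\<sigma> \<in> signed_measures X. narrow_eval X \<sigma> \<in> V}"
      "openin ?P W" "B = {\<sigma> \<in> signed_measures X. narrow_eval X \<sigma> \<in> W}" by blast
    then show ?case by (intro exI[of _ "V \<inter> W"]) auto
  next
    case (UN K)
    then have "\<forall>k\<in>K. \<exists>V. openin ?P V \<and> k = {\<sigma> \<in> signed_measures X. narrow_eval X \<sigma> \<in> V}"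
      by blast
    from bchoice[OF this] obtain V where
      V: "\<forall>k\<in>K. openin ?P (V k) \<and> k = {\<sigma> \<in> signed_measures X. narrow_eval X \<sigma> \<in> V k}" ..
    have "\<Union>K = (\<Union>k\<in>K. k)"
      by simp
    also have "\<dots> = (\<Union>k\<in>K. {\<sigma> \<in> signed_measures X. narrow_eval X \<sigma> \<in> V k})"
      by (rule SUP_cong[OF refl conjunct2[OF bspec[OF V]]])
    also have "\<dots> = {\<sigma> \<in> signed_measures X. narrow_eval X \<sigma> \<in> (\<Union>k\<in>K. V k)}"
      by auto
    finally show ?case
      using V by (intro exI[of _ "\<Union>k\<in>K. V k"] conjI openin_Union) blast+
  next
    case (Basis A)
    then obtain f W where f: "bounded_continuous X f" "open W"
      "A = {\<mu> \<in> signed_measures X. signed_integral X \<mu> f \<in> W}"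
      by (auto simp: bounded_continuous_def)
    have "openin ?P {y \<in> topspace ?P. y f \<in> W}"
      using f by (intro openin_continuous_map_preimage[OF continuous_map_product_projection]) auto
    moreover have "A = {\<sigma> \<in> signed_measures X. narrow_eval X \<sigma> \<in> {y \<in> topspace ?P. y f \<in> W}}"
      using f by (auto simp: narrow_eval_def)
    ultimately show ?case by blast
  qed
qed

text \<open>A narrowly open cover consists of preimages of open sets of the product, so a finite
  subcover of the image can be pulled back.\<close>

lemma compactin_narrow:
  assumes K: "K \<subseteq> signed_measures X"
    and c: "compactin (product_topology (\<lambda>_. euclideanreal) {f. bounded_continuous X f}) (narrow_eval X ` K)"
  shows "compactin (narrow_topology X) K"
  unfolding compactin_def
proof (intro conjI allI impI)
  let ?P = "product_topology (\<lambda>_. euclideanreal) {f. bounded_continuous X f}"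
  show "K \<subseteq> topspace (narrow_topology X)"
    using K by simp
  fix \<U> assume \<U>: "Ball \<U> (openin (narrow_topology X)) \<and> K \<subseteq> \<Union>\<U>"
  then have "\<forall>U\<in>\<U>. \<exists>V. openin ?P V \<and> U = {\<sigma> \<in> signed_measures X. narrow_eval X \<sigma> \<in> V}"
    using openin_narrow_pullback by blast
  from bchoice[OF this] obtain V where
    V: "\<And>U. U \<in> \<U> \<Longrightarrow> openin ?P (V U)"
      "\<And>U. U \<in> \<U> \<Longrightarrow> U = {\<sigma> \<in> signed_measures X. narrow_eval X \<sigma> \<in> V U}"
    by blast
  have "narrow_eval X ` K \<subseteq> \<Union>(V ` \<U>)"
  proof
    fix y assume "y \<in> narrow_eval X ` K"
    then obtain \<sigma> where \<sigma>: "y = narrow_eval X \<sigma>" "\<sigma> \<in> K" by blast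
    then obtain U where "U \<in> \<U>" "\<sigma> \<in> U" using \<U> by blast
    then show "y \<in> \<Union>(V ` \<U>)"
      using V(2)[of U] \<sigma>(1) by blast
  qed
  moreover have "openin ?P W" if "W \<in> V ` \<U>" for W
    using that V(1) by auto
  ultimately have "\<exists>\<F>. finite \<F> \<and> \<F> \<subseteq> V ` \<U> \<and> narrow_eval X ` K \<subseteq> \<Union>\<F>"
    by (intro compactinD[OF c])
  then obtain \<F> where F: "finite \<F>" "\<F> \<subseteq> V ` \<U>" "narrow_eval X ` K \<subseteq> \<Union>\<F>"
    by (elim exE conjE)
  obtain \<G> where "\<G> \<subseteq> \<U>" "finite \<G>" "\<F> = V ` \<G>"
    using finite_subset_image[OF F(1,2)] by (elim exE conjE)
  with F(3) have G: "finite \<G>" "\<G> \<subseteq> \<U>" "narrow_eval X ` K \<subseteq> \<Union>(V ` \<G>)"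
    by simp_all
  have "K \<subseteq> \<Union>\<G>"
  proof
    fix \<sigma> assume \<sigma>: "\<sigma> \<in> K"
    then obtain U where "U \<in> \<G>" "narrow_eval X \<sigma> \<in> V U" using G(3) by blast
    then show "\<sigma> \<in> \<Union>\<G>"
      using V(2)[of U] G(2) K \<sigma> by blast
  qed
  then show "\<exists>\<F>. finite \<F> \<and> \<F> \<subseteq> \<U> \<and> K \<subseteq> \<Union>\<F>"
    using G by blast
qed

lemma signed_integral_mono_nonneg:
  assumes "\<sigma> \<in> nonneg_measures X" "bounded_continuous X f" "bounded_continuous X g"
    "\<And>x. x \<in> topspace X \<Longrightarrow> f x \<le> g x"
  shows "signed_integral X \<sigma> f \<le> signed_integral X \<sigma> g"
  using assms finite_borel_measure_to_measure(1)[OF assms(1)] finite_borel_measureD(3)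
  unfolding signed_integral_nonneg_measure[OF assms(1)]
  by (intro integral_mono integrable_bounded_continuous) auto

lemma signed_integral_const:
  assumes "\<sigma> \<in> nonneg_measures X"
  shows "signed_integral X \<sigma> (\<lambda>x. c) = c * \<sigma> (topspace X)"
  using finite_borel_measure_to_measure[OF assms] finite_borel_measureD(3)[of X "to_measure X \<sigma>"]
  unfolding signed_integral_nonneg_measure[OF assms] by (simp add: mult.commute)

text \<open>The evaluations of these measures satisfy every closed affine inequality between three
  coordinates that they satisfy simultaneously, and a point of the product that does so comes from a
  Daniell functional.\<close>

lemma compactin_tight_measures:
  assumes X: "metrizable_space X" and \<psi>: "lower_semicontinuous_map X \<psi>"
    and sub: "compact_sublevel_sets X \<psi>"
  shows "compactin (narrow_topology X)
    {\<sigma> \<in> nonneg_measures X. \<sigma> (topspace X) \<le> R \<and> regulariser X \<psi> \<sigma> \<le> ennreal C}"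
proof (rule compactin_narrow)
  define K where "K = {\<sigma> \<in> nonneg_measures X. \<sigma> (topspace X) \<le> R \<and> regulariser X \<psi> \<sigma> \<le> ennreal C}"
  define B where "B = {f :: 'a \<Rightarrow> real. bounded_continuous X f}"
  let ?P = "product_topology (\<lambda>_. euclideanreal) B"
  have KD: "\<sigma> \<in> nonneg_measures X" "\<sigma> (topspace X) \<le> R" "0 \<le> \<sigma> (topspace X)" "regulariser X \<psi> \<sigma> \<le> ennreal C"
    if "\<sigma> \<in> K" for \<sigma>
    using that nonneg_measuresD(2) by (auto simp: K_def)
  show "{\<sigma> \<in> nonneg_measures X. \<sigma> (topspace X) \<le> R \<and> regulariser X \<psi> \<sigma> \<le> ennreal C} \<subseteq> signed_measures X"
    using nonneg_measuresD(1) by auto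
  have eval: "narrow_eval X \<sigma> f = signed_integral X \<sigma> f" if "f \<in> B" for \<sigma> f
    using that by (simp add: narrow_eval_def B_def)
  define Z where "Z = {y \<in> topspace ?P. \<forall>f1\<in>B. \<forall>f2\<in>B. \<forall>f3\<in>B. \<forall>c1 c2 c3 r.
    (\<forall>\<sigma>\<in>K. c1 * signed_integral X \<sigma> f1 + c2 * signed_integral X \<sigma> f2 + c3 * signed_integral X \<sigma> f3 \<le> r) \<longrightarrow>
    c1 * y f1 + c2 * y f2 + c3 * y f3 \<le> r}"
  have ZD: "c1 * y f1 + c2 * y f2 + c3 * y f3 \<le> r"
    if "y \<in> Z" "f1 \<in> B" "f2 \<in> B" "f3 \<in> B"
      "\<And>\<sigma>. \<sigma> \<in> K \<Longrightarrow> c1 * signed_integral X \<sigma> f1 + c2 * signed_integral X \<sigma> f2 + c3 * signed_integral X \<sigma> f3 \<le> r"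
    for y f1 f2 f3 c1 c2 c3 r
    using that unfolding Z_def by blast
  have ZD1: "c * y f \<le> r" if "y \<in> Z" "f \<in> B" "\<And>\<sigma>. \<sigma> \<in> K \<Longrightarrow> c * signed_integral X \<sigma> f \<le> r" for y f c r
    using ZD[OF that(1,2,2,2), of c 0 0 r] that(3) by simp
  have sub1: "narrow_eval X ` K \<subseteq> Z"
  proof (rule image_subsetI)
    fix \<sigma> assume "\<sigma> \<in> K"
    moreover have "narrow_eval X \<sigma> \<in> topspace ?P"
      by (simp add: narrow_eval_def B_def)
    ultimately show "narrow_eval X \<sigma> \<in> Z"
      unfolding Z_def by (simp add: eval)
  qed
  have closed: "closedin ?P Z"
  proof -
    define J where "J = {(f1, f2, f3, c1, c2, c3, r). f1 \<in> B \<and> f2 \<in> B \<and> f3 \<in> B \<and>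
      (\<forall>\<sigma>\<in>K. c1 * signed_integral X \<sigma> f1 + c2 * signed_integral X \<sigma> f2 + c3 * signed_integral X \<sigma> f3 \<le> r)}"
    define S where "S = (\<lambda>(f1, f2, f3, c1, c2, c3, r). {y \<in> topspace ?P. c1 * y f1 + c2 * y f2 + c3 * y f3 \<in> {..r}})"
    \<comment> \<open>The trivial inequality keeps the index set nonempty; an empty intersection
      would be the whole type instead of the topspace.\<close>
    have 0: "((\<lambda>x. 0), (\<lambda>x. 0), (\<lambda>x. 0), 0, 0, 0, 0) \<in> J"
      using bounded_continuous_const[of X 0] by (simp add: J_def B_def)
    have "Z = (\<Inter>j\<in>J. S j)"
    proof (intro equalityI subsetI INT_I)
      fix y j assume "y \<in> Z" "j \<in> J"
      then show "y \<in> S j"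
        unfolding Z_def J_def S_def by (cases j) simp
    next
      fix y assume y: "y \<in> (\<Inter>j\<in>J. S j)"
      have yt: "y \<in> topspace ?P"
        using INT_D[OF y 0] by (simp add: S_def)
      have "c1 * y f1 + c2 * y f2 + c3 * y f3 \<le> r" if "(f1, f2, f3, c1, c2, c3, r) \<in> J" for f1 f2 f3 c1 c2 c3 r
        using INT_D[OF y that] by (simp add: S_def)
      then show "y \<in> Z"
        using yt unfolding Z_def J_def by simp
    qed
    moreover have "closedin ?P (S j)" if j: "j \<in> J" for j
    proof -
      obtain f1 f2 f3 c1 c2 c3 r where jj: "j = (f1, f2, f3, c1, c2, c3, r)"
        by (cases j) auto
      then have f: "f1 \<in> B" "f2 \<in> B" "f3 \<in> B"
        using j by (simp_all add: J_def)
      have "continuous_map ?P euclideanreal (\<lambda>y. c1 * y f1 + c2 * y f2 + c3 * y f3)"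
        using f by (intro continuous_map_add continuous_map_real_mult_left continuous_map_product_projection)
      from closedin_continuous_map_preimage[OF this, of "{..r}"] show ?thesis
        unfolding jj S_def by simp
    qed
    ultimately show ?thesis
      using 0 by (metis closedin_INT empty_iff)
  qed
  define b where "b f = (SOME b. 0 \<le> b \<and> (\<forall>x\<in>topspace X. \<bar>f x\<bar> \<le> b))" for f :: "'a \<Rightarrow> real"
  have b: "0 \<le> b f" "\<And>x. x \<in> topspace X \<Longrightarrow> \<bar>f x\<bar> \<le> b f" if "f \<in> B" for f
    using someI_ex[of "\<lambda>b. 0 \<le> b \<and> (\<forall>x\<in>topspace X. \<bar>f x\<bar> \<le> b)"] bounded_continuousD(2)[of X f] that
    by (auto simp: B_def b_def)
  have "compactin ?P Z"
  proof (rule closed_compactin[OF _ _ closed])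
    \<comment> \<open>Tychonoff's theorem. A measure of mass at most R integrates f into this
      interval, and \<open>Z\<close> inherits the bound as two affine inequalities.\<close>
    show "compactin ?P (PiE B (\<lambda>f. {- (R * b f)..R * b f}))"
      by (simp add: compactin_PiE)
    show "Z \<subseteq> PiE B (\<lambda>f. {- (R * b f)..R * b f})"
    proof
      fix y assume y: "y \<in> Z"
      have "y f \<in> {- (R * b f)..R * b f}" if f: "f \<in> B" for f
      proof -
        have f': "bounded_continuous X f"
          using f by (simp add: B_def)
        have "signed_integral X \<sigma> f \<le> R * b f" "- signed_integral X \<sigma> f \<le> R * b f" if \<sigma>: "\<sigma> \<in> K" for \<sigma>
        proof -
          have "signed_integral X \<sigma> f \<le> signed_integral X \<sigma> (\<lambda>x. b f)"
            using b(2)[OF f] abs_le_D1 by (intro signed_integral_mono_nonneg[OF KD(1)[OF \<sigma>] f' bounded_continuous_const]) blast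
          moreover have "signed_integral X \<sigma> (\<lambda>x. - b f) \<le> signed_integral X \<sigma> f"
            using abs_le_D2[OF b(2)[OF f]]
            by (intro signed_integral_mono_nonneg[OF KD(1)[OF \<sigma>] bounded_continuous_const f']) (simp add: minus_le_iff)
          moreover have "b f * \<sigma> (topspace X) \<le> b f * R"
            using KD(2)[OF \<sigma>] b(1)[OF f] by (rule mult_left_mono)
          ultimately show "signed_integral X \<sigma> f \<le> R * b f" "- signed_integral X \<sigma> f \<le> R * b f"
            unfolding signed_integral_const[OF KD(1)[OF \<sigma>]] by (auto simp: mult.commute)
        qed
        then show ?thesis
          using ZD1[OF y f, of 1 "R * b f"] ZD1[OF y f, of "-1" "R * b f"] by simp
      qed
      then show "y \<in> PiE B (\<lambda>f. {- (R * b f)..R * b f})"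
        using y by (auto simp: Z_def PiE_iff)
    qed
  qed
  moreover have "Z \<subseteq> narrow_eval X ` K"
  proof
    fix y assume y: "y \<in> Z"
    have lin: "signed_integral X \<sigma> (\<lambda>x. f x + g x) = signed_integral X \<sigma> f + signed_integral X \<sigma> g"
      "signed_integral X \<sigma> (\<lambda>x. c * f x) = c * signed_integral X \<sigma> f"
      if "\<sigma> \<in> K" "bounded_continuous X f" "bounded_continuous X g" for \<sigma> f g c
      using integrable_bounded_continuous[OF _ finite_borel_measure_to_measure(1)[OF KD(1)[OF that(1)]]] that(2,3)
      unfolding signed_integral_nonneg_measure[OF KD(1)[OF that(1)]] by simp_all
    interpret daniell_functional X y
    proof
      show "metrizable_space X" by (rule X)
    next
      fix f g :: "'a \<Rightarrow> real"
      assume f: "bounded_continuous X f" and g: "bounded_continuous X g"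
      have fg: "f \<in> B" "g \<in> B" "(\<lambda>x. f x + g x) \<in> B"
        using f g bounded_continuous_add by (auto simp: B_def)
      \<comment> \<open>Equations are recovered from two opposite inequalities; additivity is the
        reason for allowing three coordinates.\<close>
      show "y (\<lambda>x. f x + g x) = y f + y g"
        using ZD[OF y fg(3,1,2), of 1 "-1" "-1" 0] ZD[OF y fg(3,1,2), of "-1" 1 1 0] lin(1)[OF _ f g] by simp
    next
      fix f :: "'a \<Rightarrow> real" and c :: real
      assume f: "bounded_continuous X f"
      have cf: "f \<in> B" "(\<lambda>x. c * f x) \<in> B"
        using f bounded_continuous_mult_left by (auto simp: B_def)
      show "y (\<lambda>x. c * f x) = c * y f"
        using ZD[OF y cf(1,2,2), of c "-1" 0 0] ZD[OF y cf(1,2,2), of "-c" 1 0 0] lin(2)[OF _ f f] by simp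
    next
      fix f :: "'a \<Rightarrow> real"
      assume f: "bounded_continuous X f" "\<And>x. x \<in> topspace X \<Longrightarrow> 0 \<le> f x"
      have "- 1 * signed_integral X \<sigma> f \<le> 0" if "\<sigma> \<in> K" for \<sigma>
        using signed_integral_mono_nonneg[OF KD(1)[OF that] bounded_continuous_const[of X 0] f]
          signed_integral_const[OF KD(1)[OF that], of 0] by simp
      then show "0 \<le> y f"
        using ZD1[OF y, of f "-1" 0] f(1) by (simp add: B_def)
    next
      fix f :: "nat \<Rightarrow> 'a \<Rightarrow> real"
      assume f: "\<And>n. bounded_continuous X (f n)" "\<And>m n x. m \<le> n \<Longrightarrow> x \<in> topspace X \<Longrightarrow> f n x \<le> f m x"
        "\<And>x. x \<in> topspace X \<Longrightarrow> (\<lambda>n. f n x) \<longlonglongrightarrow> 0"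
      have fB: "f n \<in> B" for n
        using f(1) by (simp add: B_def)
      have f0: "0 \<le> f n x" if x: "x \<in> topspace X" for n x
        using f(2)[OF _ x] by (intro LIMSEQ_le_const2[OF f(3)[OF x]]) auto
      show "(\<lambda>n. y (f n)) \<longlonglongrightarrow> 0"
      proof (rule LIMSEQ_I)
        fix e :: real
        assume e: "0 < e"
        define \<beta> where "\<beta> = b (f 0)"
        have \<beta>: "0 \<le> \<beta>" "\<And>n x. x \<in> topspace X \<Longrightarrow> f n x \<le> \<beta>"
          using b[OF fB[of 0]] f(2)[of 0] unfolding \<beta>_def by (auto simp: abs_le_iff intro: order_trans)
        \<comment> \<open>Tightness estimate: where \<psi> exceeds j, \<open>f n\<close> is at most
          \<beta>/j times \<psi>, which integrates to at most e/2 by the choice of j; on the compact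
          remainder Dini's theorem puts \<open>f n\<close> below \<epsilon>, contributing at most
          e/4. The total stays below e uniformly over \<open>K\<close>, so it passes to y as one
          more affine inequality. C and R may be negative here, hence \<open>max 0 C\<close> and
          \<open>\<bar>R\<bar>\<close>.\<close>
        define j where "j = 2 * \<beta> * (max 0 C + 1) / e + 1"
        have j: "0 < j"
          using \<beta> e by (auto simp: j_def intro!: add_nonneg_pos)
        have "\<beta> * (max 0 C + 1) * 2 \<le> j * e"
          using e by (simp add: j_def field_simps)
        then have j2: "\<beta> / j * (max 0 C + 1) \<le> e / 2"
          using j by (simp add: field_simps)
        define \<epsilon> where "\<epsilon> = e / (4 * (\<bar>R\<bar> + 1))"
        have \<epsilon>: "0 < \<epsilon>" "\<epsilon> * \<bar>R\<bar> \<le> e / 4"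
          using e by (auto simp: \<epsilon>_def field_simps)
        have "compactin X {x \<in> topspace X. \<psi> x \<le> ennreal j}"
          using sub unfolding compact_sublevel_sets_def by simp
        from decreasing_to_0_uniform_on_compactin[OF this bounded_continuousD(1)[OF f(1)] f(2,3) \<epsilon>(1)]
        obtain N where N: "\<And>n x. n \<ge> N \<Longrightarrow> x \<in> topspace X \<Longrightarrow> \<psi> x \<le> ennreal j \<Longrightarrow> f n x < \<epsilon>"
          by auto
        have "norm (y (f n) - 0) < e" if n: "n \<ge> N" for n
        proof -
          have "signed_integral X \<sigma> (f n) \<le> e / 4 + e / 2" if \<sigma>: "\<sigma> \<in> K" for \<sigma>
          proof -
            note M = finite_borel_measure_to_measure[OF KD(1)[OF \<sigma>]]
            have sp: "space (to_measure X \<sigma>) = topspace X"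
              by (rule finite_borel_measureD(3)[OF M(1)])
            \<comment> \<open>\<open>f n\<close> is known to be non-negative only on the topspace,
              whereas \<open>nn_integral_bounded_continuous\<close> wants this everywhere; the
              truncation repairs it.\<close>
            have "ennreal (max 0 (f n x)) \<le> ennreal \<epsilon> + ennreal (\<beta> / j) * \<psi> x" if x: "x \<in> topspace X" for x
            proof (cases "\<psi> x \<le> ennreal j")
              case True
              then have "ennreal (max 0 (f n x)) \<le> ennreal \<epsilon>"
                using N[OF n x] \<epsilon> by (intro ennreal_leI) auto
              then show ?thesis
                by (rule add_increasing2[rotated]) simp
            next
              case False
              have "ennreal (max 0 (f n x)) \<le> ennreal (\<beta> / j * j)"
                using \<beta>(1) \<beta>(2)[OF x] j by (intro ennreal_leI) auto
              also have "\<dots> = ennreal (\<beta> / j) * ennreal j"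
                using \<beta>(1) j by (intro ennreal_mult) auto
              also have "\<dots> \<le> ennreal (\<beta> / j) * \<psi> x"
                using False by (intro mult_left_mono) auto
              finally show ?thesis
                by (rule add_increasing[rotated]) simp
            qed
            then have "(\<integral>\<^sup>+x. ennreal (max 0 (f n x)) \<partial>to_measure X \<sigma>) \<le>
                (\<integral>\<^sup>+x. ennreal \<epsilon> + ennreal (\<beta> / j) * \<psi> x \<partial>to_measure X \<sigma>)"
              using sp by (intro nn_integral_mono) auto
            also have "\<dots> = ennreal \<epsilon> * emeasure (to_measure X \<sigma>) (topspace X) + ennreal (\<beta> / j) * regulariser X \<psi> \<sigma>"
            proof -
              have [measurable]: "\<psi> \<in> borel_measurable (to_measure X \<sigma>)"
                using borel_measurable_lower_semicontinuous[OF \<psi>] measurable_finite_borel_measure[OF M(1)] by blast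
              show ?thesis
                by (simp add: nn_integral_add nn_integral_cmult regulariser_def sp)
            qed
            also have "emeasure (to_measure X \<sigma>) (topspace X) = ennreal (\<sigma> (topspace X))"
              using finite_measure.emeasure_eq_measure[OF finite_borel_measureD(1)[OF M(1)]] M(2) by simp
            also have "ennreal \<epsilon> * ennreal (\<sigma> (topspace X)) + ennreal (\<beta> / j) * regulariser X \<psi> \<sigma> \<le>
                ennreal \<epsilon> * ennreal \<bar>R\<bar> + ennreal (\<beta> / j) * ennreal (max 0 C + 1)"
            proof (intro add_mono mult_left_mono)
              show "regulariser X \<psi> \<sigma> \<le> ennreal (max 0 C + 1)"
                by (rule order_trans[OF KD(4)[OF \<sigma>] ennreal_leI]) simp
              show "ennreal (\<sigma> (topspace X)) \<le> ennreal \<bar>R\<bar>"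
                using KD(2)[OF \<sigma>] by (intro ennreal_leI) simp
            qed simp_all
            also have "\<dots> = ennreal (\<epsilon> * \<bar>R\<bar> + \<beta> / j * (max 0 C + 1))"
              using \<epsilon>(1) \<beta>(1) j
              by (subst ennreal_plus) (auto simp: ennreal_mult[symmetric] simp del: ennreal_plus times_divide_eq_left)
            also have "\<dots> \<le> ennreal (e / 4 + e / 2)"
              using \<epsilon>(2) j2 by (intro ennreal_leI add_mono)
            finally have "ennreal (signed_integral X \<sigma> (\<lambda>x. max 0 (f n x))) \<le> ennreal (e / 4 + e / 2)"
              using nn_integral_bounded_continuous[OF bounded_continuous_min_max(2)[OF bounded_continuous_const f(1)] _ KD(1)[OF \<sigma>]]
              by simp
            then have "signed_integral X \<sigma> (\<lambda>x. max 0 (f n x)) \<le> e / 4 + e / 2"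
              using e by (subst (asm) ennreal_le_iff) auto
            moreover have "signed_integral X \<sigma> (f n) \<le> signed_integral X \<sigma> (\<lambda>x. max 0 (f n x))"
              by (intro signed_integral_mono_nonneg[OF KD(1)[OF \<sigma>] f(1)] bounded_continuous_min_max(2) bounded_continuous_const f(1)) auto
            ultimately show ?thesis
              by linarith
          qed
          then have "y (f n) \<le> e / 4 + e / 2"
            using ZD1[OF y fB[of n], where c = 1 and r = "e / 4 + e / 2"] by simp
          moreover have "0 \<le> y (f n)"
          proof -
            have "- 1 * signed_integral X \<sigma> (f n) \<le> 0" if "\<sigma> \<in> K" for \<sigma>
              using signed_integral_mono_nonneg[OF KD(1)[OF that] bounded_continuous_const[of X 0] f(1) f0]
                signed_integral_const[OF KD(1)[OF that], of 0] by simp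
            then show ?thesis
              using ZD1[OF y fB[of n], where c = "-1" and r = 0] by simp
          qed
          ultimately show ?thesis
            using e by simp
        qed
        then show "\<exists>N. \<forall>n\<ge>N. norm (y (f n) - 0) < e"
          by blast
      qed
    qed
    define \<sigma> where "\<sigma> = measure representing_measure"
    note M = finite_borel_measure_representing
    have \<sigma>: "\<sigma> \<in> nonneg_measures X"
      unfolding \<sigma>_def by (rule measure_nonneg_measures[OF M])
    have int: "signed_integral X \<sigma> f = y f" if "f \<in> B" for f
      using integral_representing[of f] that to_measure_measure[OF M]
      unfolding signed_integral_nonneg_measure[OF \<sigma>] by (simp add: \<sigma>_def B_def)
    have one: "(\<lambda>x. 1) \<in> B"
      using bounded_continuous_const by (simp add: B_def)
    have "y (\<lambda>x. 1) \<le> R"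
      using ZD1[OF y one, of 1 R] signed_integral_const[OF KD(1), of _ 1] KD(2) by simp
    then have R: "\<sigma> (topspace X) \<le> R"
      using int[OF one] signed_integral_const[OF \<sigma>, of 1] by simp
    obtain g :: "nat \<Rightarrow> 'a \<Rightarrow> real" where g: "\<And>n. bounded_continuous X (g n)" "\<And>n x. 0 \<le> g n x"
      "\<And>\<sigma>. \<sigma> \<in> nonneg_measures X \<Longrightarrow> regulariser X \<psi> \<sigma> = (SUP n. ennreal (signed_integral X \<sigma> (g n)))"
      using regulariser_SUP[OF X \<psi>] by metis
    \<comment> \<open>The bound on the integral of \<psi> is not an inequality between coordinates.
      It is transferred through the continuous minorants \<open>g n\<close>, whose supremum gives it
      back.\<close>
    have gC: "y (g n) \<le> max 0 C" for n
    proof -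
      have "1 * signed_integral X \<tau> (g n) \<le> max 0 C" if \<tau>: "\<tau> \<in> K" for \<tau>
      proof -
        have "ennreal (signed_integral X \<tau> (g n)) \<le> ennreal C"
          using KD(4)[OF \<tau>] g(3)[OF KD(1)[OF \<tau>]] by (simp add: SUP_le_iff)
        then show ?thesis
          by (cases "0 \<le> C") (auto simp: ennreal_le_iff ennreal_neg ennreal_eq_0_iff)
      qed
      then show ?thesis
        using ZD1[OF y, of "g n" 1] g(1) by (simp add: B_def)
    qed
    have "regulariser X \<psi> \<sigma> \<le> ennreal (max 0 C)"
      unfolding g(3)[OF \<sigma>] using gC int g(1) by (intro SUP_least ennreal_leI) (simp add: B_def)
    also have "ennreal (max 0 C) = ennreal C"
      by (cases "0 \<le> C") (auto simp: max_def ennreal_neg)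
    finally have "\<sigma> \<in> K"
      using \<sigma> R by (simp add: K_def)
    moreover have "narrow_eval X \<sigma> = y"
    proof
      fix f
      show "narrow_eval X \<sigma> f = y f"
        using int[of f] y by (cases "f \<in> B") (auto simp: narrow_eval_def B_def Z_def PiE_iff extensional_def)
    qed
    ultimately show "y \<in> narrow_eval X ` K"
      by blast
  qed
  ultimately show "compactin (product_topology (\<lambda>_. euclideanreal) {f. bounded_continuous X f})
    (narrow_eval X ` {\<sigma> \<in> nonneg_measures X. \<sigma> (topspace X) \<le> R \<and> regulariser X \<psi> \<sigma> \<le> ennreal C})"
    using sub1 unfolding K_def[symmetric] B_def[symmetric] by (simp add: antisym)
qed


section \<open>Time slices\<close>

text \<open>Where h(t) is nonzero, closeness in \<open>d_F\<close> fixes the sign of h(t) and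
  controls the position. Where h(t) = 0 the position is uncontrolled, but there the small factor
  h(t) multiplies a bounded value.\<close>

lemma curve_observable_continuous:
  fixes \<Omega> :: "'a::euclidean_space set"
  assumes t: "t \<in> {0..1}" and \<psi>: "continuous_on (closure \<Omega>) \<psi>" and K: "\<And>x. x \<in> closure \<Omega> \<Longrightarrow> \<bar>\<psi> x\<bar> \<le> K"
  shows "continuous_map (Gamma_inf_top \<Omega>) euclideanreal (\<lambda>\<gamma>. curve_h \<gamma> t * \<psi> (curve_xi \<gamma> t))"
proof -
  interpret Metric_space "Gamma_inf \<Omega>" "d_Gamma \<Omega>"
    by (rule Metric_space_Gamma_inf)
  have in_closure: "curve_xi \<gamma> t \<in> closure \<Omega>" if "\<gamma> \<in> Gamma_inf \<Omega>" for \<gamma>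
    using curve_representative(2)[OF that] t by (auto simp: paths_def)
  have dF: "d_F (curve_h \<gamma> t, curve_xi \<gamma> t) (curve_h \<gamma>' t, curve_xi \<gamma>' t) \<le> d_Gamma \<Omega> \<gamma> \<gamma>'"
    if "\<gamma> \<in> Gamma_inf \<Omega>" "\<gamma>' \<in> Gamma_inf \<Omega>" for \<gamma> \<gamma>'
  proof -
    have "bdd_above ((\<lambda>t. d_F (curve_h \<gamma> t, curve_xi \<gamma> t) (curve_h \<gamma>' t, curve_xi \<gamma>' t)) ` {0..1})"
      using d_F_bound curve_h_bound[OF that(1)] curve_h_bound[OF that(2)]
      by (intro bdd_aboveI2[where M = 4]) blast
    then show ?thesis
      unfolding d_Gamma_def using that cSUP_upper[OF t] by auto
  qed
  have K0: "0 \<le> K" if "\<gamma> \<in> Gamma_inf \<Omega>" for \<gamma>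
    using K[OF in_closure[OF that]] by linarith
  show ?thesis
    unfolding continuous_map_real_iff Gamma_inf_top_def topspace_mtopology
  proof (intro ballI allI impI)
    fix \<gamma> and e :: real
    assume \<gamma>: "\<gamma> \<in> Gamma_inf \<Omega>" and e: "0 < e"
    define r where "r = curve_h \<gamma> t"
    define x where "x = curve_xi \<gamma> t"
    have "\<exists>\<delta>>0. \<forall>\<gamma>'\<in>Gamma_inf \<Omega>. d_Gamma \<Omega> \<gamma> \<gamma>' < \<delta> \<longrightarrow>
        \<bar>curve_h \<gamma>' t * \<psi> (curve_xi \<gamma>' t) - r * \<psi> x\<bar> < e"
    proof (cases "r = 0")
      case True
      have "\<bar>curve_h \<gamma>' t * \<psi> (curve_xi \<gamma>' t) - r * \<psi> x\<bar> < e"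
        if \<gamma>': "\<gamma>' \<in> Gamma_inf \<Omega>" "d_Gamma \<Omega> \<gamma> \<gamma>' < e / (K + 1)" for \<gamma>'
      proof -
        have h: "\<bar>curve_h \<gamma>' t\<bar> < e / (K + 1)"
        proof (rule le_less_trans[OF _ \<gamma>'(2)])
          show "\<bar>curve_h \<gamma>' t\<bar> \<le> d_Gamma \<Omega> \<gamma> \<gamma>'"
            using dF[OF \<gamma> \<gamma>'(1)] True by (simp add: d_F_alt r_def)
        qed
        have "\<bar>curve_h \<gamma>' t\<bar> * \<bar>\<psi> (curve_xi \<gamma>' t)\<bar> \<le> \<bar>curve_h \<gamma>' t\<bar> * (K + 1)"
          using K[OF in_closure[OF \<gamma>'(1)]] by (intro mult_left_mono) auto
        also have "\<dots> < e"
          using h K0[OF \<gamma>] by (simp add: pos_less_divide_eq)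
        finally show ?thesis
          using True by (simp add: abs_mult)
      qed
      then show ?thesis
        using e K0[OF \<gamma>] by (intro exI[of _ "e / (K + 1)"]) auto
    next
      case False
      have x: "x \<in> closure \<Omega>"
        using in_closure[OF \<gamma>] by (simp add: x_def)
      obtain \<eta> where \<eta>: "\<eta> > 0" "\<And>y. y \<in> closure \<Omega> \<Longrightarrow> dist y x < \<eta> \<Longrightarrow> dist (\<psi> y) (\<psi> x) < e / 2"
        using \<psi> x e unfolding continuous_on_iff by (metis half_gt_zero)
      \<comment> \<open>The first term keeps s at the sign of r with \<open>\<bar>s\<bar>\<close> at
        least half of \<open>\<bar>r\<bar>\<close>, the second bounds the effect of changing r, the
        third brings the positions within \<eta>. \<open>d_F\<close> sees distances only up to 2,
        hence \<open>min 2 \<eta>\<close>; \<open>K + 1\<close> is safely positive.\<close>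
      define \<delta> where "\<delta> = min (min (\<bar>r\<bar> / 2) (e / (2 * (K + 1)))) (\<bar>r\<bar> / 2 * min 2 \<eta>)"
      have "\<delta> > 0"
        using False e \<eta>(1) K0[OF \<gamma>] by (simp add: \<delta>_def)
      moreover have "\<bar>curve_h \<gamma>' t * \<psi> (curve_xi \<gamma>' t) - r * \<psi> x\<bar> < e"
        if \<gamma>': "\<gamma>' \<in> Gamma_inf \<Omega>" "d_Gamma \<Omega> \<gamma> \<gamma>' < \<delta>" for \<gamma>'
      proof -
        define s where "s = curve_h \<gamma>' t"
        define y where "y = curve_xi \<gamma>' t"
        have y: "y \<in> closure \<Omega>"
          using in_closure[OF \<gamma>'(1)] by (simp add: y_def)
        define q where "q = min \<bar>r\<bar> \<bar>s\<bar> * min 2 (norm (x - y))"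
        have d: "\<bar>r - s\<bar> + (if r * s \<le> 0 then 0 else q) < \<delta>"
          using le_less_trans[OF dF[OF \<gamma> \<gamma>'(1)] \<gamma>'(2)]
          unfolding d_F_alt q_def r_def s_def x_def y_def .
        have "0 \<le> q"
          by (simp add: q_def)
        then have rs: "\<bar>r - s\<bar> < \<delta>"
          using d by (cases "r * s \<le> 0") simp_all
        have rs2: "\<bar>r - s\<bar> < \<bar>r\<bar> / 2" "\<bar>r - s\<bar> < e / (2 * (K + 1))"
          using rs by (auto simp: \<delta>_def)
        have pos: "\<not> r * s \<le> 0" "\<bar>r\<bar> / 2 \<le> min \<bar>r\<bar> \<bar>s\<bar>"
          using rs2(1) by (auto simp: mult_le_0_iff abs_if split: if_splits)
        have "\<bar>r\<bar> / 2 * min 2 (norm (x - y)) \<le> q"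
          unfolding q_def using pos(2) by (intro mult_right_mono) auto
        also have "q < \<delta>"
          using d pos(1) by simp
        also have "\<delta> \<le> \<bar>r\<bar> / 2 * min 2 \<eta>"
          unfolding \<delta>_def by (rule min.cobounded2)
        finally have "min 2 (norm (x - y)) < min 2 \<eta>"
          using False by simp
        then have "dist y x < \<eta>"
          by (auto simp: dist_norm norm_minus_commute)
        then have \<psi>xy: "\<bar>\<psi> y - \<psi> x\<bar> < e / 2"
          using \<eta>(2)[OF y] by (simp add: dist_real_def)
        have r1: "\<bar>r\<bar> \<le> 1"
          unfolding r_def by (rule curve_h_bound[OF \<gamma> t])
        have "\<bar>s * \<psi> y - r * \<psi> x\<bar> = \<bar>(s - r) * \<psi> y + r * (\<psi> y - \<psi> x)\<bar>"
          by (simp add: algebra_simps)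
        also have "\<dots> \<le> \<bar>(s - r) * \<psi> y\<bar> + \<bar>r * (\<psi> y - \<psi> x)\<bar>"
          by (rule abs_triangle_ineq)
        also have "\<dots> \<le> \<bar>r - s\<bar> * (K + 1) + 1 * \<bar>\<psi> y - \<psi> x\<bar>"
          unfolding abs_mult using K[OF y] r1 by (intro add_mono mult_mono) auto
        also have "\<bar>r - s\<bar> * (K + 1) < e / 2"
          using rs2(2) K0[OF \<gamma>] by (simp add: pos_less_divide_eq algebra_simps)
        finally show ?thesis
          using \<psi>xy by (simp add: s_def y_def)
      qed
      ultimately show ?thesis
        by blast
    qed
    then obtain \<delta> where "\<delta> > 0" "\<And>\<gamma>'. \<gamma>' \<in> Gamma_inf \<Omega> \<Longrightarrow> d_Gamma \<Omega> \<gamma> \<gamma>' < \<delta> \<Longrightarrow>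
        \<bar>curve_h \<gamma>' t * \<psi> (curve_xi \<gamma>' t) - r * \<psi> x\<bar> < e"
      by blast
    then show "\<exists>U. openin mtopology U \<and> \<gamma> \<in> U \<and>
        (\<forall>\<gamma>'\<in>U. \<bar>curve_h \<gamma>' t * \<psi> (curve_xi \<gamma>' t) - curve_h \<gamma> t * \<psi> (curve_xi \<gamma> t)\<bar> < e)"
      using \<gamma> by (intro exI[of _ "mball \<gamma> \<delta>"]) (auto simp: r_def x_def)
  qed
qed

locale curve_space =
  fixes \<Omega> :: "'a::euclidean_space set" and \<Gamma> :: "'a curve set" and X :: "'a curve topology"
  assumes bounded: "bounded \<Omega>" and closed: "closedin (Gamma_inf_top \<Omega>) \<Gamma>"
    and X_def: "X = subtopology (Gamma_inf_top \<Omega>) \<Gamma>"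
begin

lemma topspace_X: "topspace X = \<Gamma>" "\<Gamma> \<subseteq> Gamma_inf \<Omega>"
proof -
  interpret Metric_space "Gamma_inf \<Omega>" "d_Gamma \<Omega>"
    by (rule Metric_space_Gamma_inf)
  show "\<Gamma> \<subseteq> Gamma_inf \<Omega>"
    using closedin_subset[OF closed] by (simp add: Gamma_inf_top_def)
  then show "topspace X = \<Gamma>"
    by (auto simp: X_def Gamma_inf_top_def)
qed

lemma metrizable_X: "metrizable_space X"
  unfolding X_def Gamma_inf_top_def
  by (intro metrizable_space_subtopology Metric_space.metrizable_space_mtopology Metric_space_Gamma_inf)

lemma compact_closure: "compact (closure \<Omega>)"
  using bounded by (simp add: compact_closure)

lemma continuous_bound:
  assumes "continuous_on (closure \<Omega>) \<psi>"
  obtains K :: real where "\<And>x. x \<in> closure \<Omega> \<Longrightarrow> \<bar>\<psi> x\<bar> \<le> K"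
  using compact_imp_bounded[OF compact_continuous_image[OF assms compact_closure]] that
  by (auto simp: bounded_iff)

lemma xi_in_closure: "\<gamma> \<in> \<Gamma> \<Longrightarrow> t \<in> {0..1} \<Longrightarrow> curve_xi \<gamma> t \<in> closure \<Omega>"
proof -
  assume "\<gamma> \<in> \<Gamma>" and t: "t \<in> {0..1}"
  then have "(curve_h \<gamma>, curve_xi \<gamma>) \<in> paths \<Omega>"
    using curve_representative(2) topspace_X(2) by blast
  then show "curve_xi \<gamma> t \<in> closure \<Omega>"
    using t by (auto simp: paths_def)
qed

lemma observable_bounded_continuous:
  assumes "t \<in> {0..1}" "continuous_on (closure \<Omega>) \<psi>"
  shows "bounded_continuous X (\<lambda>\<gamma>. curve_h \<gamma> t * \<psi> (curve_xi \<gamma> t))"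
proof -
  obtain K where K: "\<And>x. x \<in> closure \<Omega> \<Longrightarrow> \<bar>\<psi> x\<bar> \<le> K"
    using continuous_bound[OF assms(2)] by blast
  show ?thesis
  proof (rule bounded_continuousI[where K = K])
    show "continuous_map X euclideanreal (\<lambda>\<gamma>. curve_h \<gamma> t * \<psi> (curve_xi \<gamma> t))"
      unfolding X_def by (intro continuous_map_from_subtopology curve_observable_continuous[OF assms K])
    fix \<gamma> assume \<gamma>: "\<gamma> \<in> topspace X"
    then have "\<bar>curve_h \<gamma> t\<bar> \<le> 1"
      using curve_h_bound[OF _ assms(1)] topspace_X by blast
    then have "\<bar>curve_h \<gamma> t\<bar> * \<bar>\<psi> (curve_xi \<gamma> t)\<bar> \<le> 1 * K"
      using K[OF xi_in_closure[OF _ assms(1)]] \<gamma> topspace_X by (intro mult_mono) auto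
    then show "\<bar>curve_h \<gamma> t * \<psi> (curve_xi \<gamma> t)\<bar> \<le> K"
      by (simp add: abs_mult)
  qed
qed

text \<open>Where h(t) vanishes, \<open>curve_xi\<close> depends on the chosen representative and
  need not be measurable; a fixed point replaces it there.\<close>

definition position :: "real \<Rightarrow> 'a curve \<Rightarrow> 'a" where
  "position t \<gamma> = (if curve_h \<gamma> t = 0 then (SOME x. x \<in> closure \<Omega>) else curve_xi \<gamma> t)"

lemma position_in_closure:
  assumes "\<gamma> \<in> \<Gamma>" "t \<in> {0..1}"
  shows "position t \<gamma> \<in> closure \<Omega>"
  using xi_in_closure[OF assms] someI[of "\<lambda>x. x \<in> closure \<Omega>"] unfolding position_def by auto

text \<open>On the open set of curves with nonzero h(t), the preimage of V is where h(t) times the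
  distance of the position to the complement of V is nonzero, an open condition on a continuous
  observable. On the rest \<open>position\<close> is constant.\<close>

lemma measurable_position:
  assumes t: "t \<in> {0..1}"
  shows "position t \<in> measurable (borel_of X) (borel_of (top_of_set (closure \<Omega>)))"
  unfolding borel_of_def[of "top_of_set (closure \<Omega>)"]
proof (rule measurable_measure_of)
  show "{U. openin (top_of_set (closure \<Omega>)) U} \<subseteq> Pow (topspace (top_of_set (closure \<Omega>)))"
    by (rule openin_subset_Pow)
  show "position t \<in> space (borel_of X) \<rightarrow> topspace (top_of_set (closure \<Omega>))"
    using position_in_closure[OF _ t] topspace_X by auto
  fix U assume "U \<in> {U. openin (top_of_set (closure \<Omega>)) U}"
  then obtain V where V: "open V" "U = closure \<Omega> \<inter> V"
    by (auto simp: openin_open)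
  \<comment> \<open>The distance to an empty complement would be 0 by convention, so
    \<open>V = UNIV\<close> gets the value 1.\<close>
  define f where "f \<gamma> = curve_h \<gamma> t * (if V = UNIV then 1 else setdist {curve_xi \<gamma> t} (- V))" for \<gamma>
  have "continuous_on (closure \<Omega>) (\<lambda>x. if V = UNIV then 1 else setdist {x} (- V))"
    by (cases "V = UNIV") (auto intro: continuous_on_setdist)
  then have f: "bounded_continuous X f"
    unfolding f_def by (rule observable_bounded_continuous[OF t])
  have fV: "f \<gamma> \<noteq> 0 \<longleftrightarrow> curve_h \<gamma> t \<noteq> 0 \<and> curve_xi \<gamma> t \<in> V" for \<gamma>
    using V(1) setdist_eq_0_closed[of "- V" "curve_xi \<gamma> t"] by (auto simp: f_def)
  have "openin X {\<gamma> \<in> topspace X. f \<gamma> \<in> - {0}}"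
    by (intro openin_continuous_map_preimage[OF bounded_continuousD(1)[OF f]]) auto
  then have 1: "{\<gamma> \<in> topspace X. f \<gamma> \<noteq> 0} \<in> sets (borel_of X)"
    using borel_sets_open by simp
  have "bounded_continuous X (\<lambda>\<gamma>. curve_h \<gamma> t * 1)"
    by (rule observable_bounded_continuous[OF t]) auto
  then have "openin X {\<gamma> \<in> topspace X. curve_h \<gamma> t * 1 \<in> - {0}}"
    by (intro openin_continuous_map_preimage[OF bounded_continuousD(1)]) auto
  then have "openin X {\<gamma> \<in> topspace X. curve_h \<gamma> t \<noteq> 0}"
    by simp
  then have "topspace X - {\<gamma> \<in> topspace X. curve_h \<gamma> t \<noteq> 0} \<in> sets (borel_of X)"
    unfolding sets_borel_of by (intro borel_sets_ops(5)[OF borel_sets_ops(2)] borel_sets_open)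
  then have 2: "(if (SOME x. x \<in> closure \<Omega>) \<in> V then topspace X - {\<gamma> \<in> topspace X. curve_h \<gamma> t \<noteq> 0} else {}) \<in> sets (borel_of X)"
    by (simp add: borel_sets_ops(1))
  have "position t -` U \<inter> space (borel_of X) = {\<gamma> \<in> topspace X. f \<gamma> \<noteq> 0} \<union>
      (if (SOME x. x \<in> closure \<Omega>) \<in> V then topspace X - {\<gamma> \<in> topspace X. curve_h \<gamma> t \<noteq> 0} else {})"
  proof (rule set_eqI)
    fix \<gamma>
    show "\<gamma> \<in> position t -` U \<inter> space (borel_of X) \<longleftrightarrow> \<gamma> \<in> {\<gamma> \<in> topspace X. f \<gamma> \<noteq> 0} \<union>
      (if (SOME x. x \<in> closure \<Omega>) \<in> V then topspace X - {\<gamma> \<in> topspace X. curve_h \<gamma> t \<noteq> 0} else {})"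
    proof (cases "\<gamma> \<in> topspace X")
      case True
      then have "position t \<gamma> \<in> closure \<Omega>"
        using position_in_closure[OF _ t] topspace_X by blast
      then show ?thesis
        using True fV[of \<gamma>] V(2) by (simp add: position_def)
    qed auto
  qed
  then show "position t -` U \<inter> space (borel_of X) \<in> sets (borel_of X)"
    using sets.Un[OF 1 2] by simp
qed

text \<open>The slice is the image under the position of the measure with density \<open>h(t)\<close>, split into four
  according to the signs of \<open>h(t)\<close> and of the measure.\<close>

lemma time_slice_exists:
  assumes \<sigma>: "\<sigma> \<in> signed_measures X" and t: "t \<in> {0..1}"
  shows "\<exists>\<rho>. \<rho> \<in> signed_measures (top_of_set (closure \<Omega>)) \<and>
     (\<forall>\<psi>. continuous_on (closure \<Omega>) \<psi> \<longrightarrow>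
        signed_integral (top_of_set (closure \<Omega>)) \<rho> \<psi> =
        signed_integral X \<sigma> (\<lambda>\<gamma>. curve_h \<gamma> t * \<psi> (curve_xi \<gamma> t)))"
proof -
  let ?Y = "top_of_set (closure \<Omega>)"
  define P where "P b = to_measure X (if b then jordan_pos X \<sigma> else jordan_neg X \<sigma>)" for b
  define sg where "sg b = (if b then 1 else -1 :: real)" for b
  \<comment> \<open>\<open>b\<close> selects the Jordan part and \<open>c\<close> the sign of h(t);
    \<open>ennreal\<close> cuts the density to its positive part, so each of the four measures is
    non-negative.\<close>
  define M where "M = (\<lambda>(b, c). distr (density (P b) (\<lambda>\<gamma>. ennreal (sg c * curve_h \<gamma> t))) (borel_of ?Y) (position t))"
  define s where "s = (\<lambda>(b, c). sg b * sg c)"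
  have P: "finite_borel_measure X (P b)" for b
    using finite_borel_measure_jordan[OF \<sigma>] by (simp add: P_def)
  have spP: "space (P b) = topspace X" for b
    by (rule finite_borel_measureD(3)[OF P])
  have hbc: "bounded_continuous X (\<lambda>\<gamma>. curve_h \<gamma> t * 1)"
    by (rule observable_bounded_continuous[OF t]) auto
  then have hX: "(\<lambda>\<gamma>. curve_h \<gamma> t) \<in> borel_measurable (borel_of X)"
    using borel_measurable_continuous_map[OF bounded_continuousD(1)[OF hbc]] by simp
  then have h[measurable]: "(\<lambda>\<gamma>. curve_h \<gamma> t) \<in> borel_measurable (P b)" for b
    by (simp add: measurable_finite_borel_measure[OF P])
  have h1: "\<bar>curve_h \<gamma> t\<bar> \<le> 1" if "\<gamma> \<in> topspace X" for \<gamma>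
    using curve_h_bound[OF _ t] that topspace_X by blast
  have pos[measurable]: "position t \<in> measurable (P b) (borel_of ?Y)" for b
    using measurable_position[OF t] by (simp add: measurable_finite_borel_measure[OF P])
  have M: "finite_borel_measure ?Y (M k)" for k
  proof -
    obtain b c where k: "k = (b, c)" by (cases k)
    interpret P: finite_measure "P b"
      by (rule finite_borel_measureD(1)[OF P])
    have "(\<integral>\<^sup>+\<gamma>. ennreal (sg c * curve_h \<gamma> t) \<partial>P b) \<le> (\<integral>\<^sup>+\<gamma>. 1 \<partial>P b)"
    proof (rule nn_integral_mono)
      fix \<gamma> assume "\<gamma> \<in> space (P b)"
      then have "sg c * curve_h \<gamma> t \<le> 1"
        using h1[of \<gamma>] spP by (auto simp: sg_def abs_le_iff)
      then show "ennreal (sg c * curve_h \<gamma> t) \<le> 1"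
        using ennreal_leI by fastforce
    qed
    also have "\<dots> < top"
      by (simp add: P.emeasure_eq_measure)
    finally have "finite_measure (density (P b) (\<lambda>\<gamma>. ennreal (sg c * curve_h \<gamma> t)))"
      by (intro finite_measureI) (auto simp: emeasure_density cong: nn_integral_cong)
    then have "finite_measure (M k)"
      unfolding M_def k by (auto intro!: finite_measure.finite_measure_distr)
    then show ?thesis
      by (simp add: finite_borel_measure_def M_def k)
  qed
  have intM: "integral\<^sup>L (M (b, c)) \<psi> = integral\<^sup>L (P b) (\<lambda>\<gamma>. max 0 (sg c * curve_h \<gamma> t) * \<psi> (position t \<gamma>))"
    if [measurable]: "\<psi> \<in> borel_measurable (borel_of ?Y)" for \<psi> :: "'a \<Rightarrow> real" and b c
  proof -
    have "integral\<^sup>L (M (b, c)) \<psi> = integral\<^sup>L (density (P b) (\<lambda>\<gamma>. ennreal (sg c * curve_h \<gamma> t))) (\<lambda>\<gamma>. \<psi> (position t \<gamma>))"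
      unfolding M_def by (simp add: integral_distr)
    also have "(\<lambda>\<gamma>. ennreal (sg c * curve_h \<gamma> t)) = (\<lambda>\<gamma>. ennreal (max 0 (sg c * curve_h \<gamma> t)))"
      by (auto simp: max_def ennreal_neg)
    finally show ?thesis
      by (simp add: integral_density)
  qed
  define \<rho> where "\<rho> B = (\<Sum>k\<in>UNIV. s k * measure (M k) B)" for B
  have \<rho>: "\<rho> \<in> signed_measures ?Y"
    unfolding signed_measures_def
  proof (intro CollectI conjI allI impI)
    note m = nonneg_measuresD(1)[OF measure_nonneg_measures[OF M], THEN signed_measuresD(1)]
      nonneg_measuresD(1)[OF measure_nonneg_measures[OF M], THEN signed_measuresD(3)]
    show "\<rho> B = 0" if "B \<notin> borel_sets ?Y" for B
      using m(1)[OF that] by (simp add: \<rho>_def)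
    show "\<rho> {} = 0"
      by (simp add: \<rho>_def)
    show "(\<lambda>i. \<rho> (B i)) sums \<rho> (\<Union>i. B i)" if "range B \<subseteq> borel_sets ?Y" "disjoint_family B" for B :: "nat \<Rightarrow> 'a set"
      unfolding \<rho>_def by (intro sums_sum sums_mult m(2)[OF that])
  qed
  have "signed_integral ?Y \<rho> \<psi> = signed_integral X \<sigma> (\<lambda>\<gamma>. curve_h \<gamma> t * \<psi> (curve_xi \<gamma> t))"
    if \<psi>: "continuous_on (closure \<Omega>) \<psi>" for \<psi>
  proof -
    obtain K where K: "\<And>x. x \<in> closure \<Omega> \<Longrightarrow> \<bar>\<psi> x\<bar> \<le> K"
      using continuous_bound[OF \<psi>] by blast
    have m[measurable]: "\<psi> \<in> borel_measurable (borel_of ?Y)"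
      using \<psi> by (intro borel_measurable_continuous_map) simp
    have int: "integrable (P b) (\<lambda>\<gamma>. max 0 (sg c * curve_h \<gamma> t) * \<psi> (position t \<gamma>))" for b c
    proof (rule integrable_finite_borel_measure[OF P, where K = "1 * K"])
      show "(\<lambda>\<gamma>. max 0 (sg c * curve_h \<gamma> t) * \<psi> (position t \<gamma>)) \<in> borel_measurable (borel_of X)"
        using hX measurable_compose[OF measurable_position[OF t] m] by measurable
      fix \<gamma> assume \<gamma>: "\<gamma> \<in> topspace X"
      have "\<bar>max 0 (sg c * curve_h \<gamma> t)\<bar> \<le> 1"
        using h1[OF \<gamma>] by (auto simp: sg_def abs_le_iff)
      then show "\<bar>max 0 (sg c * curve_h \<gamma> t) * \<psi> (position t \<gamma>)\<bar> \<le> 1 * K"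
        unfolding abs_mult using K[OF position_in_closure[OF _ t]] \<gamma> topspace_X by (intro mult_mono) auto
    qed
    have "signed_integral ?Y \<rho> \<psi> = (\<Sum>k\<in>UNIV. s k * integral\<^sup>L (M k) \<psi>)"
      using K by (intro signed_integral_sum[OF _ M \<rho> _ m]) (auto simp: \<rho>_def)
    also have "\<dots> = (\<Sum>b\<in>UNIV. \<Sum>c\<in>UNIV. sg b * sg c * integral\<^sup>L (M (b, c)) \<psi>)"
      unfolding s_def sum.cartesian_product by (auto intro!: sum.cong)
    also have "\<dots> = (\<Sum>b\<in>UNIV. sg b * (integral\<^sup>L (M (b, True)) \<psi> - integral\<^sup>L (M (b, False)) \<psi>))"
      by (simp add: UNIV_bool sg_def)
    also have "\<dots> = (\<Sum>b\<in>UNIV. sg b * integral\<^sup>L (P b) (\<lambda>\<gamma>. curve_h \<gamma> t * \<psi> (curve_xi \<gamma> t)))"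
    proof (rule sum.cong[OF refl])
      fix b
      have "integral\<^sup>L (M (b, True)) \<psi> - integral\<^sup>L (M (b, False)) \<psi> =
        integral\<^sup>L (P b) (\<lambda>\<gamma>. max 0 (sg True * curve_h \<gamma> t) * \<psi> (position t \<gamma>) -
          max 0 (sg False * curve_h \<gamma> t) * \<psi> (position t \<gamma>))"
        unfolding intM[OF m] by (rule Bochner_Integration.integral_diff[symmetric, OF int int])
      \<comment> \<open>\<open>position\<close> and \<open>curve_xi\<close> differ only where the
        factor h(t) is zero.\<close>
      also have "\<dots> = integral\<^sup>L (P b) (\<lambda>\<gamma>. curve_h \<gamma> t * \<psi> (curve_xi \<gamma> t))"
        by (intro Bochner_Integration.integral_cong) (auto simp: sg_def position_def max_def)
      finally show "sg b * (integral\<^sup>L (M (b, True)) \<psi> - integral\<^sup>L (M (b, False)) \<psi>) =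
          sg b * integral\<^sup>L (P b) (\<lambda>\<gamma>. curve_h \<gamma> t * \<psi> (curve_xi \<gamma> t))"
        by simp
    qed
    also have "\<dots> = signed_integral X \<sigma> (\<lambda>\<gamma>. curve_h \<gamma> t * \<psi> (curve_xi \<gamma> t))"
      by (simp add: UNIV_bool sg_def P_def signed_integral_def)
    finally show ?thesis .
  qed
  with \<rho> show ?thesis
    by blast
qed

text \<open>To use the definite description, uniqueness is required besides existence: continuous
  functions on the closure determine a signed measure there.\<close>

lemma time_slice_integral:
  assumes \<sigma>: "\<sigma> \<in> signed_measures X" and t: "t \<in> {0..1}" and \<psi>: "continuous_on (closure \<Omega>) \<psi>"
  shows "signed_integral (top_of_set (closure \<Omega>)) (time_slice \<Omega> X \<sigma> t) \<psi> =
    signed_integral X \<sigma> (\<lambda>\<gamma>. curve_h \<gamma> t * \<psi> (curve_xi \<gamma> t))"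
proof -
  let ?Y = "top_of_set (closure \<Omega>)"
  let ?Q = "\<lambda>\<rho>. \<rho> \<in> signed_measures ?Y \<and>
     (\<forall>\<psi>. continuous_on (closure \<Omega>) \<psi> \<longrightarrow>
        signed_integral ?Y \<rho> \<psi> = signed_integral X \<sigma> (\<lambda>\<gamma>. curve_h \<gamma> t * \<psi> (curve_xi \<gamma> t)))"
  have "\<rho> = \<rho>'" if "?Q \<rho>" "?Q \<rho>'" for \<rho> \<rho>'
  proof (rule signed_measure_eqI[of ?Y])
    show "metrizable_space ?Y"
      by (intro metrizable_space_subtopology metrizable_space_euclidean)
    show "signed_integral ?Y \<rho> f = signed_integral ?Y \<rho>' f" if "bounded_continuous ?Y f" for f
      using \<open>?Q \<rho>\<close> \<open>?Q \<rho>'\<close> bounded_continuousD(1)[OF that] by simp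
  qed (use that in auto)
  moreover obtain \<rho>0 where "?Q \<rho>0"
    using time_slice_exists[OF \<sigma> t] by (rule exE)
  ultimately have "\<exists>!\<rho>. ?Q \<rho>"
    by (intro ex1I[of ?Q \<rho>0])
  then have "?Q (THE \<rho>. ?Q \<rho>)"
    by (rule theI')
  then show ?thesis
    using \<psi> unfolding time_slice_def by blast
qed

end


section \<open>Discrete measures with prescribed moments\<close>

text \<open>The positive functional \<open>s * c k\<close> on the line spanned by the \<open>k\<close>-th unit vector is extended one
  coordinate at a time, as in the extension theorem of M. Riesz.\<close>

lemma riesz_extension_coordinatewise:
  fixes C :: "('i \<Rightarrow> real) set" and s :: real
  assumes I: "finite I" "k \<notin> I"
    and add: "\<And>x y. x \<in> C \<Longrightarrow> y \<in> C \<Longrightarrow> (\<lambda>i. x i + y i) \<in> C"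
    and scale: "\<And>x a. x \<in> C \<Longrightarrow> 0 \<le> a \<Longrightarrow> (\<lambda>i. a * x i) \<in> C"
    and start: "\<And>x. x \<in> C \<Longrightarrow> (\<And>i. i \<in> I \<Longrightarrow> x i = 0) \<Longrightarrow> 0 \<le> s * x k"
    and full: "\<And>x. \<exists>c\<in>C. \<forall>i\<in>I. c i = x i"
    and J: "J \<subseteq> I"
  shows "\<exists>l. \<forall>x\<in>C. (\<forall>i\<in>I - J. x i = 0) \<longrightarrow> 0 \<le> s * x k + (\<Sum>j\<in>J. l j * x j)"
  using finite_subset[OF J I(1)] J
proof (induction J rule: finite_induct)
  case empty
  then show ?case using start by auto
next
  case (insert j J)
  then obtain l where l: "\<And>x. x \<in> C \<Longrightarrow> (\<And>i. i \<in> I - J \<Longrightarrow> x i = 0) \<Longrightarrow> 0 \<le> s * x k + (\<Sum>j\<in>J. l j * x j)"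
    by blast
  define f where "f x = s * x k + (\<Sum>j\<in>J. l j * x j)" for x
  define D where "D a = {x \<in> C. x j = a \<and> (\<forall>i\<in>I - insert j J. x i = 0)}" for a
  have f_add: "f (\<lambda>i. x i + y i) = f x + f y" for x y
    by (simp add: f_def distrib_left sum.distrib)
  have f_scale: "f (\<lambda>i. a * x i) = a * f x" for a x
    by (simp add: f_def algebra_simps sum_distrib_left)
  have ne: "D a \<noteq> {}" for a
  proof -
    obtain c where "c \<in> C" "\<forall>i\<in>I. c i = (if i = j then a else 0)"
      using full[of "\<lambda>i. if i = j then a else 0"] by auto
    then have "c \<in> D a"
      using insert.prems by (simp add: D_def)
    then show ?thesis
      by blast
  qed
  have le: "- f x \<le> f y" if xy: "x \<in> D 1" "y \<in> D (-1)" for x y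
  proof -
    have "(\<lambda>i. x i + y i) \<in> C"
      using xy by (intro add[of x y]) (simp_all add: D_def)
    moreover have "x i + y i = 0" if "i \<in> I - J" for i
      using that xy by (cases "i = j") (simp_all add: D_def)
    ultimately have "0 \<le> f (\<lambda>i. x i + y i)"
      unfolding f_def by (rule l)
    then show ?thesis
      unfolding f_add by simp
  qed
  \<comment> \<open>The new coefficient must lie between \<open>- f x\<close> for x in
    \<open>D 1\<close> and \<open>f y\<close> for y in \<open>D (-1)\<close>. These bounds are
    compatible because x + y lies in the subspace already treated, and \<open>full\<close> makes
    both sets nonempty, so the supremum is finite.\<close>
  define \<mu> where "\<mu> = (SUP x\<in>D 1. - f x)"
  obtain y0 where "y0 \<in> D (-1)"
    using ne by blast
  then have bdd: "bdd_above ((\<lambda>x. - f x) ` D 1)"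
    using le by (intro bdd_aboveI2) blast
  have \<mu>1: "- f x \<le> \<mu>" if "x \<in> D 1" for x
    unfolding \<mu>_def using that bdd by (rule cSUP_upper)
  have \<mu>2: "\<mu> \<le> f y" if "y \<in> D (-1)" for y
    unfolding \<mu>_def using ne le that by (intro cSUP_least) auto
  have main: "0 \<le> f x + \<mu> * x j" if x: "x \<in> C" "\<And>i. i \<in> I - insert j J \<Longrightarrow> x i = 0" for x
  proof (cases "x j = 0")
    case True
    then have "0 \<le> f x"
      unfolding f_def using x by (intro l) auto
    then show ?thesis
      using True by simp
  next
    case False
    \<comment> \<open>Rescaling brings coordinate j to 1 or -1, where \<mu> was chosen.\<close>
    define a where "a = 1 / \<bar>x j\<bar>"
    have a: "0 < a" "a * x j = sgn (x j)"
      using False by (auto simp: a_def sgn_if)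
    have "(\<lambda>i. a * x i) \<in> D (sgn (x j))"
      using x a scale[OF x(1), of a] by (auto simp: D_def)
    then have "0 \<le> f (\<lambda>i. a * x i) + \<mu> * sgn (x j)"
      using \<mu>1[of "\<lambda>i. a * x i"] \<mu>2[of "\<lambda>i. a * x i"] False by (auto simp: sgn_if split: if_splits)
    then have "0 \<le> a * (f x + \<mu> * x j)"
      using a(2) by (simp add: f_scale distrib_left) (simp add: mult.left_commute)
    then show ?thesis
      using a(1) by (simp add: zero_le_mult_iff)
  qed
  have "(\<Sum>i\<in>insert j J. (l(j := \<mu>)) i * x i) = (\<Sum>i\<in>J. l i * x i) + \<mu> * x j" for x
    using insert.hyps by (simp add: add.commute) (intro sum.cong, auto)
  then show ?case
    using main unfolding f_def by (intro exI[of _ "l(j := \<mu>)"]) (auto simp: add.assoc)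
qed

text \<open>The cone need not be closed; the functional only has to be nonzero on \<open>I\<close>
  and non-negative on \<open>C\<close>. If the projection forgetting coordinate k is proper, the
  induction hypothesis applies to it. If it is everything, \<open>C\<close> misses a vector of the
  k-th axis, and a sign on that axis extends to all coordinates. By \<open>dep\<close>, membership
  depends on the coordinates in \<open>I\<close> alone.\<close>

lemma proper_convex_cone_halfspace:
  fixes C :: "('i \<Rightarrow> real) set"
  assumes I: "finite I" and ne: "(\<lambda>i. 0) \<in> C"
    and add: "\<And>x y. x \<in> C \<Longrightarrow> y \<in> C \<Longrightarrow> (\<lambda>i. x i + y i) \<in> C"
    and scale: "\<And>x a. x \<in> C \<Longrightarrow> 0 \<le> a \<Longrightarrow> (\<lambda>i. a * x i) \<in> C"
    and dep: "\<And>x y. x \<in> C \<Longrightarrow> (\<And>i. i \<in> I \<Longrightarrow> x i = y i) \<Longrightarrow> y \<in> C"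
    and proper: "v \<notin> C"
  shows "\<exists>l. (\<exists>i\<in>I. l i \<noteq> 0) \<and> (\<forall>x\<in>C. 0 \<le> (\<Sum>i\<in>I. l i * x i))"
  using assms
proof (induction I arbitrary: C v rule: finite_induct)
  case empty
  then show ?case by blast
next
  case (insert k I)
  note C = insert.prems
  define C' where "C' = {x. \<exists>r. x(k := r) \<in> C}"
  show ?case
  proof (cases "C' = UNIV")
    case False
    then obtain v' where "v' \<notin> C'"
      by blast
    have "\<exists>l. (\<exists>i\<in>I. l i \<noteq> 0) \<and> (\<forall>x\<in>C'. 0 \<le> (\<Sum>i\<in>I. l i * x i))"
    proof (rule insert.IH[OF _ _ _ _ \<open>v' \<notin> C'\<close>])
      have "(\<lambda>i. 0 :: real)(k := 0) \<in> C"
        using C(1) by (simp add: fun_upd_idem)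
      then show "(\<lambda>i. 0) \<in> C'"
        unfolding C'_def by blast
      show "(\<lambda>i. x i + y i) \<in> C'" if xy: "x \<in> C'" "y \<in> C'" for x y
      proof -
        obtain r s where "x(k := r) \<in> C" "y(k := s) \<in> C"
          using xy unfolding C'_def by blast
        from C(2)[OF this] have "(\<lambda>i. x i + y i)(k := r + s) \<in> C"
          by (rule C(4)) auto
        then show ?thesis
          unfolding C'_def by blast
      qed
      show "(\<lambda>i. a * x i) \<in> C'" if xa: "x \<in> C'" "0 \<le> a" for x a
      proof -
        obtain r where "x(k := r) \<in> C"
          using xa unfolding C'_def by blast
        from C(3)[OF this xa(2)] have "(\<lambda>i. a * x i)(k := a * r) \<in> C"
          by (rule C(4)) auto
        then show ?thesis
          unfolding C'_def by blast
      qed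
      show "y \<in> C'" if xy: "x \<in> C'" "\<And>i. i \<in> I \<Longrightarrow> x i = y i" for x y
      proof -
        obtain r where "x(k := r) \<in> C"
          using xy unfolding C'_def by blast
        then have "y(k := r) \<in> C"
          by (rule C(4)) (use xy in auto)
        then show ?thesis
          unfolding C'_def by blast
      qed
    qed
    then obtain l i where l: "i \<in> I" "l i \<noteq> 0" "\<And>x. x \<in> C' \<Longrightarrow> 0 \<le> (\<Sum>i\<in>I. l i * x i)"
      by blast
    have "C \<subseteq> C'"
      unfolding C'_def using fun_upd_triv by (metis (mono_tags, lifting) mem_Collect_eq subsetI)
    moreover have "(\<Sum>i\<in>insert k I. (l(k := 0)) i * x i) = (\<Sum>i\<in>I. l i * x i)" for x
      using insert.hyps by (simp, intro sum.cong) auto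
    moreover have "\<exists>i\<in>insert k I. (l(k := 0)) i \<noteq> 0"
      using l(1,2) insert.hyps(2) by (intro bexI[of _ i]) auto
    ultimately show ?thesis
      using l(3) by (intro exI[of _ "l(k := 0)"]) auto
  next
    case True
    have full: "\<exists>c\<in>C. \<forall>i\<in>I. c i = x i" for x
    proof -
      have "x \<in> C'"
        using True by simp
      then obtain r where "x(k := r) \<in> C"
        unfolding C'_def by blast
      moreover have "\<forall>i\<in>I. (x(k := r)) i = x i"
        using insert.hyps(2) by auto
      ultimately show ?thesis
        by blast
    qed
    \<comment> \<open>If \<open>C\<close> contained the whole k-th axis, adding an axis vector to an
      element with the other coordinates of \<open>v\<close> would reach \<open>v\<close>. The
      missing vector fixes the sign: an axis element of \<open>C\<close> with
      \<open>s * x k < 0\<close> could be rescaled to it.\<close>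
    have "\<exists>s::real. s \<noteq> 0 \<and> (\<lambda>i. if i = k then - s else 0) \<notin> C"
    proof (rule ccontr)
      assume "\<not> ?thesis"
      then have line: "(\<lambda>i. if i = k then r else 0) \<in> C" for r :: real
        using C(1) by (cases "r = 0") (auto simp: fun_eq_iff dest: spec[of _ "- r"] cong: if_cong)
      obtain c where c: "c \<in> C" "\<forall>i\<in>I. c i = v i"
        using full by blast
      have "v \<in> C"
        by (rule C(4)[OF C(2)[OF c(1) line[of "v k - c k"]]]) (use c(2) insert.hyps(2) in auto)
      then show False
        using C(5) by blast
    qed
    then obtain s :: real where s: "s \<noteq> 0" "(\<lambda>i. if i = k then - s else 0) \<notin> C"
      by blast
    have start: "0 \<le> s * x k" if x: "x \<in> C" "\<And>i. i \<in> I \<Longrightarrow> x i = 0" for x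
    proof (rule ccontr)
      assume "\<not> 0 \<le> s * x k"
      then have neg: "s * x k < 0"
        by simp
      then have "0 \<le> - (s / x k)"
        by (auto simp: mult_less_0_iff divide_le_0_iff)
      from C(3)[OF x(1) this] have "(\<lambda>i. if i = k then - s else 0) \<in> C"
        by (rule C(4)) (use neg x(2) in auto)
      then show False
        using s(2) by blast
    qed
    have "\<exists>l. \<forall>x\<in>C. (\<forall>i\<in>I - I. x i = 0) \<longrightarrow> 0 \<le> s * x k + (\<Sum>j\<in>I. l j * x j)"
      by (rule riesz_extension_coordinatewise[where C = C and I = I and J = I and k = k and s = s])
        (fact insert.hyps C start full order_refl)+
    then obtain l where l: "\<And>x. x \<in> C \<Longrightarrow> 0 \<le> s * x k + (\<Sum>j\<in>I. l j * x j)"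
      by auto
    have "(\<Sum>i\<in>insert k I. (l(k := s)) i * x i) = s * x k + (\<Sum>i\<in>I. l i * x i)" for x
      using insert.hyps by simp (intro sum.cong, auto)
    then show ?thesis
      using l s(1) by (intro exI[of _ "l(k := s)"]) auto
  qed
qed

text \<open>Richter's theorem, by induction on the number of moments. If the moment vector
  \<open>v\<close> is outside the cone spanned by the evaluations at points of \<open>A\<close>,
  some nontrivial combination \<open>L\<close> of the functions is non-negative on \<open>A\<close>
  with integral at most zero, hence zero almost everywhere. On the part of \<open>A\<close> where
  \<open>L\<close> vanishes one function is a combination of the others, so its moment comes for
  free. The set \<open>A\<close> is part of the statement to record this restriction.\<close>

lemma finitely_supported_moments:
  fixes g :: "'i \<Rightarrow> 'a \<Rightarrow> real"
  assumes "finite I" "AE x in M. x \<in> A" "\<And>i. i \<in> I \<Longrightarrow> integrable M (g i)"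
  shows "\<exists>S c. finite S \<and> S \<subseteq> A \<and> (\<forall>x. 0 \<le> c x) \<and> (\<forall>x. x \<notin> S \<longrightarrow> c x = 0) \<and>
    (\<forall>i\<in>I. (\<Sum>x\<in>S. c x * g i x) = integral\<^sup>L M (g i))"
  using assms
proof (induction "card I" arbitrary: I A)
  case 0
  then show ?case
    by (intro exI[of _ "{}"] exI[of _ "\<lambda>_. 0"]) auto
next
  case (Suc n)
  note I = Suc.prems(1) and A = Suc.prems(2) and int = Suc.prems(3)
  define C where "C = {y. \<exists>S c. finite S \<and> S \<subseteq> A \<and> (\<forall>x. 0 \<le> c x) \<and> (\<forall>x. x \<notin> S \<longrightarrow> c x = 0) \<and>
    (\<forall>i\<in>I. y i = (\<Sum>x\<in>S. c x * g i x))}"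
  define v where "v i = integral\<^sup>L M (g i)" for i
  have C_add: "(\<lambda>i. x i + y i) \<in> C" if xy: "x \<in> C" "y \<in> C" for x y
  proof -
    obtain S c S' c' where S: "finite S" "S \<subseteq> A" "\<forall>x. 0 \<le> c x" "\<forall>x. x \<notin> S \<longrightarrow> c x = 0"
        "\<forall>i\<in>I. x i = (\<Sum>x\<in>S. c x * g i x)"
      and S': "finite S'" "S' \<subseteq> A" "\<forall>x. 0 \<le> c' x" "\<forall>x. x \<notin> S' \<longrightarrow> c' x = 0"
        "\<forall>i\<in>I. y i = (\<Sum>x\<in>S'. c' x * g i x)"
      using xy unfolding C_def by blast
    have "x i + y i = (\<Sum>z\<in>S \<union> S'. (c z + c' z) * g i z)" if i: "i \<in> I" for i
    proof -
      have "(\<Sum>z\<in>S. c z * g i z) = (\<Sum>z\<in>S \<union> S'. c z * g i z)"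
        using S S' by (intro sum.mono_neutral_left) auto
      moreover have "(\<Sum>z\<in>S'. c' z * g i z) = (\<Sum>z\<in>S \<union> S'. c' z * g i z)"
        using S S' by (intro sum.mono_neutral_left) auto
      ultimately show ?thesis
        using S(5) S'(5) i by (simp add: distrib_right sum.distrib)
    qed
    then show ?thesis
      unfolding C_def using S S' by (intro CollectI exI[of _ "S \<union> S'"] exI[of _ "\<lambda>z. c z + c' z"]) auto
  qed
  have C_scale: "(\<lambda>i. a * x i) \<in> C" if x: "x \<in> C" "0 \<le> a" for x a
  proof -
    obtain S c where S: "finite S" "S \<subseteq> A" "\<forall>x. 0 \<le> c x" "\<forall>x. x \<notin> S \<longrightarrow> c x = 0"
        "\<forall>i\<in>I. x i = (\<Sum>x\<in>S. c x * g i x)"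
      using x unfolding C_def by blast
    then show ?thesis
      unfolding C_def using x(2)
      by (intro CollectI exI[of _ S] exI[of _ "\<lambda>z. a * c z"]) (auto simp: sum_distrib_left mult.assoc)
  qed
  have C_0: "(\<lambda>i. 0) \<in> C"
    unfolding C_def by (intro CollectI exI[of _ "{}"] exI[of _ "\<lambda>_. 0"]) auto
  have C_dep: "y \<in> C" if "x \<in> C" "\<And>i. i \<in> I \<Longrightarrow> x i = y i" for x y
    using that unfolding C_def by auto
  show ?case
  proof (cases "v \<in> C")
    case True
    then obtain S c where "finite S" "S \<subseteq> A" "\<forall>x. 0 \<le> c x" "\<forall>x. x \<notin> S \<longrightarrow> c x = 0"
        "\<forall>i\<in>I. v i = (\<Sum>x\<in>S. c x * g i x)"
      unfolding C_def by blast
    then show ?thesis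
      by (intro exI[of _ S] exI[of _ c]) (simp add: v_def)
  next
    case False
    \<comment> \<open>Subtracting multiples of \<open>v\<close> makes the functional non-positive at
      \<open>v\<close>; as \<open>C\<close> may fail to be closed, a functional found for
      \<open>C\<close> alone would say nothing about \<open>v\<close>. The larger cone still omits
      \<open>v\<close>, because \<open>v = c - \<tau> v\<close> would put
      \<open>(1 + \<tau>) v\<close> into \<open>C\<close>.\<close>
    define C1 where "C1 = {y. \<exists>c\<in>C. \<exists>\<tau>\<ge>0. \<forall>i\<in>I. y i = c i - \<tau> * v i}"
    have "\<exists>l. (\<exists>i\<in>I. l i \<noteq> 0) \<and> (\<forall>x\<in>C1. 0 \<le> (\<Sum>i\<in>I. l i * x i))"
    proof (rule proper_convex_cone_halfspace[OF I])
      show "(\<lambda>i. 0) \<in> C1"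
        unfolding C1_def using C_0 by (intro CollectI bexI[of _ "\<lambda>i. 0"] exI[of _ 0]) auto
      show "(\<lambda>i. x i + y i) \<in> C1" if xy: "x \<in> C1" "y \<in> C1" for x y
      proof -
        obtain c \<tau> c' \<tau>' where "c \<in> C" "0 \<le> \<tau>" "\<forall>i\<in>I. x i = c i - \<tau> * v i" "c' \<in> C" "0 \<le> \<tau>'" "\<forall>i\<in>I. y i = c' i - \<tau>' * v i"
          using xy unfolding C1_def by blast
        then show ?thesis
          unfolding C1_def using C_add[of c c']
          by (intro CollectI bexI[of _ "\<lambda>i. c i + c' i"] exI[of _ "\<tau> + \<tau>'"]) (auto simp: distrib_right)
      qed
      show "(\<lambda>i. a * x i) \<in> C1" if xa: "x \<in> C1" "0 \<le> a" for x a
      proof -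
        obtain c \<tau> where "c \<in> C" "0 \<le> \<tau>" "\<forall>i\<in>I. x i = c i - \<tau> * v i"
          using xa unfolding C1_def by blast
        then show ?thesis
          unfolding C1_def using xa(2) C_scale[of c a]
          by (intro CollectI bexI[of _ "\<lambda>i. a * c i"] exI[of _ "a * \<tau>"]) (auto simp: right_diff_distrib mult.assoc)
      qed
      show "y \<in> C1" if "x \<in> C1" "\<And>i. i \<in> I \<Longrightarrow> x i = y i" for x y
        using that unfolding C1_def by auto
      show "v \<notin> C1"
      proof
        assume "v \<in> C1"
        then obtain c \<tau> where c: "c \<in> C" "0 \<le> \<tau>" "\<forall>i\<in>I. v i = c i - \<tau> * v i"
          unfolding C1_def by blast
        have "(\<lambda>i. 1 / (1 + \<tau>) * c i) \<in> C"
          using c by (intro C_scale[OF c(1)]) auto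
        then have "v \<in> C"
          by (rule C_dep) (use c in \<open>auto simp: field_simps\<close>)
        then show False
          using False by blast
      qed
    qed
    then obtain l k where l: "k \<in> I" "l k \<noteq> 0" "\<And>x. x \<in> C1 \<Longrightarrow> 0 \<le> (\<Sum>i\<in>I. l i * x i)"
      by blast
    define L where "L x = (\<Sum>i\<in>I. l i * g i x)" for x
    have L_nonneg: "0 \<le> L x" if x: "x \<in> A" for x
    proof -
      have "(\<lambda>i. g i x) \<in> C"
        unfolding C_def using x by (intro CollectI exI[of _ "{x}"] exI[of _ "\<lambda>z. if z = x then 1 else 0"]) auto
      then have "(\<lambda>i. g i x) \<in> C1"
        unfolding C1_def by (intro CollectI bexI[of _ "\<lambda>i. g i x"] exI[of _ 0]) auto
      from l(3)[OF this] show ?thesis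
        unfolding L_def .
    qed
    have "(\<lambda>i. - v i) \<in> C1"
      unfolding C1_def using C_0 by (intro CollectI bexI[of _ "\<lambda>i. 0"] exI[of _ 1]) auto
    from l(3)[OF this] have lv: "(\<Sum>i\<in>I. l i * v i) \<le> 0"
      by (simp add: sum_negf)
    have L_int: "integrable M L"
      unfolding L_def using int by (intro Bochner_Integration.integrable_sum integrable_mult_right) auto
    have L_eq: "integral\<^sup>L M L = (\<Sum>i\<in>I. l i * v i)"
      unfolding L_def v_def using int by (subst Bochner_Integration.integral_sum) auto
    have AE_nonneg: "AE x in M. 0 \<le> L x"
      using A L_nonneg by auto
    then have "0 \<le> integral\<^sup>L M L"
      by (rule integral_nonneg_AE)
    then have L0: "integral\<^sup>L M L = 0"
      using lv L_eq by simp
    then have "AE x in M. L x = 0"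
      using integral_nonneg_eq_0_iff_AE[OF L_int AE_nonneg] by simp
    then have A': "AE x in M. x \<in> {x \<in> A. L x = 0}"
      using A by auto
    have card: "n = card (I - {k})"
      using Suc.hyps(2) l(1) I by simp
    have fin: "finite (I - {k})" and int': "\<And>i. i \<in> I - {k} \<Longrightarrow> integrable M (g i)"
      using I int by auto
    obtain S c where S: "finite S" "S \<subseteq> {x \<in> A. L x = 0}" "\<forall>x. 0 \<le> c x" "\<forall>x. x \<notin> S \<longrightarrow> c x = 0"
      "\<forall>i\<in>I - {k}. (\<Sum>x\<in>S. c x * g i x) = integral\<^sup>L M (g i)"
      using Suc.hyps(1)[OF card fin A' int'] by blast
    have Lk: "L x = l k * g k x + (\<Sum>i\<in>I - {k}. l i * g i x)" for x
      unfolding L_def by (rule sum.remove[OF I l(1)])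
    have "l k * (\<Sum>x\<in>S. c x * g k x) = (\<Sum>x\<in>S. c x * (l k * g k x))"
      by (simp add: sum_distrib_left algebra_simps)
    also have "\<dots> = (\<Sum>x\<in>S. c x * (- (\<Sum>i\<in>I - {k}. l i * g i x)))"
      using S(2) Lk by (intro sum.cong refl arg_cong2[where f = "(*)"]) (force simp: eq_neg_iff_add_eq_0)
    also have "\<dots> = - (\<Sum>x\<in>S. \<Sum>i\<in>I - {k}. l i * (c x * g i x))"
      by (simp add: sum_negf sum_distrib_left algebra_simps)
    also have "\<dots> = - (\<Sum>i\<in>I - {k}. l i * (\<Sum>x\<in>S. c x * g i x))"
      by (subst sum.swap) (simp add: sum_distrib_left)
    also have "\<dots> = - (\<Sum>i\<in>I - {k}. l i * v i)"
      using S(5) by (simp add: v_def)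
    also have "\<dots> = l k * v k"
      using L0 L_eq sum.remove[OF I l(1), of "\<lambda>i. l i * v i"] by simp
    finally have "(\<Sum>x\<in>S. c x * g k x) = v k"
      using l(2) by simp
    then have "\<forall>i\<in>I. (\<Sum>x\<in>S. c x * g i x) = integral\<^sup>L M (g i)"
      using S(5) by (auto simp: v_def)
    then show ?thesis
      using S by blast
  qed
qed

text \<open>Gaussian elimination: an unknown with a nonzero coefficient in equation k is eliminated
  from the others, leaving one equation and one unknown fewer.\<close>

lemma homogeneous_system_nontrivial_solution:
  fixes g :: "'i \<Rightarrow> 'a \<Rightarrow> real"
  assumes "finite I" "finite S" "card I < card S"
  shows "\<exists>d. (\<exists>x\<in>S. d x \<noteq> 0) \<and> (\<forall>i\<in>I. (\<Sum>x\<in>S. d x * g i x) = 0)"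
  using assms
proof (induction I arbitrary: S g rule: finite_induct)
  case empty
  then have "S \<noteq> {}" by auto
  then show ?case
    by (intro exI[of _ "\<lambda>_. 1"]) auto
next
  case (insert k I)
  show ?case
  proof (cases "\<forall>x\<in>S. g k x = 0")
    case True
    have "card I < card S"
      using insert by simp
    from insert.IH[OF insert.prems(1) this, of g] show ?thesis
      using True by auto
  next
    case False
    then obtain x0 where x0: "x0 \<in> S" "g k x0 \<noteq> 0" by blast
    define g' where "g' i x = g i x - g k x / g k x0 * g i x0" for i x
    have "card I < card (S - {x0})"
      using insert x0 by simp
    from insert.IH[OF _ this, of g'] insert.prems(1) obtain d' where
      d': "\<exists>x\<in>S - {x0}. d' x \<noteq> 0" "\<And>i. i \<in> I \<Longrightarrow> (\<Sum>x\<in>S - {x0}. d' x * g' i x) = 0"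
      by auto
    \<comment> \<open>The value of the pivot unknown that solves equation k.\<close>
    define e where "e = - (\<Sum>x\<in>S - {x0}. d' x * g k x) / g k x0"
    have sum: "(\<Sum>x\<in>S. (d'(x0 := e)) x * g i x) = e * g i x0 + (\<Sum>x\<in>S - {x0}. d' x * g i x)" for i
      using sum.remove[OF insert.prems(1) x0(1), of "\<lambda>x. (d'(x0 := e)) x * g i x"] by simp
    have "(\<Sum>x\<in>S. (d'(x0 := e)) x * g i x) = 0" if "i \<in> insert k I" for i
    proof (cases "i = k")
      case True
      then show ?thesis
        unfolding sum using x0(2) by (simp add: e_def)
    next
      case False
      then have "(\<Sum>x\<in>S - {x0}. d' x * g' i x) = 0"
        using that d'(2) by blast
      moreover have "(\<Sum>x\<in>S - {x0}. d' x * g' i x) = (\<Sum>x\<in>S - {x0}. d' x * g i x) + e * g i x0"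
        by (simp add: g'_def e_def right_diff_distrib sum_subtractf sum_distrib_right sum_divide_distrib
            minus_divide_left mult.assoc)
      ultimately show ?thesis
        unfolding sum by simp
    qed
    moreover have "\<exists>x\<in>S. (d'(x0 := e)) x \<noteq> 0"
      using d'(1) by auto
    ultimately show ?thesis
      by blast
  qed
qed


section \<open>The direct method\<close>

lemma lower_semicontinuous_closedin:
  fixes f :: "'a \<Rightarrow> 'b::linorder"
  assumes "lower_semicontinuous_map X f"
  shows "closedin X {x \<in> topspace X. f x \<le> c}"
proof -
  have "topspace X - {x \<in> topspace X. f x \<le> c} = {x \<in> topspace X. c < f x}"
    by auto
  then show ?thesis
    using assms unfolding closedin_def lower_semicontinuous_map_def by auto
qed

text \<open>The values lie in an arbitrary linear order, so no infimum is formed. Without a minimum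
  the open sets above the single values cover \<open>S\<close>, and the smallest value of a finite
  subcover is not covered.\<close>

lemma lower_semicontinuous_attains_min:
  fixes f :: "'a \<Rightarrow> 'b::linorder"
  assumes f: "lower_semicontinuous_map X f" and S: "compactin X S" "S \<noteq> {}"
  shows "\<exists>x\<in>S. \<forall>y\<in>S. f x \<le> f y"
proof (rule ccontr)
  assume contra: "\<not> ?thesis"
  define U where "U y = {x \<in> topspace X. f y < f x}" for y
  have op: "openin X V" if "V \<in> U ` S" for V
    using that f by (auto simp: U_def lower_semicontinuous_map_def)
  have cov: "S \<subseteq> \<Union>(U ` S)"
  proof
    fix x assume x: "x \<in> S"
    then obtain y where "y \<in> S" "f y < f x"
      using contra by (meson not_le)
    then show "x \<in> \<Union>(U ` S)"
      using x compactin_subset_topspace[OF S(1)] by (auto simp: U_def)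
  qed
  have "\<exists>\<F>. finite \<F> \<and> \<F> \<subseteq> U ` S \<and> S \<subseteq> \<Union>\<F>"
    by (rule compactinD[OF S(1) op cov])
  then obtain \<F> where F: "finite \<F>" "\<F> \<subseteq> U ` S" "S \<subseteq> \<Union>\<F>"
    by (elim exE conjE)
  obtain R where R: "R \<subseteq> S" "finite R" "\<F> = U ` R"
    using finite_subset_image[OF F(1,2)] by (elim exE conjE)
  have "R \<noteq> {}"
    using F(3) R(3) S(2) by auto
  then have "Min (f ` R) \<in> f ` R"
    using R(2) by (intro Min_in) auto
  then obtain x where x: "x \<in> R" "f x = Min (f ` R)"
    by auto
  then obtain y where y: "y \<in> R" "x \<in> U y"
    using F(3) R by blast
  then have "f y < Min (f ` R)"
    using x by (simp add: U_def)
  moreover have "Min (f ` R) \<le> f y"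
    using y R(2) by (intro Min_le) auto
  ultimately show False
    by simp
qed

text \<open>As f is real-valued, the sum exceeds c exactly when some real r below \<open>f x\<close>
  leaves \<open>c - r\<close> below \<open>g x\<close>; this is a union of intersections of open
  conditions.\<close>

lemma lower_semicontinuous_add:
  fixes f :: "'a \<Rightarrow> real" and g :: "'a \<Rightarrow> ennreal"
  assumes f: "continuous_map X euclideanreal f" and g: "lower_semicontinuous_map X g"
  shows "lower_semicontinuous_map X (\<lambda>x. ereal (f x) + enn2ereal (g x))"
  unfolding lower_semicontinuous_map_def
proof
  fix c :: ereal
  have split: "c < ereal (f x) + enn2ereal (g x) \<longleftrightarrow> (\<exists>r. r < f x \<and> c - ereal r < enn2ereal (g x))" for x
  proof
    assume c: "c < ereal (f x) + enn2ereal (g x)"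
    show "\<exists>r. r < f x \<and> c - ereal r < enn2ereal (g x)"
    proof (cases c)
      case (real c')
      then have "ereal (c' - f x) < enn2ereal (g x)"
        using c by (cases "enn2ereal (g x)") auto
      then obtain z where z: "c' - f x < z" "ereal z < enn2ereal (g x)"
        using ereal_dense2 by force
      then show ?thesis
        using real by (intro exI[of _ "c' - z"]) auto
    next
      case MInf
      then show ?thesis
        using enn2ereal_nonneg[of "g x"] by (intro exI[of _ "f x - 1"]) auto
    qed (use c in simp)
  next
    assume "\<exists>r. r < f x \<and> c - ereal r < enn2ereal (g x)"
    then obtain r where "r < f x" "c - ereal r < enn2ereal (g x)" by blast
    then show "c < ereal (f x) + enn2ereal (g x)"
      by (cases c; cases "enn2ereal (g x)") auto
  qed
  have g': "openin X {x \<in> topspace X. d < enn2ereal (g x)}" for d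
  proof (cases "d < 0")
    case True
    then have "{x \<in> topspace X. d < enn2ereal (g x)} = topspace X"
      using enn2ereal_nonneg by (auto intro: less_le_trans)
    then show ?thesis
      by simp
  next
    case False
    then have "d < enn2ereal (g x) \<longleftrightarrow> e2ennreal d < g x" for x
      by (metis enn2ereal_e2ennreal less_ennreal.rep_eq not_less)
    then show ?thesis
      using g unfolding lower_semicontinuous_map_def by simp
  qed
  have f': "openin X {x \<in> topspace X. r < f x}" for r
    using openin_continuous_map_preimage[OF f, of "{r<..}"] by simp
  have "{x \<in> topspace X. c < ereal (f x) + enn2ereal (g x)} =
      (\<Union>r. {x \<in> topspace X. r < f x} \<inter> {x \<in> topspace X. c - ereal r < enn2ereal (g x)})"
    unfolding split by auto
  then show "openin X {x \<in> topspace X. c < ereal (f x) + enn2ereal (g x)}"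
    using openin_Int[OF f' g'] by (auto intro!: openin_Union)
qed

locale energy_minimisation = curve_space \<Omega> \<Gamma> X
  for \<Omega> :: "'a::euclidean_space set" and \<Gamma> X +
  fixes w \<phi> :: "'a curve \<Rightarrow> ennreal" and T :: nat and t :: "nat \<Rightarrow> real"
    and a :: "nat \<Rightarrow> 'm::finite \<Rightarrow> 'a \<Rightarrow> real" and F :: "nat \<Rightarrow> real ^ 'm \<Rightarrow> real"
  assumes t: "\<And>j. j \<le> T \<Longrightarrow> t j \<in> {0..1}"
    and a: "\<And>i j. j \<le> T \<Longrightarrow> continuous_on (closure \<Omega>) (a j i)"
    and F_convex: "\<And>j. j \<le> T \<Longrightarrow> convex_on UNIV (F j)"
    and F_nonneg: "\<And>j y. j \<le> T \<Longrightarrow> 0 \<le> F j y"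
    and w: "lower_semicontinuous_map X w" and \<phi>: "lower_semicontinuous_map X \<phi>"
begin

abbreviation "E \<equiv> energy \<Omega> X T t a F w"
abbreviation "D \<equiv> admissible X \<phi>"

definition observable :: "nat \<times> 'm \<Rightarrow> 'a curve \<Rightarrow> real" where
  "observable = (\<lambda>(j, i) \<gamma>. curve_h \<gamma> (t j) * a j i (curve_xi \<gamma> (t j)))"

lemma observable:
  assumes "j \<le> T"
  shows "bounded_continuous X (observable (j, i))"
  using observable_bounded_continuous[OF t[OF assms] a[OF assms]] by (simp add: observable_def)

lemma fidelity_eq:
  assumes "\<sigma> \<in> signed_measures X"
  shows "fidelity \<Omega> X T t a F \<sigma> = (\<Sum>j=0..T. F j (\<chi> i. signed_integral X \<sigma> (observable (j, i))))"
  unfolding fidelity_def forward_op_def observable_def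
  using time_slice_integral[OF assms t a] by (intro sum.cong arg_cong2[where f = F]) auto

lemma fidelity_nonneg: "0 \<le> fidelity \<Omega> X T t a F \<sigma>"
  unfolding fidelity_def by (intro sum_nonneg F_nonneg) auto

text \<open>A real convex function on a finite-dimensional space is continuous, so the fidelity
  depends continuously on finitely many narrowly continuous integrals.\<close>

lemma continuous_map_fidelity: "continuous_map (narrow_topology X) euclideanreal (fidelity \<Omega> X T t a F)"
proof -
  have "continuous_map (narrow_topology X) euclideanreal
      (\<lambda>\<sigma>. \<Sum>j=0..T. F j (\<chi> i. signed_integral X \<sigma> (observable (j, i))))"
    unfolding continuous_map_atin
  proof
    fix \<sigma> assume \<sigma>: "\<sigma> \<in> topspace (narrow_topology X)"
    have lim: "((\<lambda>\<tau>. signed_integral X \<tau> (observable (j, i))) \<longlongrightarrow> signed_integral X \<sigma> (observable (j, i)))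
        (atin (narrow_topology X) \<sigma>)" if "j \<le> T" for i j
      using continuous_map_signed_integral[OF observable[OF that]] \<sigma> unfolding continuous_map_atin by simp
    have "isCont (F j) y" if "j \<le> T" for j y
      using convex_on_continuous[OF open_UNIV F_convex[OF that]]
      by (simp add: continuous_on_eq_continuous_at)
    then show "limitin euclideanreal (\<lambda>\<sigma>. \<Sum>j=0..T. F j (\<chi> i. signed_integral X \<sigma> (observable (j, i))))
        (\<Sum>j=0..T. F j (\<chi> i. signed_integral X \<sigma> (observable (j, i)))) (atin (narrow_topology X) \<sigma>)"
      using lim unfolding limitin_canonical_iff
      by (intro tendsto_sum isCont_tendsto_compose[of _ "F _"] tendsto_vec_lambda) auto
  qed
  then show ?thesis
    by (rule continuous_map_eq) (simp add: fidelity_eq)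
qed

lemma lower_semicontinuous_fidelity: "lower_semicontinuous_map (narrow_topology X) (fidelity \<Omega> X T t a F)"
  unfolding lower_semicontinuous_map_def
proof
  fix c
  show "openin (narrow_topology X) {x \<in> topspace (narrow_topology X). c < fidelity \<Omega> X T t a F x}"
    using openin_continuous_map_preimage[OF continuous_map_fidelity, of "{c<..}"] by simp
qed

lemma lower_semicontinuous_energy:
  assumes "S \<subseteq> nonneg_measures X"
  shows "lower_semicontinuous_map (subtopology (narrow_topology X) S) E"
  unfolding energy_def
  by (intro lower_semicontinuous_add continuous_map_from_subtopology continuous_map_fidelity
      lower_semicontinuous_regulariser[OF metrizable_X w assms])

section \<open>The admissible set and existence of minimisers\<close>

lemma admissible_nonneg: "D \<subseteq> nonneg_measures X"
  by (auto simp: admissible_def)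

lemma topspace_admissible: "topspace (subtopology (narrow_topology X) D) = D"
  using admissible_nonneg nonneg_measuresD(1) by auto

lemma emeasure_to_measure:
  assumes "\<sigma> \<in> nonneg_measures X"
  shows "emeasure (to_measure X \<sigma>) B = ennreal (\<sigma> B)"
  using finite_measure.emeasure_eq_measure[OF finite_borel_measureD(1)[OF finite_borel_measure_to_measure(1)[OF assms]]]
    finite_borel_measure_to_measure(2)[OF assms] by simp

lemma measurable_to_measure:
  assumes "\<sigma> \<in> nonneg_measures X"
  shows "w \<in> borel_measurable (to_measure X \<sigma>)" "\<phi> \<in> borel_measurable (to_measure X \<sigma>)"
  using borel_measurable_lower_semicontinuous[OF w] borel_measurable_lower_semicontinuous[OF \<phi>]
    measurable_finite_borel_measure[OF finite_borel_measure_to_measure(1)[OF assms]] by auto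

text \<open>The source of the mass bound: the constraint controls the integral of
  \<open>\<phi>\<close>, hence the mass once \<open>\<phi>\<close> is bounded away from
  zero.\<close>

lemma admissible_mass_le:
  assumes \<sigma>: "\<sigma> \<in> D" and r: "0 < r" "\<And>\<gamma>. \<gamma> \<in> \<Gamma> \<Longrightarrow> ennreal r \<le> \<phi> \<gamma>"
  shows "\<sigma> (topspace X) \<le> 1 / r"
proof -
  have \<sigma>': "\<sigma> \<in> nonneg_measures X"
    using \<sigma> admissible_nonneg by blast
  have sp: "space (to_measure X \<sigma>) = topspace X"
    by (rule finite_borel_measureD(3)[OF finite_borel_measure_to_measure(1)[OF \<sigma>']])
  have "ennreal (r * \<sigma> (topspace X)) = (\<integral>\<^sup>+\<gamma>. ennreal r \<partial>to_measure X \<sigma>)"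
    using r(1) nonneg_measuresD(2)[OF \<sigma>'] by (simp add: sp emeasure_to_measure[OF \<sigma>'] ennreal_mult)
  also have "\<dots> \<le> (\<integral>\<^sup>+\<gamma>. \<phi> \<gamma> \<partial>to_measure X \<sigma>)"
    using r(2) topspace_X sp by (intro nn_integral_mono) auto
  also have "\<dots> \<le> ennreal 1"
    using \<sigma> by (simp add: admissible_def)
  finally have "r * \<sigma> (topspace X) \<le> 1"
    by (subst (asm) ennreal_le_iff) auto
  then show ?thesis
    using r(1) by (simp add: field_simps)
qed

text \<open>Either alternative yields a function \<psi> with compact sub-level sets and bounded
  integral: \<open>w\<close> through the energy, since the fidelity is non-negative, or
  \<open>\<phi>\<close> through the constraint. The sub-level set of the energy is then closed
  inside a compact set of measures.\<close>

lemma compact_sublevel_sets_energy: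
  assumes sub: "compact_sublevel_sets X w \<or> compact_sublevel_sets X \<phi>"
    and r: "0 < r" "\<And>\<gamma>. \<gamma> \<in> \<Gamma> \<Longrightarrow> ennreal r \<le> \<phi> \<gamma>"
  shows "compact_sublevel_sets (subtopology (narrow_topology X) D) E"
  unfolding compact_sublevel_sets_def topspace_admissible
proof (intro allI impI)
  fix c :: ereal
  assume c: "c < top"
  \<comment> \<open>One constant for both alternatives: 1 bounds the integral of
    \<open>\<phi>\<close>, the other term that of \<open>w\<close>.\<close>
  define C where "C = max 1 (real_of_ereal c)"
  have cC: "c \<le> ereal C"
    using c by (cases c) (auto simp: C_def top_ereal_def)
  \<comment> \<open>Lower semicontinuity is available relative to non-negative measures, so the
    closed conditions are imposed in this subspace.\<close>
  let ?Y = "subtopology (narrow_topology X) (nonneg_measures X)"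
  have topY: "topspace ?Y = nonneg_measures X"
    using nonneg_measuresD(1) by auto
  have "\<exists>\<psi>. lower_semicontinuous_map X \<psi> \<and> compact_sublevel_sets X \<psi> \<and>
      (\<forall>\<sigma>\<in>D. E \<sigma> \<le> c \<longrightarrow> regulariser X \<psi> \<sigma> \<le> ennreal C)"
    using sub
  proof
    assume "compact_sublevel_sets X w"
    moreover have "regulariser X w \<sigma> \<le> ennreal C" if "E \<sigma> \<le> c" for \<sigma>
    proof -
      have "enn2ereal (regulariser X w \<sigma>) \<le> E \<sigma>"
        using fidelity_nonneg[of \<sigma>] by (simp add: energy_def add_increasing)
      then have "enn2ereal (regulariser X w \<sigma>) \<le> enn2ereal (ennreal C)"
        using that cC by (auto simp: C_def intro: order_trans)
      then show ?thesis
        by (simp add: less_eq_ennreal.rep_eq)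
    qed
    ultimately show ?thesis
      using w by blast
  next
    assume "compact_sublevel_sets X \<phi>"
    moreover have "regulariser X \<phi> \<sigma> \<le> ennreal C" if "\<sigma> \<in> D" for \<sigma>
    proof -
      have "regulariser X \<phi> \<sigma> \<le> ennreal 1"
        using that by (simp add: admissible_def regulariser_def)
      also have "\<dots> \<le> ennreal C"
        by (intro ennreal_leI) (simp add: C_def)
      finally show ?thesis .
    qed
    ultimately show ?thesis
      using \<phi> by blast
  qed
  then obtain \<psi> where \<psi>: "lower_semicontinuous_map X \<psi>" "compact_sublevel_sets X \<psi>"
    "\<And>\<sigma>. \<sigma> \<in> D \<Longrightarrow> E \<sigma> \<le> c \<Longrightarrow> regulariser X \<psi> \<sigma> \<le> ennreal C"
    by blast
  define K where "K = {\<sigma> \<in> nonneg_measures X. \<sigma> (topspace X) \<le> 1 / r \<and> regulariser X \<psi> \<sigma> \<le> ennreal C}"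
  have "compactin (narrow_topology X) K"
    unfolding K_def by (rule compactin_tight_measures[OF metrizable_X \<psi>(1,2)])
  then have "compactin ?Y K"
    by (auto simp: compactin_subtopology K_def)
  then have "compactin ?Y (K \<inter> ({\<sigma> \<in> topspace ?Y. regulariser X \<phi> \<sigma> \<le> 1} \<inter> {\<sigma> \<in> topspace ?Y. E \<sigma> \<le> c}))"
    by (intro compact_Int_closedin closedin_Int lower_semicontinuous_closedin
        lower_semicontinuous_regulariser[OF metrizable_X \<phi>] lower_semicontinuous_energy) auto
  also have "K \<inter> ({\<sigma> \<in> topspace ?Y. regulariser X \<phi> \<sigma> \<le> 1} \<inter> {\<sigma> \<in> topspace ?Y. E \<sigma> \<le> c}) = {\<sigma> \<in> D. E \<sigma> \<le> c}"
    unfolding topY using admissible_mass_le[OF _ r] \<psi>(3)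
    by (auto simp: K_def admissible_def regulariser_def)
  finally show "compactin (subtopology (narrow_topology X) D) {\<sigma> \<in> D. E \<sigma> \<le> c}"
    by (auto simp: compactin_subtopology)
qed

section \<open>Finitely supported measures\<close>

definition atomic_measure :: "'a curve set \<Rightarrow> ('a curve \<Rightarrow> real) \<Rightarrow> 'a curve set \<Rightarrow> real" where
  "atomic_measure S c = (\<lambda>B. \<Sum>\<gamma>\<in>S. c \<gamma> * dirac X \<gamma> B)"

context
  fixes S :: "'a curve set" and c :: "'a curve \<Rightarrow> real"
  assumes S: "finite S" "S \<subseteq> \<Gamma>" and c: "\<forall>\<gamma>\<in>S. 0 \<le> c \<gamma>"
begin

text \<open>A combination of Dirac measures is realised as the image under the identity of a point
  measure on \<open>S\<close>, for which integrals are finite sums.\<close>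

lemma measurable_point: "(\<lambda>\<gamma>. \<gamma>) \<in> measurable (point_measure S (\<lambda>\<gamma>. ennreal (c \<gamma>))) (borel_of X)"
  using S topspace_X by (auto simp: measurable_def space_point_measure sets_point_measure)

lemma finite_borel_measure_distr_point:
  "finite_borel_measure X (distr (point_measure S (\<lambda>\<gamma>. ennreal (c \<gamma>))) (borel_of X) (\<lambda>\<gamma>. \<gamma>))"
proof -
  have "finite_measure (point_measure S (\<lambda>\<gamma>. ennreal (c \<gamma>)))"
    using S(1) by (intro finite_measureI) (simp add: space_point_measure emeasure_point_measure_finite)
  then show ?thesis
    by (auto simp: finite_borel_measure_def intro: finite_measure.finite_measure_distr measurable_point)
qed

lemma measure_distr_point:
  "measure (distr (point_measure S (\<lambda>\<gamma>. ennreal (c \<gamma>))) (borel_of X) (\<lambda>\<gamma>. \<gamma>)) = atomic_measure S c"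
proof
  fix B
  let ?N = "distr (point_measure S (\<lambda>\<gamma>. ennreal (c \<gamma>))) (borel_of X) (\<lambda>\<gamma>. \<gamma>)"
  show "measure ?N B = atomic_measure S c B"
  proof (cases "B \<in> borel_sets X")
    case False
    then show ?thesis
      by (simp add: atomic_measure_def dirac_def measure_notin_sets)
  next
    case True
    have "measure ?N B = measure (point_measure S (\<lambda>\<gamma>. ennreal (c \<gamma>))) (B \<inter> S)"
      using True by (subst measure_distr[OF measurable_point]) (simp_all add: space_point_measure)
    also have "\<dots> = (\<Sum>\<gamma>\<in>B \<inter> S. c \<gamma>)"
    proof -
      have "(\<Sum>\<gamma>\<in>B \<inter> S. ennreal (c \<gamma>)) = ennreal (\<Sum>\<gamma>\<in>B \<inter> S. c \<gamma>)" "0 \<le> (\<Sum>\<gamma>\<in>B \<inter> S. c \<gamma>)"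
        using c by (auto intro!: sum_ennreal sum_nonneg)
      then show ?thesis
        using S(1) by (simp add: measure_def emeasure_point_measure_finite)
    qed
    also have "\<dots> = atomic_measure S c B"
      using S(1) True by (auto simp: atomic_measure_def dirac_def indicator_def Int_commute sum.inter_restrict intro!: sum.cong)
    finally show ?thesis .
  qed
qed

lemma to_measure_discrete:
  "to_measure X (atomic_measure S c) = distr (point_measure S (\<lambda>\<gamma>. ennreal (c \<gamma>))) (borel_of X) (\<lambda>\<gamma>. \<gamma>)"
  using to_measure_measure[OF finite_borel_measure_distr_point] unfolding measure_distr_point .

lemma discrete_nonneg: "atomic_measure S c \<in> nonneg_measures X"
  using measure_nonneg_measures[OF finite_borel_measure_distr_point] unfolding measure_distr_point .

lemma nn_integral_discrete:
  assumes "f \<in> borel_measurable (borel_of X)"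
  shows "(\<integral>\<^sup>+\<gamma>. f \<gamma> \<partial>to_measure X (atomic_measure S c)) = (\<Sum>\<gamma>\<in>S. ennreal (c \<gamma>) * f \<gamma>)"
  unfolding to_measure_discrete
  using S(1) assms by (subst nn_integral_distr[OF measurable_point]) (simp_all add: nn_integral_point_measure_finite)

lemma signed_integral_discrete:
  assumes "bounded_continuous X f"
  shows "signed_integral X (atomic_measure S c) f = (\<Sum>\<gamma>\<in>S. c \<gamma> * f \<gamma>)"
  unfolding signed_integral_nonneg_measure[OF discrete_nonneg] to_measure_discrete
  using S(1) c
  by (subst integral_distr[OF measurable_point borel_measurable_continuous_map[OF bounded_continuousD(1)[OF assms]]])
    (simp add: lebesgue_integral_point_measure_finite)

lemma nn_integral_discrete_finite:
  assumes "f \<in> borel_measurable (borel_of X)" "\<And>\<gamma>. \<gamma> \<in> S \<Longrightarrow> f \<gamma> < top"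
  shows "(\<integral>\<^sup>+\<gamma>. f \<gamma> \<partial>to_measure X (atomic_measure S c)) = ennreal (\<Sum>\<gamma>\<in>S. c \<gamma> * enn2real (f \<gamma>))"
proof -
  have "(\<Sum>\<gamma>\<in>S. ennreal (c \<gamma>) * f \<gamma>) = (\<Sum>\<gamma>\<in>S. ennreal (c \<gamma> * enn2real (f \<gamma>)))"
    using assms(2) c by (intro sum.cong) (simp_all add: ennreal_mult)
  also have "\<dots> = ennreal (\<Sum>\<gamma>\<in>S. c \<gamma> * enn2real (f \<gamma>))"
    using c by (intro sum_ennreal) simp
  finally show ?thesis
    unfolding nn_integral_discrete[OF assms(1)] .
qed

end

text \<open>The zero measure is admissible with finite energy, so its level gives a nonempty
  sub-level set to which compactness applies.\<close>

lemma energy_minimiser_exists: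
  assumes "compact_sublevel_sets X w \<or> compact_sublevel_sets X \<phi>"
    and r: "0 < r" "\<And>\<gamma>. \<gamma> \<in> \<Gamma> \<Longrightarrow> ennreal r \<le> \<phi> \<gamma>"
  shows "\<exists>\<sigma>\<in>D. E \<sigma> < top \<and> (\<forall>\<tau>\<in>D. E \<sigma> \<le> E \<tau>)"
proof -
  define \<sigma>0 where "\<sigma>0 = atomic_measure {} (\<lambda>_. 0)"
  have \<sigma>0: "\<sigma>0 \<in> D"
    using discrete_nonneg[of "{}" "\<lambda>_. 0"]
      nn_integral_discrete[of "{}" "\<lambda>_. 0" \<phi>] borel_measurable_lower_semicontinuous[OF \<phi>]
    by (simp add: admissible_def \<sigma>0_def)
  have "regulariser X w \<sigma>0 = 0"
    using nn_integral_discrete[of "{}" "\<lambda>_. 0" w] borel_measurable_lower_semicontinuous[OF w]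
    by (simp add: regulariser_def \<sigma>0_def)
  then have fin: "E \<sigma>0 < top"
    by (simp add: energy_def top_ereal_def)
  let ?S = "{\<sigma> \<in> D. E \<sigma> \<le> E \<sigma>0}"
  have "compactin (subtopology (narrow_topology X) D) ?S"
    using compact_sublevel_sets_energy[OF assms] fin
    unfolding compact_sublevel_sets_def topspace_admissible by blast
  moreover have "?S \<noteq> {}"
    using \<sigma>0 by blast
  ultimately have "\<exists>\<sigma>\<in>?S. \<forall>\<tau>\<in>?S. E \<sigma> \<le> E \<tau>"
    by (rule lower_semicontinuous_attains_min[OF lower_semicontinuous_energy[OF admissible_nonneg]])
  then obtain \<sigma> where \<sigma>: "\<sigma> \<in> ?S" "\<forall>\<tau>\<in>?S. E \<sigma> \<le> E \<tau>"
    by blast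
  have "E \<sigma> \<le> E \<tau>" if "\<tau> \<in> D" for \<tau>
    using \<sigma> that by (cases "E \<tau> \<le> E \<sigma>0") (auto intro: order_trans)
  moreover have "E \<sigma> < top"
    using \<sigma> fin by (auto intro: order_le_less_trans)
  ultimately show ?thesis
    using \<sigma> by blast
qed

section \<open>Sparse minimisers\<close>

definition Iobs :: "(nat \<times> 'm) set" where
  "Iobs = {0..T} \<times> UNIV"

lemma Iobs: "finite Iobs" "card Iobs = CARD('m) * (T + 1)"
  by (simp_all add: Iobs_def card_cartesian_product)

text \<open>\<open>enn2real\<close> sends infinity to 0, so sums of \<open>wr\<close> and
  \<open>\<phi>r\<close> represent integrals only over atoms from this set.\<close>

definition finite_curves :: "'a curve set" where
  "finite_curves = {\<gamma> \<in> \<Gamma>. w \<gamma> < top \<and> \<phi> \<gamma> < top}"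

abbreviation "wr \<gamma> \<equiv> enn2real (w \<gamma>)"
abbreviation "\<phi>r \<gamma> \<equiv> enn2real (\<phi> \<gamma>)"

lemma discrete_energy:
  assumes S: "finite S" "S \<subseteq> finite_curves" and c: "\<forall>\<gamma>\<in>S. 0 \<le> c \<gamma>"
  shows "E (atomic_measure S c) = ereal ((\<Sum>j=0..T. F j (\<chi> i. \<Sum>\<gamma>\<in>S. c \<gamma> * observable (j, i) \<gamma>)) + (\<Sum>\<gamma>\<in>S. c \<gamma> * wr \<gamma>))"
    and "(\<integral>\<^sup>+\<gamma>. \<phi> \<gamma> \<partial>to_measure X (atomic_measure S c)) = ennreal (\<Sum>\<gamma>\<in>S. c \<gamma> * \<phi>r \<gamma>)"
    and "atomic_measure S c \<in> D \<longleftrightarrow> (\<Sum>\<gamma>\<in>S. c \<gamma> * \<phi>r \<gamma>) \<le> 1"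
proof -
  have S': "S \<subseteq> \<Gamma>" "\<And>\<gamma>. \<gamma> \<in> S \<Longrightarrow> w \<gamma> < top" "\<And>\<gamma>. \<gamma> \<in> S \<Longrightarrow> \<phi> \<gamma> < top"
    using S(2) by (auto simp: finite_curves_def)
  note n = discrete_nonneg[of S c, OF S(1) S'(1) c]
  have "fidelity \<Omega> X T t a F (atomic_measure S c) = (\<Sum>j=0..T. F j (\<chi> i. \<Sum>\<gamma>\<in>S. c \<gamma> * observable (j, i) \<gamma>))"
    unfolding fidelity_eq[OF nonneg_measuresD(1)[OF n]]
    using signed_integral_discrete[of S c, OF S(1) S'(1) c observable] by (intro sum.cong) auto
  moreover have "regulariser X w (atomic_measure S c) = ennreal (\<Sum>\<gamma>\<in>S. c \<gamma> * wr \<gamma>)"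
    unfolding regulariser_def
    by (rule nn_integral_discrete_finite[of S c, OF S(1) S'(1) c borel_measurable_lower_semicontinuous[OF w] S'(2)])
  moreover have "0 \<le> (\<Sum>\<gamma>\<in>S. c \<gamma> * wr \<gamma>)"
    using c by (intro sum_nonneg) auto
  ultimately show "E (atomic_measure S c) = ereal ((\<Sum>j=0..T. F j (\<chi> i. \<Sum>\<gamma>\<in>S. c \<gamma> * observable (j, i) \<gamma>)) + (\<Sum>\<gamma>\<in>S. c \<gamma> * wr \<gamma>))"
    by (simp add: energy_def)
  show *: "(\<integral>\<^sup>+\<gamma>. \<phi> \<gamma> \<partial>to_measure X (atomic_measure S c)) = ennreal (\<Sum>\<gamma>\<in>S. c \<gamma> * \<phi>r \<gamma>)"
    by (rule nn_integral_discrete_finite[of S c, OF S(1) S'(1) c borel_measurable_lower_semicontinuous[OF \<phi>] S'(3)])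
  show "atomic_measure S c \<in> D \<longleftrightarrow> (\<Sum>\<gamma>\<in>S. c \<gamma> * \<phi>r \<gamma>) \<le> 1"
    using n * by (simp add: admissible_def)
qed

text \<open>The integrals of \<open>w\<close> and \<open>\<phi>\<close> against \<sigma> are finite,
  so almost every curve lies in \<open>finite_curves\<close>, where \<open>wr\<close> and
  \<open>\<phi>r\<close> can serve as two further moments next to the observables. Atoms can then be
  chosen among these curves.\<close>

lemma discrete_minimiser_exists:
  assumes \<sigma>: "\<sigma> \<in> D" "E \<sigma> < top"
  shows "\<exists>S c. finite S \<and> S \<subseteq> finite_curves \<and> (\<forall>\<gamma>. 0 \<le> c \<gamma>) \<and> atomic_measure S c \<in> D \<and> E (atomic_measure S c) = E \<sigma>"
proof -
  let ?M = "to_measure X \<sigma>"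
  have \<sigma>': "\<sigma> \<in> nonneg_measures X"
    using \<sigma>(1) admissible_nonneg by blast
  note M = finite_borel_measure_to_measure(1)[OF \<sigma>']
  have sp: "space ?M = \<Gamma>"
    using finite_borel_measureD(3)[OF M] topspace_X by simp
  note meas[measurable] = measurable_to_measure[OF \<sigma>']
  have wfin: "(\<integral>\<^sup>+\<gamma>. w \<gamma> \<partial>?M) \<noteq> \<infinity>"
    using \<sigma>(2) by (auto simp: energy_def regulariser_def top_ereal_def)
  have \<phi>le: "(\<integral>\<^sup>+\<gamma>. \<phi> \<gamma> \<partial>?M) \<le> 1"
    using \<sigma>(1) by (simp add: admissible_def)
  then have \<phi>fin: "(\<integral>\<^sup>+\<gamma>. \<phi> \<gamma> \<partial>?M) \<noteq> \<infinity>"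
    by (auto simp: top_unique)
  have AEw: "AE \<gamma> in ?M. w \<gamma> \<noteq> \<infinity>"
    by (rule nn_integral_PInf_AE[OF meas(1) wfin])
  have AE\<phi>: "AE \<gamma> in ?M. \<phi> \<gamma> \<noteq> \<infinity>"
    by (rule nn_integral_PInf_AE[OF meas(2) \<phi>fin])
  have AE: "AE \<gamma> in ?M. \<gamma> \<in> finite_curves"
    using AEw AE\<phi> AE_space by eventually_elim (auto simp: finite_curves_def sp top.not_eq_extremum)
  have nnw: "(\<integral>\<^sup>+\<gamma>. ennreal (wr \<gamma>) \<partial>?M) = (\<integral>\<^sup>+\<gamma>. w \<gamma> \<partial>?M)"
    using AEw by (intro nn_integral_cong_AE) (auto elim!: eventually_mono simp: top.not_eq_extremum)
  have nn\<phi>: "(\<integral>\<^sup>+\<gamma>. ennreal (\<phi>r \<gamma>) \<partial>?M) = (\<integral>\<^sup>+\<gamma>. \<phi> \<gamma> \<partial>?M)"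
    using AE\<phi> by (intro nn_integral_cong_AE) (auto elim!: eventually_mono simp: top.not_eq_extremum)
  have intw: "integrable ?M wr"
    using wfin nnw by (intro integrableI_nonneg) (auto simp: top.not_eq_extremum)
  have int\<phi>: "integrable ?M \<phi>r"
    using \<phi>fin nn\<phi> by (intro integrableI_nonneg) (auto simp: top.not_eq_extremum)
  define g where "g = case_sum observable (\<lambda>b. if b then wr else \<phi>r)"
  define I where "I = Inl ` Iobs \<union> {Inr True, Inr False}"
  have "finite I"
    by (simp add: I_def Iobs)
  moreover have "integrable ?M (g i)" if "i \<in> I" for i
    using that intw int\<phi> integrable_bounded_continuous[OF observable M]
    by (auto simp: I_def g_def Iobs_def)
  ultimately obtain S c where S: "finite S" "S \<subseteq> finite_curves" "\<forall>\<gamma>. 0 \<le> c \<gamma>"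
    and mom: "\<And>i. i \<in> I \<Longrightarrow> (\<Sum>\<gamma>\<in>S. c \<gamma> * g i \<gamma>) = integral\<^sup>L ?M (g i)"
    using finitely_supported_moments[OF _ AE, of I g] by blast
  have c: "\<forall>\<gamma>\<in>S. 0 \<le> c \<gamma>"
    using S(3) by blast
  have obs: "(\<Sum>\<gamma>\<in>S. c \<gamma> * observable (j, i) \<gamma>) = signed_integral X \<sigma> (observable (j, i))" if "j \<le> T" for i j
    using mom[of "Inl (j, i)"] that
    by (simp add: I_def g_def Iobs_def signed_integral_nonneg_measure[OF \<sigma>'])
  have mw: "(\<Sum>\<gamma>\<in>S. c \<gamma> * wr \<gamma>) = integral\<^sup>L ?M wr"
    using mom[of "Inr True"] by (simp add: I_def g_def)
  have m\<phi>: "(\<Sum>\<gamma>\<in>S. c \<gamma> * \<phi>r \<gamma>) = integral\<^sup>L ?M \<phi>r"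
    using mom[of "Inr False"] by (simp add: I_def g_def)
  have "ennreal (integral\<^sup>L ?M \<phi>r) \<le> ennreal 1"
    using \<phi>le nn_integral_eq_integral[OF int\<phi>] nn\<phi> by simp
  then have "atomic_measure S c \<in> D"
    unfolding discrete_energy(3)[of S c, OF S(1,2) c] m\<phi> by (subst (asm) ennreal_le_iff) auto
  moreover have "E (atomic_measure S c) = E \<sigma>"
  proof -
    have "regulariser X w \<sigma> = ennreal (integral\<^sup>L ?M wr)"
      using nn_integral_eq_integral[OF intw] nnw by (simp add: regulariser_def)
    moreover have "0 \<le> integral\<^sup>L ?M wr"
      by (intro integral_nonneg_AE) simp
    moreover have "(\<Sum>j=0..T. F j (\<chi> i. \<Sum>\<gamma>\<in>S. c \<gamma> * observable (j, i) \<gamma>)) = fidelity \<Omega> X T t a F \<sigma>"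
      unfolding fidelity_eq[OF nonneg_measuresD(1)[OF \<sigma>']] using obs by (intro sum.cong) auto
    ultimately show ?thesis
      unfolding discrete_energy(1)[of S c, OF S(1,2) c] mw by (simp add: energy_def)
  qed
  ultimately show ?thesis
    using S by blast
qed

text \<open>A direction \<open>d\<close> that fixes the observables can be followed both ways as long as the constraint
  permits; minimality makes \<open>w\<close> constant along it. Followed in the sense in which \<open>\<phi>\<close> does not
  increase, it makes a coefficient vanish.\<close>

lemma remove_atom:
  assumes r: "0 < r" "\<And>\<gamma>. \<gamma> \<in> \<Gamma> \<Longrightarrow> ennreal r \<le> \<phi> \<gamma>"
    and S: "finite S" "S \<subseteq> finite_curves" and c: "\<And>\<gamma>. \<gamma> \<in> S \<Longrightarrow> 0 < c \<gamma>"
    and adm: "atomic_measure S c \<in> D" and min: "\<And>\<tau>. \<tau> \<in> D \<Longrightarrow> E (atomic_measure S c) \<le> E \<tau>"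
    and d: "\<exists>\<gamma>\<in>S. d \<gamma> \<noteq> 0" "\<And>k. k \<in> Iobs \<Longrightarrow> (\<Sum>\<gamma>\<in>S. d \<gamma> * observable k \<gamma>) = 0"
    and slack: "(\<Sum>\<gamma>\<in>S. d \<gamma> * \<phi>r \<gamma>) = 0 \<or> (\<Sum>\<gamma>\<in>S. c \<gamma> * \<phi>r \<gamma>) < 1"
  shows "\<exists>c' \<gamma>. \<gamma> \<in> S \<and> (\<forall>\<gamma>\<in>S. 0 \<le> c' \<gamma>) \<and> atomic_measure (S - {\<gamma>}) c' \<in> D \<and> E (atomic_measure (S - {\<gamma>}) c') = E (atomic_measure S c)"
proof -
  define fid where "fid c = (\<Sum>j=0..T. F j (\<chi> i. \<Sum>\<gamma>\<in>S. c \<gamma> * observable (j, i) \<gamma>))" for c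
  define W where "W c = (\<Sum>\<gamma>\<in>S. c \<gamma> * wr \<gamma>)" for c
  define \<Phi> where "\<Phi> c = (\<Sum>\<gamma>\<in>S. c \<gamma> * \<phi>r \<gamma>)" for c
  have c0: "\<forall>\<gamma>\<in>S. 0 \<le> c \<gamma>"
    using c less_imp_le by blast
  have move: "fid (\<lambda>\<gamma>. c \<gamma> + s * d \<gamma>) = fid c" "W (\<lambda>\<gamma>. c \<gamma> + s * d \<gamma>) = W c + s * W d"
    "\<Phi> (\<lambda>\<gamma>. c \<gamma> + s * d \<gamma>) = \<Phi> c + s * \<Phi> d" for s
  proof -
    have lin: "(\<Sum>\<gamma>\<in>S. (c \<gamma> + s * d \<gamma>) * f \<gamma>) = (\<Sum>\<gamma>\<in>S. c \<gamma> * f \<gamma>) + s * (\<Sum>\<gamma>\<in>S. d \<gamma> * f \<gamma>)" for f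
      by (simp add: distrib_right sum.distrib sum_distrib_left mult.assoc)
    show "fid (\<lambda>\<gamma>. c \<gamma> + s * d \<gamma>) = fid c"
      unfolding fid_def lin using d(2) by (intro sum.cong) (auto simp: Iobs_def)
    show "W (\<lambda>\<gamma>. c \<gamma> + s * d \<gamma>) = W c + s * W d" "\<Phi> (\<lambda>\<gamma>. c \<gamma> + s * d \<gamma>) = \<Phi> c + s * \<Phi> d"
      unfolding W_def \<Phi>_def by (rule lin)+
  qed
  have \<Phi>c: "\<Phi> c \<le> 1"
    using adm discrete_energy(3)[of S c, OF S c0] by (simp add: \<Phi>_def)
  have step: "0 \<le> s * W d" if nn: "\<forall>\<gamma>\<in>S. 0 \<le> c \<gamma> + s * d \<gamma>" and le: "\<Phi> c + s * \<Phi> d \<le> 1" for s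
  proof -
    have "atomic_measure S (\<lambda>\<gamma>. c \<gamma> + s * d \<gamma>) \<in> D"
      using le move(3)[of s] discrete_energy(3)[of S "\<lambda>\<gamma>. c \<gamma> + s * d \<gamma>", OF S nn] by (simp add: \<Phi>_def)
    from min[OF this] show ?thesis
      using move(1,2)[of s] discrete_energy(1)[of S "\<lambda>\<gamma>. c \<gamma> + s * d \<gamma>", OF S nn] discrete_energy(1)[of S c, OF S c0]
      by (simp add: fid_def W_def)
  qed
  have Wd: "W d = 0"
  proof -
    have "\<exists>s>0. (\<forall>\<gamma>\<in>S. \<bar>s * d \<gamma>\<bar> \<le> c \<gamma>) \<and> \<Phi> c + \<bar>s * \<Phi> d\<bar> \<le> 1"
    proof -
      \<comment> \<open>Up to q all weights stay non-negative in both directions; the 1 in the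
        denominator admits \<open>d \<gamma> = 0\<close>.\<close>
      define q where "q = Min (insert 1 ((\<lambda>\<gamma>. c \<gamma> / (\<bar>d \<gamma>\<bar> + 1)) ` S))"
      have q: "0 < q" "\<And>\<gamma>. \<gamma> \<in> S \<Longrightarrow> q \<le> c \<gamma> / (\<bar>d \<gamma>\<bar> + 1)"
        using S(1) c by (auto simp: q_def Min_gr_iff add_nonneg_pos)
      \<comment> \<open>If the direction changes the integral of \<open>\<phi>\<close>, then
        \<open>slack\<close> leaves positive room below 1; otherwise the constraint does not limit
        s.\<close>
      define s where "s = (if \<Phi> d = 0 then q else min q ((1 - \<Phi> c) / \<bar>\<Phi> d\<bar>))"
      have s: "0 < s" "s \<le> q"
        using q(1) slack by (auto simp: s_def \<Phi>_def)
      have "\<bar>s * d \<gamma>\<bar> \<le> c \<gamma>" if "\<gamma> \<in> S" for \<gamma>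
      proof -
        have "\<bar>s * d \<gamma>\<bar> \<le> q * (\<bar>d \<gamma>\<bar> + 1)"
          unfolding abs_mult using s by (intro mult_mono) auto
        also have "\<dots> \<le> c \<gamma>"
          using q(2)[OF that] by (simp add: pos_le_divide_eq add_nonneg_pos)
        finally show ?thesis .
      qed
      moreover have "\<bar>s * \<Phi> d\<bar> \<le> 1 - \<Phi> c"
      proof (cases "\<Phi> d = 0")
        case False
        then have "s \<le> (1 - \<Phi> c) / \<bar>\<Phi> d\<bar>"
          by (simp add: s_def)
        then show ?thesis
          using False s(1) by (simp add: abs_mult pos_le_divide_eq)
      qed (use \<Phi>c in simp)
      ultimately show ?thesis
        using s(1) by (intro exI[of _ s]) auto
    qed
    then obtain s where s: "0 < s" "\<And>\<gamma>. \<gamma> \<in> S \<Longrightarrow> \<bar>s * d \<gamma>\<bar> \<le> c \<gamma>" "\<Phi> c + \<bar>s * \<Phi> d\<bar> \<le> 1"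
      by blast
    \<comment> \<open>Steps of length s and -s are both admissible, so minimality bounds
      \<open>W d\<close> from both sides.\<close>
    have "0 \<le> s * W d"
      using s(3) abs_le_D2[OF s(2)] by (intro step) (force, linarith)
    moreover have "0 \<le> - s * W d"
      using s(3) abs_le_D1[OF s(2)] by (intro step) (force, linarith)
    ultimately show ?thesis
      using s(1) by (simp add: zero_le_mult_iff mult_le_0_iff)
  qed
  \<comment> \<open>The orientation along which the integral of \<open>\<phi>\<close> does not
    increase: a long move stays admissible.\<close>
  obtain \<epsilon> :: real where \<epsilon>: "\<epsilon> \<noteq> 0" "\<epsilon> * \<Phi> d \<le> 0"
    by (cases "\<Phi> d \<le> 0") (auto intro: that[of 1] that[of "-1"])
  have \<phi>pos: "0 < \<phi>r \<gamma>" if "\<gamma> \<in> S" for \<gamma>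
  proof -
    have "\<phi> \<gamma> < top" "ennreal r \<le> \<phi> \<gamma>"
      using that S(2) r(2) by (auto simp: finite_curves_def)
    moreover from this have "0 < \<phi> \<gamma>"
      using r(1) by (auto intro: less_le_trans[of 0 "ennreal r"])
    ultimately show ?thesis
      by (simp add: enn2real_positive_iff)
  qed
  define N where "N = {\<gamma> \<in> S. \<epsilon> * d \<gamma> < 0}"
  \<comment> \<open>Here strict positivity of \<open>\<phi>\<close> on the atoms enters: if no
    weight decreased, the integral of \<open>\<phi>\<close> would strictly increase.\<close>
  have "N \<noteq> {}"
  proof
    assume "N = {}"
    then have nn: "0 \<le> \<epsilon> * d \<gamma>" if "\<gamma> \<in> S" for \<gamma>
      using that by (force simp: N_def)
    obtain \<gamma>0 where \<gamma>0: "\<gamma>0 \<in> S" "d \<gamma>0 \<noteq> 0"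
      using d(1) by blast
    have "0 < (\<Sum>\<gamma>\<in>S. (\<epsilon> * d \<gamma>) * \<phi>r \<gamma>)"
    proof (rule sum_pos2[OF S(1) \<gamma>0(1)])
      show "0 < \<epsilon> * d \<gamma>0 * \<phi>r \<gamma>0"
        using \<epsilon>(1) \<gamma>0 nn[OF \<gamma>0(1)] \<phi>pos[OF \<gamma>0(1)] by (simp add: less_le)
    qed (use nn in simp)
    then show False
      using \<epsilon>(2) by (simp add: \<Phi>_def sum_distrib_left mult.assoc)
  qed
  \<comment> \<open>The first time at which a weight reaches zero along \<epsilon> * d.\<close>
  define \<theta> where "\<theta> = Min ((\<lambda>\<gamma>. c \<gamma> / - (\<epsilon> * d \<gamma>)) ` N)"
  have N: "finite N" "N \<subseteq> S"
    using S(1) by (auto simp: N_def)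
  have "\<theta> \<in> (\<lambda>\<gamma>. c \<gamma> / - (\<epsilon> * d \<gamma>)) ` N"
    unfolding \<theta>_def using N \<open>N \<noteq> {}\<close> by (intro Min_in) auto
  then obtain \<gamma>1 where \<gamma>1: "\<gamma>1 \<in> N" "\<theta> = c \<gamma>1 / - (\<epsilon> * d \<gamma>1)"
    by blast
  have \<theta>_le: "\<theta> \<le> c \<gamma> / - (\<epsilon> * d \<gamma>)" if "\<gamma> \<in> N" for \<gamma>
    unfolding \<theta>_def using N that by (intro Min_le) auto
  have \<theta>: "0 < \<theta>"
    unfolding \<gamma>1(2) using \<gamma>1(1) c by (intro divide_pos_pos) (auto simp: N_def)
  define c' where "c' \<gamma> = c \<gamma> + (\<theta> * \<epsilon>) * d \<gamma>" for \<gamma>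
  have c'0: "0 \<le> c' \<gamma>" if "\<gamma> \<in> S" for \<gamma>
  proof (cases "\<gamma> \<in> N")
    case True
    then have "\<theta> * - (\<epsilon> * d \<gamma>) \<le> c \<gamma>"
      using \<theta>_le[OF True] by (subst (asm) pos_le_divide_eq) (auto simp: N_def)
    then show ?thesis
      by (simp add: c'_def)
  next
    case False
    then have "0 \<le> \<epsilon> * d \<gamma>"
      using that by (auto simp: N_def)
    then have "0 \<le> \<theta> * (\<epsilon> * d \<gamma>)"
      using \<theta> by simp
    then show ?thesis
      using c[OF that] by (simp add: c'_def mult.assoc)
  qed
  then have c'0: "\<forall>\<gamma>\<in>S. 0 \<le> c' \<gamma>"
    by blast
  have c'1: "c' \<gamma>1 = 0"
    using \<gamma>1 by (auto simp: c'_def N_def)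
  have eq: "atomic_measure (S - {\<gamma>1}) c' = atomic_measure S c'"
  proof
    fix B
    have "\<gamma>1 \<in> S"
      using \<gamma>1(1) N(2) by blast
    from sum.remove[OF S(1) this, of "\<lambda>\<gamma>. c' \<gamma> * dirac X \<gamma> B"]
    show "atomic_measure (S - {\<gamma>1}) c' B = atomic_measure S c' B"
      by (simp add: atomic_measure_def c'1)
  qed
  have "\<theta> * \<epsilon> * \<Phi> d \<le> 0"
    using \<theta> \<epsilon>(2) by (simp add: mult.assoc mult_le_0_iff)
  then have "\<Phi> c' \<le> 1"
    using \<Phi>c unfolding c'_def move(3) by linarith
  then have "atomic_measure S c' \<in> D"
    using discrete_energy(3)[of S c', OF S c'0] by (simp add: \<Phi>_def)
  moreover have "E (atomic_measure S c') = E (atomic_measure S c)"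
    unfolding discrete_energy(1)[of S c', OF S c'0] discrete_energy(1)[of S c, OF S c0]
    using move(1,2)[of "\<theta> * \<epsilon>"] Wd by (simp add: fid_def W_def c'_def)
  ultimately show ?thesis
    using c'0 \<gamma>1(1) N(2) unfolding eq[symmetric] by blast
qed

text \<open>\<open>P\<close> admits zero weights so that the outcome of \<open>remove_atom\<close>
  is again a candidate; leastness of the number of atoms then makes all weights positive and
  excludes every direction that \<open>remove_atom\<close> could use.\<close>

lemma sparse_minimiser_exists:
  assumes sub: "compact_sublevel_sets X w \<or> compact_sublevel_sets X \<phi>"
    and r: "0 < r" "\<And>\<gamma>. \<gamma> \<in> \<Gamma> \<Longrightarrow> ennreal r \<le> \<phi> \<gamma>"
  obtains S c where "finite S" "S \<subseteq> \<Gamma>" "\<And>\<gamma>. \<gamma> \<in> S \<Longrightarrow> 0 < c \<gamma>" "atomic_measure S c \<in> D"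
    "\<And>\<tau>. \<tau> \<in> D \<Longrightarrow> E (atomic_measure S c) \<le> E \<tau>" "card S \<le> CARD('m) * (T + 1) + 1"
    "(\<integral>\<^sup>+\<gamma>. \<phi> \<gamma> \<partial>to_measure X (atomic_measure S c)) < 1 \<Longrightarrow> card S \<le> CARD('m) * (T + 1)"
proof -
  obtain \<sigma> where \<sigma>: "\<sigma> \<in> D" "E \<sigma> < top" "\<And>\<tau>. \<tau> \<in> D \<Longrightarrow> E \<sigma> \<le> E \<tau>"
    using energy_minimiser_exists[OF sub r] by blast
  define P where "P n \<longleftrightarrow> (\<exists>S c. finite S \<and> S \<subseteq> finite_curves \<and> (\<forall>\<gamma>\<in>S. 0 \<le> c \<gamma>) \<and>
    atomic_measure S c \<in> D \<and> E (atomic_measure S c) = E \<sigma> \<and> card S = n)" for n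
  have "\<exists>n. P n"
    unfolding P_def using discrete_minimiser_exists[OF \<sigma>(1,2)] by blast
  then have least: "P (LEAST n. P n)"
    by (rule LeastI_ex)
  then obtain S c where S: "finite S" "S \<subseteq> finite_curves" and c0: "\<forall>\<gamma>\<in>S. 0 \<le> c \<gamma>"
    and adm: "atomic_measure S c \<in> D" and En: "E (atomic_measure S c) = E \<sigma>" and card: "card S = (LEAST n. P n)"
    unfolding P_def by blast
  have no: False if "\<gamma> \<in> S" "\<forall>\<gamma>\<in>S. 0 \<le> c' \<gamma>" "atomic_measure (S - {\<gamma>}) c' \<in> D"
    "E (atomic_measure (S - {\<gamma>}) c') = E \<sigma>" for \<gamma> c'
  proof -
    have "P (card (S - {\<gamma>}))"
      unfolding P_def using that S by (intro exI[of _ "S - {\<gamma>}"] exI[of _ c']) auto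
    then have "card S \<le> card (S - {\<gamma>})"
      unfolding card by (rule Least_le)
    then show False
      using card_Diff1_less[OF S(1) that(1)] by simp
  qed
  have c: "0 < c \<gamma>" if \<gamma>: "\<gamma> \<in> S" for \<gamma>
  proof (rule ccontr)
    assume "\<not> 0 < c \<gamma>"
    then have "c \<gamma> = 0"
      using c0 \<gamma> by fastforce
    then have "atomic_measure (S - {\<gamma>}) c = atomic_measure S c"
      by (simp add: atomic_measure_def fun_eq_iff sum.remove[OF S(1) \<gamma>])
    then show False
      using no[of \<gamma> c, OF \<gamma> c0] adm En by simp
  qed
  have min: "E (atomic_measure S c) \<le> E \<tau>" if "\<tau> \<in> D" for \<tau>
    using \<sigma>(3)[OF that] En by simp
  have indep: False if "\<exists>\<gamma>\<in>S. d \<gamma> \<noteq> 0" "\<And>k. k \<in> Iobs \<Longrightarrow> (\<Sum>\<gamma>\<in>S. d \<gamma> * observable k \<gamma>) = 0"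
    "(\<Sum>\<gamma>\<in>S. d \<gamma> * \<phi>r \<gamma>) = 0 \<or> (\<Sum>\<gamma>\<in>S. c \<gamma> * \<phi>r \<gamma>) < 1" for d
    using remove_atom[OF r S c adm min that] no En by metis
  have "card S \<le> CARD('m) * (T + 1) + 1"
  proof (rule ccontr)
    assume contra: "\<not> ?thesis"
    \<comment> \<open>\<open>None\<close> stands for the equation that keeps the integral of
      \<open>\<phi>\<close> fixed; it is the origin of the summand 1 in the bound.\<close>
    let ?I = "insert None (Some ` Iobs)"
    have "card ?I = CARD('m) * (T + 1) + 1"
      using Iobs by (simp add: card_image)
    then have "finite ?I" "card ?I < card S"
      using Iobs contra by simp_all
    from homogeneous_system_nontrivial_solution[OF this(1) S(1) this(2), of "case_option \<phi>r observable"]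
    obtain d where d: "\<exists>\<gamma>\<in>S. d \<gamma> \<noteq> 0" "\<forall>i\<in>?I. (\<Sum>\<gamma>\<in>S. d \<gamma> * (case_option \<phi>r observable i) \<gamma>) = 0"
      by blast
    show False
      using d(2) by (intro indep[OF d(1)]) auto
  qed
  moreover have "card S \<le> CARD('m) * (T + 1)"
    if "(\<integral>\<^sup>+\<gamma>. \<phi> \<gamma> \<partial>to_measure X (atomic_measure S c)) < 1"
  proof (rule ccontr)
    assume contra: "\<not> ?thesis"
    have lt: "(\<Sum>\<gamma>\<in>S. c \<gamma> * \<phi>r \<gamma>) < 1"
      using that discrete_energy(2)[of S c, OF S c0] by (simp add: ennreal_less_one_iff)
    have "card Iobs < card S"
      using contra Iobs by simp
    \<comment> \<open>With a strict constraint the equation for \<open>\<phi>\<close> is dropped,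
      which saves one atom.\<close>
    from homogeneous_system_nontrivial_solution[OF Iobs(1) S(1) this, of observable]
    obtain d where d: "\<exists>\<gamma>\<in>S. d \<gamma> \<noteq> 0" "\<forall>i\<in>Iobs. (\<Sum>\<gamma>\<in>S. d \<gamma> * observable i \<gamma>) = 0"
      by blast
    show False
      using d(2) lt by (intro indep[OF d(1)]) auto
  qed
  moreover have "S \<subseteq> \<Gamma>"
    using S(2) by (auto simp: finite_curves_def)
  ultimately show ?thesis
    using that[of S c] S(1) c adm min by blast
qed

end

theorem theorem3p1:
  fixes \<Omega> :: "(real ^ 'd::finite) set"
    and \<Gamma> :: "(real ^ 'd) curve set"
    and w \<phi> :: "(real ^ 'd) curve \<Rightarrow> ennreal"
    and T :: nat
    and t :: "nat \<Rightarrow> real"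
    and a :: "nat \<Rightarrow> 'm::finite \<Rightarrow> real ^ 'd \<Rightarrow> real"
    and F :: "nat \<Rightarrow> real ^ 'm \<Rightarrow> real"
  defines "X \<equiv> subtopology (Gamma_inf_top \<Omega>) \<Gamma>"
  defines "D \<equiv> admissible X \<phi>"
  defines "E \<equiv> energy \<Omega> X T t a F w"
  assumes "open \<Omega>" "bounded \<Omega>" "convex \<Omega>"
    and "closedin (Gamma_inf_top \<Omega>) \<Gamma>"
    and "\<And>j. j \<le> T \<Longrightarrow> t j \<in> {0..1}"
    and "\<And>i j. j \<le> T \<Longrightarrow> continuous_on (closure \<Omega>) (a j i)"
    and "\<And>j. j \<le> T \<Longrightarrow> C2_function (F j)"
    and "\<And>j. j \<le> T \<Longrightarrow> convex_on UNIV (F j)"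
    and "\<And>j y. j \<le> T \<Longrightarrow> 0 \<le> F j y"
    and "lower_semicontinuous_map X w" "lower_semicontinuous_map X \<phi>"
  shows "lower_semicontinuous_map (narrow_topology X) (fidelity \<Omega> X T t a F) \<and>
    lower_semicontinuous_map (subtopology (narrow_topology X) D) E \<and>
    ((compact_sublevel_sets X w \<or> compact_sublevel_sets X \<phi>) \<and> (INF \<gamma>\<in>\<Gamma>. \<phi> \<gamma>) > 0 \<longrightarrow>
      compact_sublevel_sets (subtopology (narrow_topology X) D) E \<and>
      (\<exists>\<sigma> s c \<gamma>.
         is_arg_min E (\<lambda>\<sigma>. \<sigma> \<in> D) \<sigma> \<and>
         (\<forall>i\<in>{1..s}. c i \<ge> 0 \<and> \<gamma> i \<in> \<Gamma>) \<and>
         \<sigma> = (\<lambda>B. \<Sum>i=1..s. c i * dirac X (\<gamma> i) B) \<and>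
         s \<le> CARD('m) * (T + 1) + 1 \<and>
         ((\<integral>\<^sup>+\<gamma>. \<phi> \<gamma> \<partial>to_measure X \<sigma>) < 1 \<longrightarrow> s \<le> CARD('m) * (T + 1))))"
proof -
  interpret energy_minimisation \<Omega> \<Gamma> X w \<phi> T t a F
    using assms by unfold_locales (auto simp: X_def)
  show ?thesis
    unfolding D_def E_def
  proof (intro conjI impI)
    show "lower_semicontinuous_map (narrow_topology X) (fidelity \<Omega> X T t a F)"
      by (rule lower_semicontinuous_fidelity)
    show "lower_semicontinuous_map (subtopology (narrow_topology X) (admissible X \<phi>)) (energy \<Omega> X T t a F w)"
      by (rule lower_semicontinuous_energy[OF admissible_nonneg])
    assume hyp: "(compact_sublevel_sets X w \<or> compact_sublevel_sets X \<phi>) \<and> 0 < (INF \<gamma>\<in>\<Gamma>. \<phi> \<gamma>)"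
    \<comment> \<open>The infimum may be infinite, for instance when \<Gamma> is empty; the minimum
      with 1 has a real value.\<close>
    define r where "r = enn2real (min 1 (INF \<gamma>\<in>\<Gamma>. \<phi> \<gamma>))"
    have fin: "min 1 (INF \<gamma>\<in>\<Gamma>. \<phi> \<gamma>) < top"
      by (simp add: min_less_iff_disj)
    then have r: "0 < r"
      using hyp by (simp add: r_def enn2real_positive_iff)
    have r_le: "ennreal r \<le> \<phi> \<gamma>" if "\<gamma> \<in> \<Gamma>" for \<gamma>
      using fin INF_lower[OF that, of \<phi>] by (simp add: r_def min.coboundedI2)
    have sub: "compact_sublevel_sets X w \<or> compact_sublevel_sets X \<phi>"
      using hyp by blast
    show "compact_sublevel_sets (subtopology (narrow_topology X) (admissible X \<phi>)) (energy \<Omega> X T t a F w)"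
      by (rule compact_sublevel_sets_energy[OF sub r r_le])
    obtain S c where S: "finite S" "S \<subseteq> \<Gamma>" "\<And>\<gamma>. \<gamma> \<in> S \<Longrightarrow> 0 < c \<gamma>" "atomic_measure S c \<in> admissible X \<phi>"
      "\<And>\<tau>. \<tau> \<in> admissible X \<phi> \<Longrightarrow> energy \<Omega> X T t a F w (atomic_measure S c) \<le> energy \<Omega> X T t a F w \<tau>"
      "card S \<le> CARD('m) * (T + 1) + 1"
      "(\<integral>\<^sup>+\<gamma>. \<phi> \<gamma> \<partial>to_measure X (atomic_measure S c)) < 1 \<Longrightarrow> card S \<le> CARD('m) * (T + 1)"
      using sparse_minimiser_exists[OF sub r r_le] by blast
    obtain \<gamma> where \<gamma>: "bij_betw \<gamma> {1..card S} S"
      using ex_bij_betw_nat_finite_1[OF S(1)] by blast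
    show "\<exists>\<sigma> s c \<gamma>. is_arg_min (energy \<Omega> X T t a F w) (\<lambda>\<sigma>. \<sigma> \<in> admissible X \<phi>) \<sigma> \<and>
         (\<forall>i\<in>{1..s}. c i \<ge> 0 \<and> \<gamma> i \<in> \<Gamma>) \<and>
         \<sigma> = (\<lambda>B. \<Sum>i=1..s. c i * dirac X (\<gamma> i) B) \<and>
         s \<le> CARD('m) * (T + 1) + 1 \<and>
         ((\<integral>\<^sup>+\<gamma>. \<phi> \<gamma> \<partial>to_measure X \<sigma>) < 1 \<longrightarrow> s \<le> CARD('m) * (T + 1))"
    proof (intro exI conjI ballI impI)
      show "is_arg_min (energy \<Omega> X T t a F w) (\<lambda>\<sigma>. \<sigma> \<in> admissible X \<phi>) (atomic_measure S c)"
        using S(4,5) by (auto simp: is_arg_min_def not_less)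
      show "atomic_measure S c = (\<lambda>B. \<Sum>i=1..card S. (c \<circ> \<gamma>) i * dirac X (\<gamma> i) B)"
      proof
        fix B
        show "atomic_measure S c B = (\<Sum>i=1..card S. (c \<circ> \<gamma>) i * dirac X (\<gamma> i) B)"
          using sum.reindex_bij_betw[OF \<gamma>, of "\<lambda>\<gamma>. c \<gamma> * dirac X \<gamma> B"] by (simp add: atomic_measure_def)
      qed
      fix i assume "i \<in> {1..card S}"
      then have "\<gamma> i \<in> S"
        using \<gamma> by (auto simp: bij_betw_def)
      then show "0 \<le> (c \<circ> \<gamma>) i" "\<gamma> i \<in> \<Gamma>"
        using S(2) S(3)[of "\<gamma> i"] by auto
    qed (use S in auto)
  qed
qed

end
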